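(* Let $\mathsf{X}$ be a category with a topological functor $|\text{-}|\colon\mathsf{X}\to\mathsf{Set}$. Then $\mathsf{X}\text{-}\mathsf{Equ}\cong\mathrm{PER}(\mathsf{X},\mathrm{RegMono})$ (equivalence of categories) is a full reflective subcategory of the exact completion $\mathsf{X}_{\mathrm{ex}}$ of $\mathsf{X}$; the reflector preserves finite products and commutes with change of base in the codomain.
   Context: A functor $|\text{-}|\colon\mathsf{X}\to\mathsf{Set}$ is topological if every (possibly large) $|\text{-}|$-structured source $(A\to|X_i|)_i$ has a unique $|\text{-}|$-initial lifting; then $|\text{-}|$ is faithful and $\mathsf{X}$ is complete and cocomplete. $\mathsf{X}\text{-}\mathsf{Equ}$: objects are pairs $\langle X,\equiv_{|X|}\rangle$ with $X$ in $\mathsf{X}$ and $\equiv_{|X|}$ an equivalence relation on $|X|$. A morphism $\langle X,\equiv_{|X|}\rangle\to\langle Y,\equiv_{|Y|}\rangle$ is an equivalence class $[f]$ of $\mathsf{X}$-morphisms $f\colon X\to Y$ such that $x\equiv_{|X|}x'$ implies $|f|(x)\equiv_{|Y|}|f|(x')$, where $f,g$ are equivalent iff for all $x,x'\in|X|$, $x\equiv_{|X|}x'$ implies $|f|(x)\equiv_{|Y|}|g|(x')$; composition and identities are induced from $\mathsf{X}$. The exact completion $\mathsf{X}_{\mathrm{ex}}$: objects are pseudo-equivalence relations on $\mathsf{X}$, i.e. parallel pairs $r_1,r_2\colon X_1\to X_0$ in $\mathsf{X}$ such that: (reflexivity) there is $r\colon X_0\to X_1$ with $r_1\cdot r=1_{X_0}=r_2\cdot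 r$; (symmetry) there is $s\colon X_1\to X_1$ with $r_1\cdot s=r_2$ and $r_2\cdot s=r_1$; (transitivity) if $r_3,r_4\colon X_2\to X_1$ is a pullback with $r_2\cdot r_3=r_1\cdot r_4$, there is $t\colon X_2\to X_1$ with $r_1\cdot t=r_1\cdot r_3$ and $r_2\cdot t=r_2\cdot r_4$. A morphism from $(r_1,r_2\colon X_1\to X_0)$ to $(s_1,s_2\colon Y_1\to Y_0)$ is an equivalence class $[f]$ of morphisms $f\colon X_0\to Y_0$ for which there exists $g\colon X_1\to Y_1$ with $f\cdot r_i=s_i\cdot g$, $i=1,2$; two such $f_1,f_2$ are equivalent iff there is $h\colon X_0\to Y_1$ with $f_i=s_i\cdot h$, $i=1,2$. $\mathrm{PER}(\mathsf{X},\mathrm{RegMono})$ is the full subcategory of $\mathsf{X}_{\mathrm{ex}}$ of those pseudo-equivalence relations for which $\langle r_1,r_2\rangle\colon X_1\to X_0\times X_0$ is a regular monomorphism. A reflector $R\colon\mathsf{X}_{\mathrm{ex}}\to\mathsf{P}$ onto a full reflective subcategory $\mathsf{P}$ commutes with change of base in the codomain if it commutes with pullback along morphisms of $\mathsf{P}$: for every morphism $K\to J$ in $\mathsf{P}$ and every $A\to J$ in $\mathsf{X}_{\mathrm{ex}}$, the canonical morphism $R(A\times_J K)\to R(A)\times_J K$ is an isomorphism. *)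

theory Defs
  imports "HOL-Library.FuncSet" "HOL-Library.Equipollence"
begin

section \<open>Categories, functors, natural isomorphisms\<close>

text \<open>
  Categories are given by hom-sets \<open>Hom C A B\<close>, which need not be disjoint for different
  \<open>(A, B)\<close>; \<open>Comp C A B D g f\<close> is therefore the composite \<open>g \<cdot> f\<close> of
  \<open>f \<in> Hom C A B\<close> and \<open>g \<in> Hom C B D\<close>, with explicit objects.
\<close>

record ('o, 'm) cat =
  Ob :: "'o set"
  Hom :: "'o \<Rightarrow> 'o \<Rightarrow> 'm set"
  Id :: "'o \<Rightarrow> 'm"
  Comp :: "'o \<Rightarrow> 'o \<Rightarrow> 'o \<Rightarrow> 'm \<Rightarrow> 'm \<Rightarrow> 'm"

definition category :: "('o, 'm) cat \<Rightarrow> bool" where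
  "category C \<longleftrightarrow>
     (\<forall>A\<in>Ob C. Id C A \<in> Hom C A A) \<and>
     (\<forall>A\<in>Ob C. \<forall>B\<in>Ob C. \<forall>D\<in>Ob C. \<forall>f\<in>Hom C A B. \<forall>g\<in>Hom C B D.
        Comp C A B D g f \<in> Hom C A D) \<and>
     (\<forall>A\<in>Ob C. \<forall>B\<in>Ob C. \<forall>f\<in>Hom C A B.
        Comp C A A B f (Id C A) = f \<and> Comp C A B B (Id C B) f = f) \<and>
     (\<forall>A\<in>Ob C. \<forall>B\<in>Ob C. \<forall>D\<in>Ob C. \<forall>E\<in>Ob C.
      \<forall>f\<in>Hom C A B. \<forall>g\<in>Hom C B D. \<forall>h\<in>Hom C D E.
        Comp C A B E (Comp C B D E h g) f = Comp C A D E h (Comp C A B D g f))"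

definition iso :: "('o, 'm) cat \<Rightarrow> 'o \<Rightarrow> 'o \<Rightarrow> 'm \<Rightarrow> bool" where
  "iso C A B f \<longleftrightarrow> f \<in> Hom C A B \<and>
     (\<exists>g\<in>Hom C B A. Comp C A B A g f = Id C A \<and> Comp C B A B f g = Id C B)"

record ('o, 'm, 'p, 'n) fct =
  fob :: "'o \<Rightarrow> 'p"
  fhom :: "'o \<Rightarrow> 'o \<Rightarrow> 'm \<Rightarrow> 'n"

definition is_functor ::
  "('o, 'm) cat \<Rightarrow> ('p, 'n) cat \<Rightarrow> ('o, 'm, 'p, 'n) fct \<Rightarrow> bool" where
  "is_functor C D F \<longleftrightarrow> category C \<and> category D \<and>
     (\<forall>A\<in>Ob C. fob F A \<in> Ob D) \<and>
     (\<forall>A\<in>Ob C. \<forall>B\<in>Ob C. \<forall>f\<in>Hom C A B. fhom F A B f \<in> Hom D (fob F A) (fob F B)) \<and>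
     (\<forall>A\<in>Ob C. fhom F A A (Id C A) = Id D (fob F A)) \<and>
     (\<forall>A\<in>Ob C. \<forall>B\<in>Ob C. \<forall>E\<in>Ob C. \<forall>f\<in>Hom C A B. \<forall>g\<in>Hom C B E.
        fhom F A E (Comp C A B E g f) =
          Comp D (fob F A) (fob F B) (fob F E) (fhom F B E g) (fhom F A B f))"

definition id_fct :: "('o, 'm, 'o, 'm) fct" where
  "id_fct = \<lparr>fob = (\<lambda>A. A), fhom = (\<lambda>A B f. f)\<rparr>"

definition comp_fct ::
  "('p, 'n, 'q, 'k) fct \<Rightarrow> ('o, 'm, 'p, 'n) fct \<Rightarrow> ('o, 'm, 'q, 'k) fct" where
  "comp_fct G F = \<lparr>fob = (\<lambda>A. fob G (fob F A)),
     fhom = (\<lambda>A B f. fhom G (fob F A) (fob F B) (fhom F A B f))\<rparr>"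

definition natural_transformation :: "('o, 'm) cat \<Rightarrow> ('p, 'n) cat \<Rightarrow>
    ('o, 'm, 'p, 'n) fct \<Rightarrow> ('o, 'm, 'p, 'n) fct \<Rightarrow> ('o \<Rightarrow> 'n) \<Rightarrow> bool" where
  "natural_transformation C D F G \<tau> \<longleftrightarrow>
     (\<forall>A\<in>Ob C. \<tau> A \<in> Hom D (fob F A) (fob G A)) \<and>
     (\<forall>A\<in>Ob C. \<forall>B\<in>Ob C. \<forall>f\<in>Hom C A B.
        Comp D (fob F A) (fob F B) (fob G B) (\<tau> B) (fhom F A B f) =
        Comp D (fob F A) (fob G A) (fob G B) (fhom G A B f) (\<tau> A))"

definition natural_iso :: "('o, 'm) cat \<Rightarrow> ('p, 'n) cat \<Rightarrow>
    ('o, 'm, 'p, 'n) fct \<Rightarrow> ('o, 'm, 'p, 'n) fct \<Rightarrow> ('o \<Rightarrow> 'n) \<Rightarrow> bool" where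
  "natural_iso C D F G \<tau> \<longleftrightarrow> natural_transformation C D F G \<tau> \<and>
     (\<forall>A\<in>Ob C. iso D (fob F A) (fob G A) (\<tau> A))"

definition equivalent_categories :: "('o, 'm) cat \<Rightarrow> ('p, 'n) cat \<Rightarrow> bool" where
  "equivalent_categories C D \<longleftrightarrow>
     (\<exists>F G \<eta> \<epsilon>. is_functor C D F \<and> is_functor D C G \<and>
        natural_iso C C id_fct (comp_fct G F) \<eta> \<and>
        natural_iso D D (comp_fct F G) id_fct \<epsilon>)"


section \<open>Limits and regular monomorphisms\<close>

definition is_product ::
  "('o, 'm) cat \<Rightarrow> 'i set \<Rightarrow> ('i \<Rightarrow> 'o) \<Rightarrow> 'o \<Rightarrow> ('i \<Rightarrow> 'm) \<Rightarrow> bool" where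
  "is_product C I A P p \<longleftrightarrow> P \<in> Ob C \<and> (\<forall>i\<in>I. A i \<in> Ob C \<and> p i \<in> Hom C P (A i)) \<and>
     (\<forall>Y\<in>Ob C. \<forall>h. (\<forall>i\<in>I. h i \<in> Hom C Y (A i)) \<longrightarrow>
        (\<exists>!u. u \<in> Hom C Y P \<and> (\<forall>i\<in>I. Comp C Y P (A i) (p i) u = h i)))"

definition is_binary_product ::
  "('o, 'm) cat \<Rightarrow> 'o \<Rightarrow> 'o \<Rightarrow> 'o \<Rightarrow> 'm \<Rightarrow> 'm \<Rightarrow> bool" where
  "is_binary_product C A B P p q \<longleftrightarrow>
     is_product C (UNIV :: bool set) (\<lambda>i. if i then A else B) P (\<lambda>i. if i then p else q)"

definition is_pullback :: "('o, 'm) cat \<Rightarrow> 'o \<Rightarrow> 'o \<Rightarrow> 'o \<Rightarrow> 'm \<Rightarrow> 'm \<Rightarrow>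
    'o \<Rightarrow> 'm \<Rightarrow> 'm \<Rightarrow> bool" where
  "is_pullback C A B D f g P p q \<longleftrightarrow> A \<in> Ob C \<and> B \<in> Ob C \<and> D \<in> Ob C \<and> P \<in> Ob C \<and>
     f \<in> Hom C A D \<and> g \<in> Hom C B D \<and> p \<in> Hom C P A \<and> q \<in> Hom C P B \<and>
     Comp C P A D f p = Comp C P B D g q \<and>
     (\<forall>Y\<in>Ob C. \<forall>a\<in>Hom C Y A. \<forall>b\<in>Hom C Y B.
        Comp C Y A D f a = Comp C Y B D g b \<longrightarrow>
        (\<exists>!u. u \<in> Hom C Y P \<and> Comp C Y P A p u = a \<and> Comp C Y P B q u = b))"

definition is_equalizer ::
  "('o, 'm) cat \<Rightarrow> 'o \<Rightarrow> 'o \<Rightarrow> 'm \<Rightarrow> 'm \<Rightarrow> 'o \<Rightarrow> 'm \<Rightarrow> bool" where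
  "is_equalizer C A B f g E e \<longleftrightarrow> A \<in> Ob C \<and> B \<in> Ob C \<and> E \<in> Ob C \<and>
     f \<in> Hom C A B \<and> g \<in> Hom C A B \<and> e \<in> Hom C E A \<and>
     Comp C E A B f e = Comp C E A B g e \<and>
     (\<forall>Y\<in>Ob C. \<forall>h\<in>Hom C Y A. Comp C Y A B f h = Comp C Y A B g h \<longrightarrow>
        (\<exists>!u. u \<in> Hom C Y E \<and> Comp C Y E A e u = h))"

definition regular_mono :: "('o, 'm) cat \<Rightarrow> 'o \<Rightarrow> 'o \<Rightarrow> 'm \<Rightarrow> bool" where
  "regular_mono C E A e \<longleftrightarrow> (\<exists>B f g. is_equalizer C A B f g E e)"


section \<open>Full reflective subcategories\<close>

definition full_subcategory_on :: "('o, 'm) cat \<Rightarrow> 'o set \<Rightarrow> ('o, 'm) cat" where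
  "full_subcategory_on C S = C\<lparr>Ob := S\<rparr>"

definition full_subcategory :: "('o, 'm) cat \<Rightarrow> ('o, 'm) cat \<Rightarrow> bool" where
  "full_subcategory P C \<longleftrightarrow> category P \<and> category C \<and>
     (\<exists>S\<subseteq>Ob C. P = full_subcategory_on C S)"

text \<open>\<open>R\<close> is left adjoint to the inclusion of the full subcategory \<open>P\<close>, with unit \<open>\<eta>\<close>.\<close>

definition reflector ::
  "('o, 'm) cat \<Rightarrow> ('o, 'm) cat \<Rightarrow> ('o, 'm, 'o, 'm) fct \<Rightarrow> ('o \<Rightarrow> 'm) \<Rightarrow> bool" where
  "reflector C P R \<eta> \<longleftrightarrow> full_subcategory P C \<and> is_functor C P R \<and>
     natural_transformation C C id_fct R \<eta> \<and>
     (\<forall>A\<in>Ob C. \<forall>B\<in>Ob P. \<forall>f\<in>Hom C A B.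
        \<exists>!g. g \<in> Hom P (fob R A) B \<and> Comp C A (fob R A) B g (\<eta> A) = f)"

definition full_reflective_subcategory :: "('o, 'm) cat \<Rightarrow> ('o, 'm) cat \<Rightarrow> bool" where
  "full_reflective_subcategory P C \<longleftrightarrow> full_subcategory P C \<and> (\<exists>R \<eta>. reflector C P R \<eta>)"

definition preserves_finite_products ::
  "('o, 'm) cat \<Rightarrow> ('p, 'n) cat \<Rightarrow> ('o, 'm, 'p, 'n) fct \<Rightarrow> bool" where
  "preserves_finite_products C D F \<longleftrightarrow>
     (\<forall>(I :: nat set) A P p. finite I \<longrightarrow> is_product C I A P p \<longrightarrow>
        is_product D I (\<lambda>i. fob F (A i)) (fob F P) (\<lambda>i. fhom F P (A i) (p i)))"

text \<open>
  Below, \<open>(Q, q1, q2)\<close> is \<open>A \<times>\<^sub>J K\<close>; \<open>f'\<close> and \<open>q2'\<close> are the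
  morphisms \<open>R A \<rightarrow> J\<close> and \<open>R Q \<rightarrow> K\<close> corresponding to \<open>f\<close> and \<open>q2\<close>
  under the adjunction (as \<open>J\<close> and \<open>K\<close> lie in the subcategory); \<open>(T, t1, t2)\<close>
  is \<open>R A \<times>\<^sub>J K\<close>, and \<open>c\<close> is the canonical morphism.
  The second pullback is taken in \<open>C\<close>; as the inclusion is a right adjoint, this
  covers pullbacks formed in \<open>P\<close>.
\<close>

definition commutes_with_codomain_base_change ::
  "('o, 'm) cat \<Rightarrow> ('o, 'm) cat \<Rightarrow> ('o, 'm, 'o, 'm) fct \<Rightarrow> ('o \<Rightarrow> 'm) \<Rightarrow> bool" where
  "commutes_with_codomain_base_change C P R \<eta> \<longleftrightarrow>
     (\<forall>J\<in>Ob P. \<forall>K\<in>Ob P. \<forall>k\<in>Hom P K J. \<forall>A\<in>Ob C. \<forall>f\<in>Hom C A J.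
      \<forall>Q q1 q2. is_pullback C A K J f k Q q1 q2 \<longrightarrow>
      (\<forall>f'\<in>Hom P (fob R A) J. \<forall>q2'\<in>Hom P (fob R Q) K.
         Comp C A (fob R A) J f' (\<eta> A) = f \<longrightarrow>
         Comp C Q (fob R Q) K q2' (\<eta> Q) = q2 \<longrightarrow>
         (\<forall>T t1 t2. is_pullback C (fob R A) K J f' k T t1 t2 \<longrightarrow>
            (\<exists>c\<in>Hom C (fob R Q) T.
               Comp C (fob R Q) T (fob R A) t1 c = fhom R Q A q1 \<and>
               Comp C (fob R Q) T K t2 c = q2' \<and>
               iso C (fob R Q) T c))))"


section \<open>The category of sets and topological functors\<close>

text \<open>
  HOL has no type of all sets, so the category of sets is formed relative to a collection
  \<open>\<U>\<close> of ``small'' sets over some type. Only the closure properties listed here are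
  required, so \<open>\<U>\<close> may be the collection of small sets of a model of ZFC
  or of a Grothendieck universe, or that of all subsets of an infinite type.
\<close>

definition set_universe :: "'u set set \<Rightarrow> bool" where
  "set_universe \<U> \<longleftrightarrow>
     (\<forall>A\<in>\<U>. \<forall>B. B \<subseteq> A \<longrightarrow> B \<in> \<U>) \<and>
     (\<forall>A\<in>\<U>. \<forall>B\<in>\<U>. \<exists>P\<in>\<U>. P \<approx> A \<times> B) \<and>
     (\<exists>A\<in>\<U>. card A = 2)"

definition Set_cat :: "'u set set \<Rightarrow> ('u set, 'u \<Rightarrow> 'u) cat" where
  "Set_cat \<U> = \<lparr>Ob = \<U>, Hom = (\<lambda>A B. A \<rightarrow>\<^sub>E B), Id = (\<lambda>A. \<lambda>x\<in>A. x),
     Comp = (\<lambda>A B D g f. compose A g f)\<rparr>"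

definition initial_source :: "('o, 'm) cat \<Rightarrow> ('p, 'n) cat \<Rightarrow> ('o, 'm, 'p, 'n) fct \<Rightarrow>
    'i set \<Rightarrow> ('i \<Rightarrow> 'o) \<Rightarrow> 'o \<Rightarrow> ('i \<Rightarrow> 'm) \<Rightarrow> bool" where
  "initial_source C D F I X Z g \<longleftrightarrow>
     (\<forall>Y\<in>Ob C. \<forall>h. (\<forall>i\<in>I. h i \<in> Hom C Y (X i)) \<longrightarrow>
      (\<forall>u\<in>Hom D (fob F Y) (fob F Z).
         (\<forall>i\<in>I. fhom F Y (X i) (h i) =
            Comp D (fob F Y) (fob F Z) (fob F (X i)) (fhom F Z (X i) (g i)) u) \<longrightarrow>
         (\<exists>!v. v \<in> Hom C Y Z \<and> fhom F Y Z v = u \<and>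
            (\<forall>i\<in>I. Comp C Y Z (X i) (g i) v = h i))))"

definition initial_lifting :: "('o, 'm) cat \<Rightarrow> ('p, 'n) cat \<Rightarrow> ('o, 'm, 'p, 'n) fct \<Rightarrow>
    'i set \<Rightarrow> ('i \<Rightarrow> 'o) \<Rightarrow> 'p \<Rightarrow> ('i \<Rightarrow> 'n) \<Rightarrow> 'o \<Rightarrow> ('i \<Rightarrow> 'm) \<Rightarrow> bool" where
  "initial_lifting C D F I X A f Z g \<longleftrightarrow>
     Z \<in> Ob C \<and> fob F Z = A \<and> g \<in> extensional I \<and>
     (\<forall>i\<in>I. g i \<in> Hom C Z (X i) \<and> fhom F Z (X i) (g i) = f i) \<and>
     initial_source C D F I X Z g"

text \<open>
  Sources are indexed by arbitrary subsets of \<open>'o \<times> 'm \<times> 'n\<close>. This type is large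
  enough to index the source of all pairs \<open>(X, f : A \<rightarrow> F X)\<close>, and large enough for the
  cardinality argument showing that topological functors are faithful; hence liftings
  along sources with larger index collections exist and are unique as well.
\<close>

definition topological_functor ::
  "('o, 'm) cat \<Rightarrow> ('p, 'n) cat \<Rightarrow> ('o, 'm, 'p, 'n) fct \<Rightarrow> bool" where
  "topological_functor C D F \<longleftrightarrow> is_functor C D F \<and>
     (\<forall>(I :: ('o \<times> 'm \<times> 'n) set) X. \<forall>A\<in>Ob D. \<forall>f.
        (\<forall>i\<in>I. X i \<in> Ob C \<and> f i \<in> Hom D A (fob F (X i))) \<longrightarrow>
        (\<exists>!(Z, g). initial_lifting C D F I X A f Z g))"


section \<open>Categories with classes of morphisms as morphisms\<close>

text \<open>
  \<open>quotient_category C S b E\<close> has objects \<open>S\<close>, each \<open>A \<in> S\<close> lying over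
  \<open>b A \<in> Ob C\<close>. Its morphisms are the classes of the partial equivalence relations
  \<open>E A B\<close> on \<open>Hom C (b A) (b B)\<close>; the domain of \<open>E A B\<close> consists of the
  representatives. Identities and composition are induced from \<open>C\<close>.
\<close>

definition quotient_category :: "('o, 'm) cat \<Rightarrow> 'a set \<Rightarrow> ('a \<Rightarrow> 'o) \<Rightarrow>
    ('a \<Rightarrow> 'a \<Rightarrow> ('m \<times> 'm) set) \<Rightarrow> ('a, 'm set) cat" where
  "quotient_category C S b E = \<lparr>Ob = S,
     Hom = (\<lambda>A B. Domain (E A B) // E A B),
     Id = (\<lambda>A. E A A `` {Id C (b A)}),
     Comp = (\<lambda>A B D G F. E A D `` {Comp C (b A) (b B) (b D) g f | g f. g \<in> G \<and> f \<in> F})\<rparr>"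


section \<open>The category of objects with equivalence relations\<close>

definition equ_hom :: "('o, 'm) cat \<Rightarrow> ('o, 'm, 'u set, 'u \<Rightarrow> 'u) fct \<Rightarrow>
    'o \<times> 'u rel \<Rightarrow> 'o \<times> 'u rel \<Rightarrow> 'm set" where
  "equ_hom C U = (\<lambda>(X, r) (Y, s).
     {f \<in> Hom C X Y. \<forall>(x, x')\<in>r. (fhom U X Y f x, fhom U X Y f x') \<in> s})"

definition equ_rel :: "('o, 'm) cat \<Rightarrow> ('o, 'm, 'u set, 'u \<Rightarrow> 'u) fct \<Rightarrow>
    'o \<times> 'u rel \<Rightarrow> 'o \<times> 'u rel \<Rightarrow> ('m \<times> 'm) set" where
  "equ_rel C U = (\<lambda>(X, r) (Y, s).
     {(f, g). f \<in> equ_hom C U (X, r) (Y, s) \<and> g \<in> equ_hom C U (X, r) (Y, s) \<and>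
        (\<forall>(x, x')\<in>r. (fhom U X Y f x, fhom U X Y g x') \<in> s)})"

definition Equ :: "('o, 'm) cat \<Rightarrow> ('o, 'm, 'u set, 'u \<Rightarrow> 'u) fct \<Rightarrow>
    ('o \<times> 'u rel, 'm set) cat" where
  "Equ C U = quotient_category C {(X, r). X \<in> Ob C \<and> equiv (fob U X) r} fst (equ_rel C U)"


section \<open>The exact completion\<close>

text \<open>A parallel pair \<open>leg1, leg2 : top \<rightarrow> base\<close>.\<close>

datatype ('o, 'm) parallel_pair = Parallel_Pair (top: 'o) (base: 'o) (leg1: 'm) (leg2: 'm)

definition pseudo_equivalence :: "('o, 'm) cat \<Rightarrow> ('o, 'm) parallel_pair \<Rightarrow> bool" where
  "pseudo_equivalence C R \<longleftrightarrow>
     (case R of Parallel_Pair X1 X0 r1 r2 \<Rightarrow>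
        X1 \<in> Ob C \<and> X0 \<in> Ob C \<and> r1 \<in> Hom C X1 X0 \<and> r2 \<in> Hom C X1 X0 \<and>
        (\<exists>r\<in>Hom C X0 X1. Comp C X0 X1 X0 r1 r = Id C X0 \<and> Comp C X0 X1 X0 r2 r = Id C X0) \<and>
        (\<exists>s\<in>Hom C X1 X1. Comp C X1 X1 X0 r1 s = r2 \<and> Comp C X1 X1 X0 r2 s = r1) \<and>
        (\<forall>X2 r3 r4. is_pullback C X1 X1 X0 r2 r1 X2 r3 r4 \<longrightarrow>
           (\<exists>t\<in>Hom C X2 X1. Comp C X2 X1 X0 r1 t = Comp C X2 X1 X0 r1 r3 \<and>
                             Comp C X2 X1 X0 r2 t = Comp C X2 X1 X0 r2 r4)))"

definition ex_hom ::
  "('o, 'm) cat \<Rightarrow> ('o, 'm) parallel_pair \<Rightarrow> ('o, 'm) parallel_pair \<Rightarrow> 'm set" where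
  "ex_hom C R S = {f \<in> Hom C (base R) (base S). \<exists>g\<in>Hom C (top R) (top S).
     Comp C (top R) (base R) (base S) f (leg1 R) = Comp C (top R) (top S) (base S) (leg1 S) g \<and>
     Comp C (top R) (base R) (base S) f (leg2 R) = Comp C (top R) (top S) (base S) (leg2 S) g}"

definition ex_rel ::
  "('o, 'm) cat \<Rightarrow> ('o, 'm) parallel_pair \<Rightarrow> ('o, 'm) parallel_pair \<Rightarrow> ('m \<times> 'm) set" where
  "ex_rel C R S = {(f1, f2). f1 \<in> ex_hom C R S \<and> f2 \<in> ex_hom C R S \<and>
     (\<exists>h\<in>Hom C (base R) (top S).
        f1 = Comp C (base R) (top S) (base S) (leg1 S) h \<and>
        f2 = Comp C (base R) (top S) (base S) (leg2 S) h)}"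

definition exact_completion :: "('o, 'm) cat \<Rightarrow> (('o, 'm) parallel_pair, 'm set) cat" where
  "exact_completion C = quotient_category C {R. pseudo_equivalence C R} base (ex_rel C)"

text \<open>
  \<open>\<langle>leg1, leg2\<rangle>\<close> is formed with respect to some product of \<open>base\<close> with itself;
  the choice of the product does not matter.
\<close>

definition pairing_regular_mono :: "('o, 'm) cat \<Rightarrow> ('o, 'm) parallel_pair \<Rightarrow> bool" where
  "pairing_regular_mono C R \<longleftrightarrow>
     (\<exists>P p1 p2 m. is_binary_product C (base R) (base R) P p1 p2 \<and>
        m \<in> Hom C (top R) P \<and>
        Comp C (top R) P (base R) p1 m = leg1 R \<and>
        Comp C (top R) P (base R) p2 m = leg2 R \<and>
        regular_mono C (top R) P m)"

definition PER_RegMono :: "('o, 'm) cat \<Rightarrow> (('o, 'm) parallel_pair, 'm set) cat" where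
  "PER_RegMono C = full_subcategory_on (exact_completion C)
     {R \<in> Ob (exact_completion C). pairing_regular_mono C R}"

end

theory Submission
  imports Defs
begin

text \<open>
  A pseudo-equivalence relation \<open>R\<close> on an object \<open>base R\<close> has an underlying equivalence relation
  \<open>ker R\<close> on the points of \<open>base R\<close>, obtained by forgetting which elements of \<open>top R\<close> witness that
  two points are related. This defines a functor \<open>under\<close> from the exact completion to \<open>Equ\<close>.
  Conversely, an equivalence relation on points can be lifted initially to an object over
  \<open>A\<close> and \<open>A\<close> (\<open>tabulation_exists\<close>), and the pairing of its legs is a regular monomorphism, namely the
  equalizer of the characteristic function of the relation and a constant map into an indiscrete
  two-point object.

  If the pairing of the legs of \<open>S\<close> is a regular monomorphism, then two morphisms into \<open>base S\<close> are
  related by a morphism into \<open>top S\<close> as soon as they are related pointwise. For such \<open>S\<close>, both the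
  representatives of morphisms \<open>R \<rightarrow> S\<close> and their equivalence are therefore expressed by \<open>ker R\<close> and
  \<open>ker S\<close> alone (\<open>ex_rel_saturated\<close>): morphisms \<open>R \<rightarrow> S\<close> in the exact completion and morphisms
  \<open>under R \<rightarrow> under S\<close> in \<open>Equ\<close> are the same classes. The equivalence of categories and the
  universal property of the reflection \<open>R \<mapsto> tabulator (under R)\<close> follow at once, all the
  morphisms involved being identities of \<open>Equ\<close>.

  For limits, the discrete one-point object \<open>D\<close> and the discrete pseudo-equivalence
  relations on objects of \<open>X\<close> are used as test objects. As morphisms out of \<open>D\<close> are points, a cone \<open>p\<close> on
  \<open>Q\<close> that is jointly monic in the exact completion reflects the underlying relations:
  points of \<open>Q\<close> are related if their images in all components are (\<open>ker_jointly_reflected\<close>). A cone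
  in \<open>Equ\<close> with vertex \<open>(B, s)\<close> restricts to a cone in the exact completion whose vertex is the
  discrete relation on \<open>B\<close>. It factors through the limit there, and by the reflection of relations
  the factorization respects \<open>s\<close> (\<open>under_cone_ex1\<close>). Hence \<open>under\<close> preserves products, and also
  pullbacks over an object \<open>J\<close> of \<open>PER(X, RegMono)\<close>: there the restricted cone commutes in the exact
  completion because relatedness in \<open>J\<close> can be checked on points. Finally, any two reflectors are
  isomorphic (\<open>reflectors_iso\<close>), and limit cones can be transported along isomorphisms.
\<close>

section \<open>Cones and reflectors up to isomorphism\<close>

lemma category_Id: "category C \<Longrightarrow> A \<in> Ob C \<Longrightarrow> Id C A \<in> Hom C A A"
  by (simp add: category_def)

lemma category_Comp:
  "\<lbrakk>category C; f \<in> Hom C A B; g \<in> Hom C B D; A \<in> Ob C; B \<in> Ob C; D \<in> Ob C\<rbrakk>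
    \<Longrightarrow> Comp C A B D g f \<in> Hom C A D"
  unfolding category_def by blast

lemma category_Id_right:
  "\<lbrakk>category C; f \<in> Hom C A B; A \<in> Ob C; B \<in> Ob C\<rbrakk> \<Longrightarrow> Comp C A A B f (Id C A) = f"
  unfolding category_def by blast

lemma category_Id_left:
  "\<lbrakk>category C; f \<in> Hom C A B; A \<in> Ob C; B \<in> Ob C\<rbrakk> \<Longrightarrow> Comp C A B B (Id C B) f = f"
  unfolding category_def by blast

lemma category_assoc:
  "\<lbrakk>category C; f \<in> Hom C A B; g \<in> Hom C B D; h \<in> Hom C D E;
    A \<in> Ob C; B \<in> Ob C; D \<in> Ob C; E \<in> Ob C\<rbrakk>
    \<Longrightarrow> Comp C A B E (Comp C B D E h g) f = Comp C A D E h (Comp C A B D g f)"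
  unfolding category_def by blast

lemmas category_rules =
  category_Id category_Comp category_Id_right category_Id_left category_assoc

lemma iso_Id: "category C \<Longrightarrow> A \<in> Ob C \<Longrightarrow> iso C A A (Id C A)"
  unfolding iso_def by (auto simp: category_rules intro!: bexI[of _ "Id C A"])

lemma iso_cancel_left:
  assumes "category C" "iso C A B f" "A \<in> Ob C" "B \<in> Ob C" "Y \<in> Ob C"
    and "g \<in> Hom C Y A" "h \<in> Hom C Y A" "Comp C Y A B f g = Comp C Y A B f h"
  shows "g = h"
proof -
  obtain k where k: "k \<in> Hom C B A" "Comp C A B A k f = Id C A" and f: "f \<in> Hom C A B"
    using assms(2) unfolding iso_def by blast
  have "Comp C Y A A (Comp C A B A k f) g = Comp C Y A A (Comp C A B A k f) h"
    using assms f k(1) by (simp add: category_assoc)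
  then show ?thesis
    using assms k by (simp add: category_Id_left)
qed

lemma is_product_ex1:
  "\<lbrakk>is_product C I A P p; Y \<in> Ob C; \<And>i. i \<in> I \<Longrightarrow> h i \<in> Hom C Y (A i)\<rbrakk>
    \<Longrightarrow> \<exists>!u. u \<in> Hom C Y P \<and> (\<forall>i\<in>I. Comp C Y P (A i) (p i) u = h i)"
  unfolding is_product_def by simp

text \<open>
  The uniqueness half of a limit, isolated because it is what transfers an equivalence relation on
  the components of a limit cone to its vertex (see \<open>ker_jointly_reflected\<close> below).
\<close>

definition jointly_monic ::
  "('o, 'm) cat \<Rightarrow> 'o \<Rightarrow> 'i set \<Rightarrow> ('i \<Rightarrow> 'o) \<Rightarrow> ('i \<Rightarrow> 'm) \<Rightarrow> bool" where
  "jointly_monic C P I A p \<longleftrightarrow> (\<forall>Y\<in>Ob C. \<forall>u\<in>Hom C Y P. \<forall>v\<in>Hom C Y P.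
     (\<forall>i\<in>I. Comp C Y P (A i) (p i) u = Comp C Y P (A i) (p i) v) \<longrightarrow> u = v)"

lemma is_product_jointly_monic:
  assumes C: "category C" and P: "is_product C I A P p"
  shows "jointly_monic C P I A p"
  unfolding jointly_monic_def
proof (intro ballI impI)
  fix Y u v
  assume Y: "Y \<in> Ob C" and uv: "u \<in> Hom C Y P" "v \<in> Hom C Y P"
    and eq: "\<forall>i\<in>I. Comp C Y P (A i) (p i) u = Comp C Y P (A i) (p i) v"
  have "\<exists>!w. w \<in> Hom C Y P \<and> (\<forall>i\<in>I. Comp C Y P (A i) (p i) w = Comp C Y P (A i) (p i) v)"
    by (rule is_product_ex1[OF P Y], rule category_Comp[OF C uv(2)])
      (use P Y in \<open>auto simp: is_product_def\<close>)
  then show "u = v" using uv eq by blast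
qed

text \<open>
  A cone isomorphic to a limit cone is a limit cone. Together with the essential uniqueness of
  reflectors this reduces statements about arbitrary reflectors to one explicit reflector. The
  comparison \<open>\<beta> i\<close> points from the new component to the old one and \<open>\<alpha>\<close> from the new vertex to the
  old one, so that the hypothesis on \<open>\<beta>\<close> and \<open>\<alpha>\<close> is a naturality square of a natural isomorphism.
\<close>

lemma is_product_iso:
  assumes C: "category C" and P: "is_product C I A P p"
    and P': "P' \<in> Ob C" "iso C P' P \<alpha>"
    and A': "\<And>i. i \<in> I \<Longrightarrow> A' i \<in> Ob C" "\<And>i. i \<in> I \<Longrightarrow> iso C (A' i) (A i) (\<beta> i)"
    and p': "\<And>i. i \<in> I \<Longrightarrow> p' i \<in> Hom C P' (A' i)"
    and nat: "\<And>i. i \<in> I \<Longrightarrow>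
        Comp C P' (A' i) (A i) (\<beta> i) (p' i) = Comp C P' P (A i) (p i) \<alpha>"
  shows "is_product C I A' P' p'"
proof -
  have Ob: "P \<in> Ob C" "\<And>i. i \<in> I \<Longrightarrow> A i \<in> Ob C"
    and p: "\<And>i. i \<in> I \<Longrightarrow> p i \<in> Hom C P (A i)"
    using P unfolding is_product_def by auto
  have \<beta>: "\<And>i. i \<in> I \<Longrightarrow> \<beta> i \<in> Hom C (A' i) (A i)"
    using A'(2) unfolding iso_def by auto
  obtain \<alpha>' where \<alpha>: "\<alpha> \<in> Hom C P' P" "\<alpha>' \<in> Hom C P P'"
      "Comp C P' P P' \<alpha>' \<alpha> = Id C P'" "Comp C P P' P \<alpha> \<alpha>' = Id C P"
    using P'(2) unfolding iso_def by auto
  have *: "\<exists>!u. u \<in> Hom C Y P' \<and> (\<forall>i\<in>I. Comp C Y P' (A' i) (p' i) u = h i)"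
    if Y: "Y \<in> Ob C" and h: "\<And>i. i \<in> I \<Longrightarrow> h i \<in> Hom C Y (A' i)" for Y h
  proof -
    note mem = C Y h P'(1) A'(1) Ob p p' \<alpha>(1,2) \<beta>
    have "\<forall>i\<in>I. Comp C Y (A' i) (A i) (\<beta> i) (h i) \<in> Hom C Y (A i)"
      using mem by (auto intro!: category_Comp)
    then have "\<exists>!u. u \<in> Hom C Y P \<and>
        (\<forall>i\<in>I. Comp C Y P (A i) (p i) u = Comp C Y (A' i) (A i) (\<beta> i) (h i))"
      by (intro is_product_ex1[OF P Y]) blast
    then obtain u where u: "u \<in> Hom C Y P"
        "\<And>i. i \<in> I \<Longrightarrow> Comp C Y P (A i) (p i) u = Comp C Y (A' i) (A i) (\<beta> i) (h i)"
      and uniq: "\<And>v. v \<in> Hom C Y P \<Longrightarrow>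
        (\<And>i. i \<in> I \<Longrightarrow> Comp C Y P (A i) (p i) v = Comp C Y (A' i) (A i) (\<beta> i) (h i)) \<Longrightarrow> v = u"
      by (elim ex1E conjE) blast
    show ?thesis
    proof (intro ex1I[of _ "Comp C Y P P' \<alpha>' u"] conjI ballI)
      show u': "Comp C Y P P' \<alpha>' u \<in> Hom C Y P'"
        using mem u by (auto intro!: category_Comp)
      fix i assume i: "i \<in> I"
      have "Comp C Y (A' i) (A i) (\<beta> i) (Comp C Y P' (A' i) (p' i) (Comp C Y P P' \<alpha>' u))
          = Comp C Y P' (A i) (Comp C P' P (A i) (p i) \<alpha>) (Comp C Y P P' \<alpha>' u)"
        using mem u' i by (simp flip: nat add: category_rules)
      also have "\<dots> = Comp C Y P (A i) (p i) (Comp C Y P P (Comp C P P' P \<alpha> \<alpha>') u)"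
        using mem u(1) i by (simp add: category_rules)
      also have "\<dots> = Comp C Y (A' i) (A i) (\<beta> i) (h i)"
        using mem u i \<alpha>(4) by (simp add: category_rules)
      finally show "Comp C Y P' (A' i) (p' i) (Comp C Y P P' \<alpha>' u) = h i"
        using iso_cancel_left[OF C A'(2)[OF i]] mem u' i
        by (simp add: category_Comp)
    next
      fix v assume v: "v \<in> Hom C Y P' \<and> (\<forall>i\<in>I. Comp C Y P' (A' i) (p' i) v = h i)"
      have "Comp C Y P' P \<alpha> v = u"
      proof (rule uniq)
        show "Comp C Y P' P \<alpha> v \<in> Hom C Y P" using mem v by (auto intro!: category_Comp)
        fix i assume i: "i \<in> I"
        have "Comp C Y P (A i) (p i) (Comp C Y P' P \<alpha> v)
            = Comp C Y P' (A i) (Comp C P' (A' i) (A i) (\<beta> i) (p' i)) v"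
          using mem v i by (simp add: nat category_rules)
        also have "\<dots> = Comp C Y (A' i) (A i) (\<beta> i) (h i)"
          using mem v i by (simp add: category_rules)
        finally show "Comp C Y P (A i) (p i) (Comp C Y P' P \<alpha> v)
            = Comp C Y (A' i) (A i) (\<beta> i) (h i)" .
      qed
      moreover have "Comp C Y P P' \<alpha>' (Comp C Y P' P \<alpha> v) = v"
        using mem v \<alpha>(3) by (simp flip: category_assoc add: category_Id_left)
      ultimately show "v = Comp C Y P P' \<alpha>' u" by simp
    qed
  qed
  show ?thesis
    unfolding is_product_def using P' A' p' * by blast
qed

lemma is_pullback_iso:
  assumes C: "category C" and Q: "is_pullback C A K J f k Q q1 q2"
    and Q': "Q' \<in> Ob C" "iso C Q' Q \<alpha>" and A': "A' \<in> Ob C" "iso C A' A \<beta>"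
    and f': "f' = Comp C A' A J f \<beta>"
    and q1': "q1' \<in> Hom C Q' A'" "Comp C Q' A' A \<beta> q1' = Comp C Q' Q A q1 \<alpha>"
    and q2': "q2' = Comp C Q' Q K q2 \<alpha>"
  shows "is_pullback C A' K J f' k Q' q1' q2'"
proof -
  have Ob: "A \<in> Ob C" "K \<in> Ob C" "J \<in> Ob C" "Q \<in> Ob C"
    and hom: "f \<in> Hom C A J" "k \<in> Hom C K J" "q1 \<in> Hom C Q A" "q2 \<in> Hom C Q K"
    and eq: "Comp C Q A J f q1 = Comp C Q K J k q2"
    using Q unfolding is_pullback_def by auto
  have \<beta>: "\<beta> \<in> Hom C A' A"
    using A'(2) unfolding iso_def by auto
  obtain \<alpha>' where \<alpha>: "\<alpha> \<in> Hom C Q' Q" "\<alpha>' \<in> Hom C Q Q'"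
      "Comp C Q' Q Q' \<alpha>' \<alpha> = Id C Q'" "Comp C Q Q' Q \<alpha> \<alpha>' = Id C Q"
    using Q'(2) unfolding iso_def by auto
  note mem = C Q'(1) A'(1) Ob hom \<beta> \<alpha>(1,2) q1'(1)
  have square: "Comp C Q' A' J f' q1' = Comp C Q' K J k q2'"
  proof -
    have "Comp C Q' A' J f' q1' = Comp C Q' A J f (Comp C Q' Q A q1 \<alpha>)"
      using mem by (simp add: f' flip: q1'(2) add: category_rules)
    also have "\<dots> = Comp C Q' Q J (Comp C Q A J f q1) \<alpha>"
      using mem by (simp add: category_rules)
    also have "\<dots> = Comp C Q' K J k q2'"
      using mem by (simp add: eq q2' category_rules)
    finally show ?thesis .
  qed
  have *: "\<exists>!u. u \<in> Hom C Y Q' \<and> Comp C Y Q' A' q1' u = a \<and> Comp C Y Q' K q2' u = b"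
    if Y: "Y \<in> Ob C" and ab: "a \<in> Hom C Y A'" "b \<in> Hom C Y K"
      and sq: "Comp C Y A' J f' a = Comp C Y K J k b" for Y a b
  proof -
    note mem = mem Y ab
    have "Comp C Y A J f (Comp C Y A' A \<beta> a) = Comp C Y K J k b"
      using mem by (simp flip: sq add: f' category_rules)
    moreover have "Comp C Y A' A \<beta> a \<in> Hom C Y A"
      using mem by (auto intro!: category_Comp)
    ultimately have "\<exists>!u. u \<in> Hom C Y Q \<and>
        Comp C Y Q A q1 u = Comp C Y A' A \<beta> a \<and> Comp C Y Q K q2 u = b"
      using Q Y ab unfolding is_pullback_def by blast
    then obtain u where u: "u \<in> Hom C Y Q"
        "Comp C Y Q A q1 u = Comp C Y A' A \<beta> a" "Comp C Y Q K q2 u = b"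
      and uniq: "\<And>v. v \<in> Hom C Y Q \<Longrightarrow> Comp C Y Q A q1 v = Comp C Y A' A \<beta> a \<Longrightarrow>
        Comp C Y Q K q2 v = b \<Longrightarrow> v = u"
      by (elim ex1E conjE) blast
    show ?thesis
    proof (intro ex1I[of _ "Comp C Y Q Q' \<alpha>' u"] conjI)
      show u': "Comp C Y Q Q' \<alpha>' u \<in> Hom C Y Q'"
        using mem u by (auto intro!: category_Comp)
      have cancel: "Comp C Y Q' Q \<alpha> (Comp C Y Q Q' \<alpha>' u) = u"
        using mem u \<alpha>(4) by (simp flip: category_assoc add: category_Id_left)
      have "Comp C Y A' A \<beta> (Comp C Y Q' A' q1' (Comp C Y Q Q' \<alpha>' u))
          = Comp C Y Q A q1 (Comp C Y Q' Q \<alpha> (Comp C Y Q Q' \<alpha>' u))"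
        using mem u' by (simp flip: category_assoc add: q1'(2))
      also have "\<dots> = Comp C Y A' A \<beta> a"
        by (simp add: cancel u)
      finally show "Comp C Y Q' A' q1' (Comp C Y Q Q' \<alpha>' u) = a"
        using iso_cancel_left[OF C A'(2)] mem u'
        by (simp add: category_Comp)
      show "Comp C Y Q' K q2' (Comp C Y Q Q' \<alpha>' u) = b"
        using mem u' by (simp add: q2' category_assoc cancel u)
    next
      fix v assume v: "v \<in> Hom C Y Q' \<and> Comp C Y Q' A' q1' v = a \<and> Comp C Y Q' K q2' v = b"
      have "Comp C Y Q' Q \<alpha> v = u"
      proof (rule uniq)
        show "Comp C Y Q' Q \<alpha> v \<in> Hom C Y Q" using mem v by (auto intro!: category_Comp)
        have "Comp C Y Q A q1 (Comp C Y Q' Q \<alpha> v) = Comp C Y Q' A (Comp C Q' A' A \<beta> q1') v"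
          using mem v by (simp add: q1'(2) category_rules)
        also have "\<dots> = Comp C Y A' A \<beta> a"
          using mem v by (simp add: category_rules)
        finally show "Comp C Y Q A q1 (Comp C Y Q' Q \<alpha> v) = Comp C Y A' A \<beta> a" .
        have "Comp C Y Q K q2 (Comp C Y Q' Q \<alpha> v) = Comp C Y Q' K q2' v"
          using mem conjunct1[OF v] by (simp add: q2' category_rules)
        then show "Comp C Y Q K q2 (Comp C Y Q' Q \<alpha> v) = b" using v by simp
      qed
      moreover have "Comp C Y Q Q' \<alpha>' (Comp C Y Q' Q \<alpha> v) = v"
        using mem v \<alpha>(3) by (simp flip: category_assoc add: category_Id_left)
      ultimately show "v = Comp C Y Q Q' \<alpha>' u" by simp
    qed
  qed
  have "f' \<in> Hom C A' J" "q2' \<in> Hom C Q' K"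
    using mem by (auto simp: f' q2' intro!: category_Comp)
  then show ?thesis
    unfolding is_pullback_def using mem square * by blast
qed

lemma is_pullback_eqI:
  assumes C: "category C" and P: "is_pullback C A B D f g P p q" and Y: "Y \<in> Ob C"
    and uv: "u \<in> Hom C Y P" "v \<in> Hom C Y P"
    and eq: "Comp C Y P A p u = Comp C Y P A p v" "Comp C Y P B q u = Comp C Y P B q v"
  shows "u = v"
proof -
  have mem: "A \<in> Ob C" "B \<in> Ob C" "D \<in> Ob C" "P \<in> Ob C" "f \<in> Hom C A D" "g \<in> Hom C B D"
      "p \<in> Hom C P A" "q \<in> Hom C P B"
    and sq: "Comp C P A D f p = Comp C P B D g q"
    using P unfolding is_pullback_def by auto
  have "Comp C Y A D f (Comp C Y P A p v) = Comp C Y B D g (Comp C Y P B q v)"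
    using C mem Y uv sq by (simp flip: category_assoc)
  moreover have "Comp C Y P A p v \<in> Hom C Y A" "Comp C Y P B q v \<in> Hom C Y B"
    using C mem Y uv by (auto intro!: category_Comp)
  ultimately have "\<exists>!w. w \<in> Hom C Y P \<and> Comp C Y P A p w = Comp C Y P A p v \<and>
      Comp C Y P B q w = Comp C Y P B q v"
    using P Y unfolding is_pullback_def by blast
  then show ?thesis using uv eq by metis
qed

lemma pullback_comparison_iso:
  assumes C: "category C"
    and Q: "is_pullback C A B D f g Q q1 q2" and T: "is_pullback C A B D f g T t1 t2"
  shows "\<exists>c\<in>Hom C Q T. Comp C Q T A t1 c = q1 \<and> Comp C Q T B t2 c = q2 \<and> iso C Q T c"
proof -
  have mem: "A \<in> Ob C" "B \<in> Ob C" "Q \<in> Ob C" "T \<in> Ob C"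
      "q1 \<in> Hom C Q A" "q2 \<in> Hom C Q B" "t1 \<in> Hom C T A" "t2 \<in> Hom C T B"
    using Q T unfolding is_pullback_def by auto
  obtain c where c: "c \<in> Hom C Q T" "Comp C Q T A t1 c = q1" "Comp C Q T B t2 c = q2"
    using Q T unfolding is_pullback_def by metis
  obtain d where d: "d \<in> Hom C T Q" "Comp C T Q A q1 d = t1" "Comp C T Q B q2 d = t2"
    using Q T unfolding is_pullback_def by metis
  have "Comp C Q T Q d c = Id C Q"
    by (rule is_pullback_eqI[OF C Q mem(3)]) (use C mem c d in \<open>simp_all add: category_rules flip: category_assoc\<close>)
  moreover have "Comp C T Q T c d = Id C T"
    by (rule is_pullback_eqI[OF C T mem(4)]) (use C mem c d in \<open>simp_all add: category_rules flip: category_assoc\<close>)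
  ultimately have "iso C Q T c"
    using c d unfolding iso_def by blast
  then show ?thesis using c by blast
qed

text \<open>
  Each unit factors through the other, and the universal properties force the two factorizations to
  be mutually inverse. Naturality holds because both composites agree after precomposition with the
  unit of \<open>R\<close>.
\<close>

lemma reflectors_iso:
  assumes R: "reflector C P R \<eta>" and R': "reflector C P R' \<eta>'"
  shows "\<exists>\<theta>. \<forall>A\<in>Ob C. iso C (fob R A) (fob R' A) (\<theta> A) \<and>
      Comp C A (fob R A) (fob R' A) (\<theta> A) (\<eta> A) = \<eta>' A \<and>
      (\<forall>B\<in>Ob C. \<forall>f\<in>Hom C A B.
        Comp C (fob R A) (fob R B) (fob R' B) (\<theta> B) (fhom R A B f) =
        Comp C (fob R A) (fob R' A) (fob R' B) (fhom R' A B f) (\<theta> A))"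
proof -
  obtain S where S: "S \<subseteq> Ob C" "P = full_subcategory_on C S" and C: "category C"
    using R unfolding reflector_def full_subcategory_def by auto
  have P [simp]: "Ob P = S" "Hom P = Hom C" "Comp P = Comp C"
    using S by (auto simp: full_subcategory_on_def)
  have facts: "fob T A \<in> S" "fob T A \<in> Ob C" "\<epsilon> A \<in> Hom C A (fob T A)"
    "B \<in> S \<Longrightarrow> f \<in> Hom C A B \<Longrightarrow> \<exists>!g. g \<in> Hom C (fob T A) B \<and> Comp C A (fob T A) B g (\<epsilon> A) = f"
    "B \<in> Ob C \<Longrightarrow> f \<in> Hom C A B \<Longrightarrow> fhom T A B f \<in> Hom C (fob T A) (fob T B)"
    "B \<in> Ob C \<Longrightarrow> f \<in> Hom C A B \<Longrightarrow>
       Comp C A B (fob T B) (\<epsilon> B) f = Comp C A (fob T A) (fob T B) (fhom T A B f) (\<epsilon> A)"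
    if "reflector C P T \<epsilon>" "A \<in> Ob C" for T \<epsilon> A B f
    using that S(1)
    by (auto simp: reflector_def is_functor_def natural_transformation_def id_fct_def)
  note f1 = facts[OF R] and f2 = facts[OF R']
  have ext: "g = h"
    if "reflector C P T \<epsilon>" "A \<in> Ob C" "B \<in> S" "g \<in> Hom C (fob T A) B" "h \<in> Hom C (fob T A) B"
      "Comp C A (fob T A) B g (\<epsilon> A) = Comp C A (fob T A) B h (\<epsilon> A)" for T \<epsilon> A B g h
  proof -
    have "Comp C A (fob T A) B h (\<epsilon> A) \<in> Hom C A B"
      using C facts[OF that(1,2)] that(2,3,5) S(1) by (auto intro!: category_Comp)
    then show ?thesis
      using facts(4)[OF that(1,2,3)] that(4-6) by blast
  qed
  have "\<forall>A\<in>Ob C. \<exists>g. g \<in> Hom C (fob R A) (fob R' A) \<and>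
      Comp C A (fob R A) (fob R' A) g (\<eta> A) = \<eta>' A"
    using f1(4) f2(1,3) by blast
  then obtain \<theta> where \<theta>: "\<And>A. A \<in> Ob C \<Longrightarrow> \<theta> A \<in> Hom C (fob R A) (fob R' A)"
      "\<And>A. A \<in> Ob C \<Longrightarrow> Comp C A (fob R A) (fob R' A) (\<theta> A) (\<eta> A) = \<eta>' A"
    by metis
  have iso: "iso C (fob R A) (fob R' A) (\<theta> A)" if A: "A \<in> Ob C" for A
  proof -
    obtain g where g: "g \<in> Hom C (fob R' A) (fob R A)"
        "Comp C A (fob R' A) (fob R A) g (\<eta>' A) = \<eta> A"
      using f2(4)[OF A f1(1)[OF A] f1(3)[OF A]] by blast
    have "Comp C (fob R A) (fob R' A) (fob R A) g (\<theta> A) = Id C (fob R A)"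
      by (rule ext[OF R A f1(1)[OF A]])
        (use C A g \<theta>[OF A] f1(2,3)[OF A] f2(2,3)[OF A] in \<open>simp_all add: category_rules\<close>)
    moreover have "Comp C (fob R' A) (fob R A) (fob R' A) (\<theta> A) g = Id C (fob R' A)"
      by (rule ext[OF R' A f2(1)[OF A]])
        (use C A g \<theta>[OF A] f1(2,3)[OF A] f2(2,3)[OF A] in \<open>simp_all add: category_rules\<close>)
    ultimately show ?thesis
      using g \<theta>[OF A] unfolding iso_def by blast
  qed
  have "Comp C (fob R A) (fob R B) (fob R' B) (\<theta> B) (fhom R A B f) =
        Comp C (fob R A) (fob R' A) (fob R' B) (fhom R' A B f) (\<theta> A)"
    if A: "A \<in> Ob C" and B: "B \<in> Ob C" and f: "f \<in> Hom C A B" for A B f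
  proof (rule ext[OF R A f2(1)[OF B]])
    note mem = C A B f \<theta>[OF A] \<theta>[OF B] f1(2,3)[OF A] f1(2,3)[OF B] f2(2,3)[OF A] f2(2,3)[OF B]
      f1(5)[OF A B f] f2(5)[OF A B f]
    show "Comp C (fob R A) (fob R B) (fob R' B) (\<theta> B) (fhom R A B f) \<in> Hom C (fob R A) (fob R' B)"
      "Comp C (fob R A) (fob R' A) (fob R' B) (fhom R' A B f) (\<theta> A) \<in> Hom C (fob R A) (fob R' B)"
      using mem by (auto intro!: category_Comp)
    have "Comp C A (fob R A) (fob R' B)
          (Comp C (fob R A) (fob R B) (fob R' B) (\<theta> B) (fhom R A B f)) (\<eta> A)
        = Comp C A (fob R B) (fob R' B) (\<theta> B) (Comp C A B (fob R B) (\<eta> B) f)"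
      using mem f1(6)[OF A B f] by (simp add: category_assoc)
    also have "\<dots> = Comp C A B (fob R' B) (\<eta>' B) f"
      using mem by (simp flip: category_assoc)
    also have "\<dots> = Comp C A (fob R' A) (fob R' B) (fhom R' A B f) (\<eta>' A)"
      by (rule f2(6)[OF A B f])
    also have "\<dots> = Comp C A (fob R A) (fob R' B)
          (Comp C (fob R A) (fob R' A) (fob R' B) (fhom R' A B f) (\<theta> A)) (\<eta> A)"
      using mem by (simp add: category_assoc)
    finally show "Comp C A (fob R A) (fob R' B)
          (Comp C (fob R A) (fob R B) (fob R' B) (\<theta> B) (fhom R A B f)) (\<eta> A)
        = Comp C A (fob R A) (fob R' B)
          (Comp C (fob R A) (fob R' A) (fob R' B) (fhom R' A B f) (\<theta> A)) (\<eta> A)" .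
  qed
  then show ?thesis using iso \<theta> by blast
qed

section \<open>Quotient categories\<close>

text \<open>
  A partial equivalence relation on hom-sets whose domain contains the identities and which is
  compatible with composition on both sides. Both \<open>Equ\<close> and the exact completion arise in this
  way, and with the relation given, composition can be computed on representatives.
\<close>

locale quotient_data =
  fixes C :: "('o, 'm) cat" and S :: "'a set" and b :: "'a \<Rightarrow> 'o"
    and E :: "'a \<Rightarrow> 'a \<Rightarrow> ('m \<times> 'm) set"
  assumes base_category: "category C"
    and base_Ob: "A \<in> S \<Longrightarrow> b A \<in> Ob C"
    and rel_Hom: "A \<in> S \<Longrightarrow> B \<in> S \<Longrightarrow> (f, g) \<in> E A B \<Longrightarrow> f \<in> Hom C (b A) (b B)"
    and rel_sym: "A \<in> S \<Longrightarrow> B \<in> S \<Longrightarrow> (f, g) \<in> E A B \<Longrightarrow> (g, f) \<in> E A B"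
    and rel_trans: "A \<in> S \<Longrightarrow> B \<in> S \<Longrightarrow> (f, g) \<in> E A B \<Longrightarrow> (g, h) \<in> E A B \<Longrightarrow> (f, h) \<in> E A B"
    and rel_Id: "A \<in> S \<Longrightarrow> (Id C (b A), Id C (b A)) \<in> E A A"
    and rel_Comp: "A \<in> S \<Longrightarrow> B \<in> S \<Longrightarrow> D \<in> S \<Longrightarrow> (f, f') \<in> E A B \<Longrightarrow> (g, g') \<in> E B D \<Longrightarrow>
      (Comp C (b A) (b B) (b D) g f, Comp C (b A) (b B) (b D) g' f') \<in> E A D"
begin

lemma Ob_quotient [simp]: "Ob (quotient_category C S b E) = S"
  by (simp add: quotient_category_def)

lemma Hom_quotient:
  assumes "A \<in> S" "B \<in> S"
  shows "c \<in> Hom (quotient_category C S b E) A B \<longleftrightarrow> (\<exists>f. (f, f) \<in> E A B \<and> c = E A B `` {f})"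
proof -
  have "f \<in> Domain (E A B) \<longleftrightarrow> (f, f) \<in> E A B" for f
    using rel_sym[OF assms] rel_trans[OF assms] by blast
  then show ?thesis
    by (auto simp: quotient_category_def quotient_def)
qed

lemma class_eq:
  assumes "A \<in> S" "B \<in> S" "(f, f) \<in> E A B"
  shows "E A B `` {f} = E A B `` {g} \<longleftrightarrow> (f, g) \<in> E A B"
  using rel_sym[OF assms(1,2)] rel_trans[OF assms(1,2)] assms(3) by blast

lemma Comp_quotient:
  assumes "A \<in> S" "B \<in> S" "D \<in> S" "(f, f) \<in> E A B" "(g, g) \<in> E B D"
  shows "Comp (quotient_category C S b E) A B D (E B D `` {g}) (E A B `` {f})
    = E A D `` {Comp C (b A) (b B) (b D) g f}"
  unfolding quotient_category_def
  using assms(4,5) rel_Comp[OF assms(1-3)] rel_trans[OF assms(1,3)] by fastforce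

lemma Id_quotient: "Id (quotient_category C S b E) A = E A A `` {Id C (b A)}"
  by (simp add: quotient_category_def)

lemma category_quotient: "category (quotient_category C S b E)" (is "category ?Q")
proof -
  have 1: "Id ?Q A \<in> Hom ?Q A A" if "A \<in> S" for A
    using that rel_Id by (auto simp: Hom_quotient Id_quotient)
  have 2: "Comp ?Q A B D d c \<in> Hom ?Q A D"
    if S: "A \<in> S" "B \<in> S" "D \<in> S" and cd: "c \<in> Hom ?Q A B" "d \<in> Hom ?Q B D" for A B D c d
  proof -
    obtain f g where fg: "(f, f) \<in> E A B" "c = E A B `` {f}" "(g, g) \<in> E B D" "d = E B D `` {g}"
      using cd unfolding Hom_quotient[OF S(1,2)] Hom_quotient[OF S(2,3)] by blast
    show ?thesis
      using S fg rel_Comp[OF S fg(1,3)]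
      by (auto simp: Hom_quotient Comp_quotient)
  qed
  have 3: "Comp ?Q A A B c (Id ?Q A) = c \<and> Comp ?Q A B B (Id ?Q B) c = c"
    if S: "A \<in> S" "B \<in> S" and c: "c \<in> Hom ?Q A B" for A B c
  proof -
    obtain f where f: "(f, f) \<in> E A B" "c = E A B `` {f}"
      using c unfolding Hom_quotient[OF S] by blast
    show ?thesis
      using S f rel_Id rel_Hom[OF S f(1)] base_Ob base_category
      by (simp add: Comp_quotient Id_quotient category_rules)
  qed
  have 4: "Comp ?Q A B F (Comp ?Q B D F e d) c = Comp ?Q A D F e (Comp ?Q A B D d c)"
    if S: "A \<in> S" "B \<in> S" "D \<in> S" "F \<in> S" and cde: "c \<in> Hom ?Q A B" "d \<in> Hom ?Q B D" "e \<in> Hom ?Q D F"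
    for A B D F c d e
  proof -
    obtain f g h where fgh: "(f, f) \<in> E A B" "c = E A B `` {f}" "(g, g) \<in> E B D" "d = E B D `` {g}"
        "(h, h) \<in> E D F" "e = E D F `` {h}"
      using cde unfolding Hom_quotient[OF S(1,2)] Hom_quotient[OF S(2,3)] Hom_quotient[OF S(3,4)]
      by blast
    note homs = rel_Hom[OF S(1,2) fgh(1)] rel_Hom[OF S(2,3) fgh(3)] rel_Hom[OF S(3,4) fgh(5)]
    note comps = rel_Comp[OF S(1-3) fgh(1,3)] rel_Comp[OF S(2-4) fgh(3,5)]
    show ?thesis
      unfolding fgh(2,4,6) Comp_quotient[OF S(1-3) fgh(1,3)] Comp_quotient[OF S(2-4) fgh(3,5)]
        Comp_quotient[OF S(1,2,4) fgh(1) comps(2)] Comp_quotient[OF S(1,3,4) comps(1) fgh(5)]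
      by (simp only: category_assoc[OF base_category homs S[THEN base_Ob]])
  qed
  show ?thesis
    unfolding category_def Ob_quotient
    by (intro conjI ballI) (rule 1 2 4 3[THEN conjunct1] 3[THEN conjunct2]; assumption)+
qed

end

section \<open>Topological categories over sets\<close>

locale topological_over_sets =
  fixes X :: "('o, 'm) cat"
    and U :: "('o, 'm, 'u set, 'u \<Rightarrow> 'u) fct"
    and \<U> :: "'u set set"
  assumes universe: "set_universe \<U>"
    and topological: "topological_functor X (Set_cat \<U>) U"
begin

abbreviation pts :: "'o \<Rightarrow> 'u set" where "pts \<equiv> fob U"

lemma U_functor: "is_functor X (Set_cat \<U>) U"
  using topological by (simp add: topological_functor_def)

lemma category_X: "category X"
  using U_functor by (simp add: is_functor_def)

lemma pts_universe: "A \<in> Ob X \<Longrightarrow> pts A \<in> \<U>"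
  using U_functor by (auto simp: is_functor_def Set_cat_def)

lemma fhom_PiE: "\<lbrakk>f \<in> Hom X A B; A \<in> Ob X; B \<in> Ob X\<rbrakk> \<Longrightarrow> fhom U A B f \<in> pts A \<rightarrow>\<^sub>E pts B"
  using U_functor by (auto simp: is_functor_def Set_cat_def)

lemma fhom_pts:
  "\<lbrakk>f \<in> Hom X A B; A \<in> Ob X; B \<in> Ob X; x \<in> pts A\<rbrakk> \<Longrightarrow> fhom U A B f x \<in> pts B"
  using fhom_PiE by blast

lemma fhom_Id: "A \<in> Ob X \<Longrightarrow> x \<in> pts A \<Longrightarrow> fhom U A A (Id X A) x = x"
  using U_functor by (simp add: is_functor_def Set_cat_def)

lemma fhom_Comp:
  assumes "f \<in> Hom X A B" "g \<in> Hom X B D" "A \<in> Ob X" "B \<in> Ob X" "D \<in> Ob X"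
  shows "fhom U A D (Comp X A B D g f) = compose (pts A) (fhom U B D g) (fhom U A B f)"
  using U_functor assms unfolding is_functor_def Set_cat_def by simp

lemma fhom_Comp_apply:
  "\<lbrakk>f \<in> Hom X A B; g \<in> Hom X B D; A \<in> Ob X; B \<in> Ob X; D \<in> Ob X; x \<in> pts A\<rbrakk>
    \<Longrightarrow> fhom U A D (Comp X A B D g f) x = fhom U B D g (fhom U A B f x)"
  by (simp add: fhom_Comp compose_def)

lemma universe_subset: "A \<in> \<U> \<Longrightarrow> B \<subseteq> A \<Longrightarrow> B \<in> \<U>"
  using conjunct1[OF universe[unfolded set_universe_def]] by blast

lemma initial_lifting_exists:
  fixes I :: "('o \<times> 'm \<times> ('u \<Rightarrow> 'u)) set"
  assumes "A \<in> \<U>" "\<And>i. i \<in> I \<Longrightarrow> Y i \<in> Ob X" "\<And>i. i \<in> I \<Longrightarrow> f i \<in> A \<rightarrow>\<^sub>E pts (Y i)"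
  shows "\<exists>Z g. initial_lifting X (Set_cat \<U>) U I Y A f Z g"
proof -
  have "\<exists>!(Z, g). initial_lifting X (Set_cat \<U>) U I Y A f Z g"
    using topological assms unfolding topological_functor_def by (simp add: Set_cat_def)
  then show ?thesis by auto
qed

text \<open>
  A cardinality argument. If \<open>f \<noteq> g\<close> had the same underlying map, then the source consisting of one
  copy of that map for every index would have an initial lifting \<open>Z\<close>, and every choice of \<open>f\<close> or \<open>g\<close>
  for each index would determine a different morphism \<open>A \<rightarrow> Z\<close> over the identity. With as many
  indices as there are potential morphisms, this embeds a powerset into its base set.
\<close>

lemma faithful:
  assumes f: "f \<in> Hom X A B" and g: "g \<in> Hom X A B" and Ob: "A \<in> Ob X" "B \<in> Ob X"
    and eq: "fhom U A B f = fhom U A B g"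
  shows "f = g"
proof (rule ccontr)
  assume "f \<noteq> g"
  let ?UNIV = "UNIV :: ('o \<times> 'm \<times> ('u \<Rightarrow> 'u)) set"
  let ?idx = "\<lambda>m. (undefined, m, undefined) :: 'o \<times> 'm \<times> ('u \<Rightarrow> 'u)"
  have fA: "fhom U A B f \<in> pts A \<rightarrow>\<^sub>E pts B"
    by (rule fhom_PiE[OF f Ob])
  have "\<exists>Z k. initial_lifting X (Set_cat \<U>) U ?UNIV (\<lambda>_. B) (pts A) (\<lambda>_. fhom U A B f) Z k"
    by (rule initial_lifting_exists) (use Ob fA in \<open>auto simp: pts_universe\<close>)
  then obtain Z k where Z: "Z \<in> Ob X" "pts Z = pts A"
      and k: "\<And>i. k i \<in> Hom X Z B" "\<And>i. fhom U Z B (k i) = fhom U A B f"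
      and init: "initial_source X (Set_cat \<U>) U ?UNIV (\<lambda>_. B) Z k"
    unfolding initial_lifting_def by blast
  have "\<exists>v. \<forall>i. Comp X A Z B (k i) v = (if fst (snd i) \<in> S then f else g)" for S
  proof -
    let ?u = "\<lambda>x\<in>pts A. x"
    have "?u \<in> Hom (Set_cat \<U>) (pts A) (pts Z)"
      by (auto simp: Set_cat_def Z)
    moreover have "fhom U A B (if fst (snd i) \<in> S then f else g) =
        Comp (Set_cat \<U>) (pts A) (pts Z) (pts B) (fhom U Z B (k i)) ?u" for i
      using fA eq by (auto simp: Set_cat_def k compose_def PiE_def extensional_def)
    moreover have "\<forall>i\<in>?UNIV. (if fst (snd i) \<in> S then f else g) \<in> Hom X A B"
      using f g by simp
    ultimately show ?thesis
      using init[unfolded initial_source_def, THEN bspec, OF Ob(1), THEN spec,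
          of "\<lambda>i. if fst (snd i) \<in> S then f else g", THEN mp] by blast
  qed
  then obtain v where v: "\<And>S i. Comp X A Z B (k i) (v S) = (if fst (snd i) \<in> S then f else g)"
    by metis
  \<comment> \<open>\<open>\<phi>\<close> recovers a set of indices from the morphism that it determines.\<close>
  define \<phi> where "\<phi> m = {m'. Comp X A Z B (k (?idx m')) m = f}" for m
  have "\<phi> (v S) = S" for S
    using \<open>f \<noteq> g\<close> by (auto simp: \<phi>_def v)
  then have "range \<phi> = Pow UNIV"
    by (metis Pow_UNIV surjI)
  then show False
    using Cantors_theorem by blast
qed

lemma hom_eqI:
  assumes "f \<in> Hom X A B" "g \<in> Hom X A B" "A \<in> Ob X" "B \<in> Ob X"
    and "\<And>x. x \<in> pts A \<Longrightarrow> fhom U A B f x = fhom U A B g x"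
  shows "f = g"
  by (rule faithful[OF assms(1-4) PiE_ext[OF fhom_PiE[OF assms(1,3,4)] fhom_PiE[OF assms(2-4)]]])
    (rule assms(5))

text \<open>
  As \<open>U\<close> is faithful, lifts are determined by their underlying maps. A source can therefore be
  described by its underlying maps alone, as a set of pairs of an object and a map into its points,
  and initiality becomes a criterion for a map to underlie a morphism.
\<close>

lemma initial_lift:
  assumes A: "A \<in> \<U>"
    and src: "\<And>Y n. (Y, n) \<in> \<S> \<Longrightarrow> Y \<in> Ob X" "\<And>Y n. (Y, n) \<in> \<S> \<Longrightarrow> n \<in> A \<rightarrow>\<^sub>E pts Y"
  obtains Z where "Z \<in> Ob X" "pts Z = A"
    and "\<And>Y n. (Y, n) \<in> \<S> \<Longrightarrow> \<exists>g\<in>Hom X Z Y. fhom U Z Y g = n"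
    and "\<And>W u. W \<in> Ob X \<Longrightarrow> u \<in> pts W \<rightarrow>\<^sub>E A \<Longrightarrow>
      (\<And>Y n. (Y, n) \<in> \<S> \<Longrightarrow> \<exists>h\<in>Hom X W Y. fhom U W Y h = compose (pts W) n u) \<Longrightarrow>
      \<exists>v\<in>Hom X W Z. fhom U W Z v = u"
proof -
  \<comment> \<open>Each leg is repeated once for every morphism; the repetitions impose the same condition.\<close>
  let ?I = "{(Y, m :: 'm, n). (Y, n) \<in> \<S>}"
  have "\<exists>Z g. initial_lifting X (Set_cat \<U>) U ?I fst A (\<lambda>i. snd (snd i)) Z g"
    by (rule initial_lifting_exists[OF A]; clarsimp; erule src)
  then obtain Z g where Z: "Z \<in> Ob X" "pts Z = A"
      and g: "\<And>i. i \<in> ?I \<Longrightarrow> g i \<in> Hom X Z (fst i) \<and> fhom U Z (fst i) (g i) = snd (snd i)"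
      and init: "initial_source X (Set_cat \<U>) U ?I fst Z g"
    unfolding initial_lifting_def by blast
  show ?thesis
  proof
    show "Z \<in> Ob X" "pts Z = A" by fact+
    show "\<exists>g\<in>Hom X Z Y. fhom U Z Y g = n" if "(Y, n) \<in> \<S>" for Y n
      using g[of "(Y, undefined, n)"] that by auto
    show "\<exists>v\<in>Hom X W Z. fhom U W Z v = u"
      if W: "W \<in> Ob X" and u: "u \<in> pts W \<rightarrow>\<^sub>E A"
        and h: "\<And>Y n. (Y, n) \<in> \<S> \<Longrightarrow> \<exists>h\<in>Hom X W Y. fhom U W Y h = compose (pts W) n u" for W u
    proof -
      have "\<forall>i\<in>?I. \<exists>h. h \<in> Hom X W (fst i) \<and>
          fhom U W (fst i) h = compose (pts W) (snd (snd i)) u"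
        using h by auto
      then obtain h where h: "\<forall>i\<in>?I. h i \<in> Hom X W (fst i) \<and>
          fhom U W (fst i) (h i) = compose (pts W) (snd (snd i)) u"
        by metis
      have "\<exists>!v. v \<in> Hom X W Z \<and> fhom U W Z v = u \<and>
          (\<forall>i\<in>?I. Comp X W Z (fst i) (g i) v = h i)"
        using init[unfolded initial_source_def, rule_format, of W h u] W u h g Z
        by (simp add: Set_cat_def)
      then show ?thesis by blast
    qed
  qed
qed

section \<open>Indiscrete and discrete objects\<close>

lemma indiscrete:
  assumes "A \<in> \<U>"
  obtains Z where "Z \<in> Ob X" "pts Z = A"
    "\<And>W u. W \<in> Ob X \<Longrightarrow> u \<in> pts W \<rightarrow>\<^sub>E A \<Longrightarrow> \<exists>v\<in>Hom X W Z. fhom U W Z v = u"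
  by (rule initial_lift[OF assms, of "{}"]) auto

lemma two_points:
  obtains a b where "a \<noteq> b" "{a, b} \<in> \<U>"
  using universe unfolding set_universe_def by (metis card_2_iff)

text \<open>
  The initial lift of all maps out of a one-point set. Morphisms out of \<open>D\<close> are the same as
  points, so statements about points can be tested with morphisms.
\<close>

lemma discrete_point:
  obtains D a where "D \<in> Ob X" "pts D = {a}"
    "\<And>Y y. Y \<in> Ob X \<Longrightarrow> y \<in> pts Y \<Longrightarrow> \<exists>f\<in>Hom X D Y. fhom U D Y f a = y"
proof -
  obtain a where "{a} \<in> \<U>"
    using two_points universe_subset by (metis insert_subset subset_insertI2 empty_subsetI insertI1)
  then obtain D where D: "D \<in> Ob X" "pts D = {a}"
    and homs: "\<And>Y n. (Y, n) \<in> {(Y, n). Y \<in> Ob X \<and> n \<in> {a} \<rightarrow>\<^sub>E pts Y} \<Longrightarrow>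
      \<exists>g\<in>Hom X D Y. fhom U D Y g = n"
    by (rule initial_lift[where \<S> = "{(Y, n). Y \<in> Ob X \<and> n \<in> {a} \<rightarrow>\<^sub>E pts Y}"]) auto
  have "\<exists>f\<in>Hom X D Y. fhom U D Y f a = y" if "Y \<in> Ob X" "y \<in> pts Y" for Y y
  proof -
    have "\<exists>g\<in>Hom X D Y. fhom U D Y g = (\<lambda>x\<in>{a}. y)"
      using that by (intro homs) auto
    then obtain g where "g \<in> Hom X D Y" "fhom U D Y g = (\<lambda>x\<in>{a}. y)" by blast
    then show ?thesis by (intro bexI[of _ g]) simp_all
  qed
  then show ?thesis using that D by blast
qed

section \<open>Tabulations of relations\<close>

text \<open>
  \<open>P\<close> represents the relation \<open>r\<close>: its points are the pairs in \<open>r\<close>, and a pair of morphisms factors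
  through it as soon as it does so pointwise. Products and pullbacks are tabulations of suitable
  relations, and an equivalence relation on the points of \<open>A\<close> becomes a pseudo-equivalence
  relation on \<open>A\<close> by being tabulated.
\<close>

definition tabulates :: "'o \<Rightarrow> 'o \<Rightarrow> 'u rel \<Rightarrow> 'o \<Rightarrow> 'm \<Rightarrow> 'm \<Rightarrow> bool" where
  "tabulates A B r P p q \<longleftrightarrow> A \<in> Ob X \<and> B \<in> Ob X \<and> P \<in> Ob X \<and> p \<in> Hom X P A \<and> q \<in> Hom X P B \<and>
     bij_betw (\<lambda>z. (fhom U P A p z, fhom U P B q z)) (pts P) r \<and>
     (\<forall>Y\<in>Ob X. \<forall>a\<in>Hom X Y A. \<forall>b\<in>Hom X Y B.
        (\<forall>y\<in>pts Y. (fhom U Y A a y, fhom U Y B b y) \<in> r) \<longrightarrow>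
        (\<exists>u\<in>Hom X Y P. Comp X Y P A p u = a \<and> Comp X Y P B q u = b))"

text \<open>
  The initial lift of the two projections of \<open>r\<close>. As the universe contains products only up to
  bijection, the set \<open>r\<close> is replaced by a subset \<open>L\<close> of such a copy of the product.
\<close>

lemma tabulation_exists:
  assumes A: "A \<in> Ob X" and B: "B \<in> Ob X" and r: "r \<subseteq> pts A \<times> pts B"
  shows "\<exists>P p q. tabulates A B r P p q"
proof -
  obtain M \<phi> where M: "M \<in> \<U>" "bij_betw \<phi> M (pts A \<times> pts B)"
    using universe pts_universe[OF A] pts_universe[OF B]
    unfolding set_universe_def eqpoll_def by blast
  define L where "L = {z \<in> M. \<phi> z \<in> r}"
  have L: "L \<in> \<U>"
    by (rule universe_subset[OF M(1)]) (simp add: L_def)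
  have \<phi>: "bij_betw \<phi> L r"
  proof -
    have "r \<subseteq> \<phi> ` M"
      using r bij_betw_imp_surj_on[OF M(2)] by simp
    then have "\<phi> ` L = r"
      unfolding L_def by blast
    then show ?thesis
      using bij_betw_subset[OF M(2), of L] by (auto simp: L_def bij_betw_def)
  qed
  then have \<phi>_in: "\<phi> z \<in> r" if "z \<in> L" for z
    using that bij_betwE by blast
  define p where "p = (\<lambda>z\<in>L. fst (\<phi> z))"
  define q where "q = (\<lambda>z\<in>L. snd (\<phi> z))"
  have pq: "p \<in> L \<rightarrow>\<^sub>E pts A" "q \<in> L \<rightarrow>\<^sub>E pts B"
    using \<phi>_in r unfolding p_def q_def by (fastforce)+
  obtain P where P: "P \<in> Ob X" "pts P = L"
    and legs: "\<And>Y n. (Y, n) \<in> {(A, p), (B, q)} \<Longrightarrow> \<exists>g\<in>Hom X P Y. fhom U P Y g = n"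
    and lift: "\<And>W u. W \<in> Ob X \<Longrightarrow> u \<in> pts W \<rightarrow>\<^sub>E L \<Longrightarrow>
      (\<And>Y n. (Y, n) \<in> {(A, p), (B, q)} \<Longrightarrow>
        \<exists>h\<in>Hom X W Y. fhom U W Y h = compose (pts W) n u) \<Longrightarrow>
      \<exists>v\<in>Hom X W P. fhom U W P v = u"
    by (rule initial_lift[OF L, of "{(A, p), (B, q)}"]) (use A B pq in auto)
  obtain p' where p': "p' \<in> Hom X P A" "fhom U P A p' = p" using legs by blast
  obtain q' where q': "q' \<in> Hom X P B" "fhom U P B q' = q" using legs by blast
  have "bij_betw (\<lambda>z. (fhom U P A p' z, fhom U P B q' z)) (pts P) r"
    using \<phi> by (subst bij_betw_cong[where g = \<phi>]) (auto simp: P p' q' p_def q_def)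
  moreover have "\<exists>u\<in>Hom X Y P. Comp X Y P A p' u = a \<and> Comp X Y P B q' u = b"
    if Y: "Y \<in> Ob X" and a: "a \<in> Hom X Y A" and b: "b \<in> Hom X Y B"
      and ab: "\<forall>y\<in>pts Y. (fhom U Y A a y, fhom U Y B b y) \<in> r" for Y a b
  proof -
    define u where "u = (\<lambda>y\<in>pts Y. inv_into L \<phi> (fhom U Y A a y, fhom U Y B b y))"
    have u: "\<phi> (u y) = (fhom U Y A a y, fhom U Y B b y)" "u y \<in> L" if "y \<in> pts Y" for y
      using that ab \<phi> bij_betw_inv_into_right[OF \<phi>]
      by (auto simp: u_def bij_betw_def inv_into_into)
    have a_eq: "fhom U Y A a = compose (pts Y) p u"
      by (rule extensionalityI[where A = "pts Y"])
        (use fhom_PiE[OF a Y A] u in \<open>auto simp: PiE_def compose_def p_def\<close>)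
    have b_eq: "fhom U Y B b = compose (pts Y) q u"
      by (rule extensionalityI[where A = "pts Y"])
        (use fhom_PiE[OF b Y B] u in \<open>auto simp: PiE_def compose_def q_def\<close>)
    have "\<exists>v\<in>Hom X Y P. fhom U Y P v = u"
    proof (rule lift[OF Y])
      show "u \<in> pts Y \<rightarrow>\<^sub>E L" using u(2) by (auto simp: u_def)
      show "\<exists>h\<in>Hom X Y V. fhom U Y V h = compose (pts Y) n u" if "(V, n) \<in> {(A, p), (B, q)}" for V n
        using that a b a_eq b_eq by blast
    qed
    then obtain v where v: "v \<in> Hom X Y P" "fhom U Y P v = u" by blast
    have "Comp X Y P A p' v = a"
      by (rule faithful[OF category_Comp[OF category_X v(1) p'(1) Y P(1) A] a Y A])
        (simp only: fhom_Comp[OF v(1) p'(1) Y P(1) A] v(2) p'(2) a_eq)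
    moreover have "Comp X Y P B q' v = b"
      by (rule faithful[OF category_Comp[OF category_X v(1) q'(1) Y P(1) B] b Y B])
        (simp only: fhom_Comp[OF v(1) q'(1) Y P(1) B] v(2) q'(2) b_eq)
    ultimately show ?thesis using v by blast
  qed
  ultimately show ?thesis
    unfolding tabulates_def using A B P p' q' by blast
qed

lemma tabulates_hom_eqI:
  assumes "tabulates A B r P p q" "Y \<in> Ob X" "u \<in> Hom X Y P" "v \<in> Hom X Y P"
    and "Comp X Y P A p u = Comp X Y P A p v" "Comp X Y P B q u = Comp X Y P B q v"
  shows "u = v"
proof (rule hom_eqI[OF assms(3,4,2)])
  show "P \<in> Ob X" using assms(1) by (simp add: tabulates_def)
  fix y assume y: "y \<in> pts Y"
  have mem: "A \<in> Ob X" "B \<in> Ob X" "P \<in> Ob X" "p \<in> Hom X P A" "q \<in> Hom X P B"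
    and inj: "inj_on (\<lambda>z. (fhom U P A p z, fhom U P B q z)) (pts P)"
    using assms(1) by (auto simp: tabulates_def bij_betw_def)
  have "fhom U P A p (fhom U Y P u y) = fhom U P A p (fhom U Y P v y)"
    "fhom U P B q (fhom U Y P u y) = fhom U P B q (fhom U Y P v y)"
    using fhom_Comp_apply[of u Y P p A y] fhom_Comp_apply[of v Y P p A y]
      fhom_Comp_apply[of u Y P q B y] fhom_Comp_apply[of v Y P q B y] mem assms y by simp_all
  then show "fhom U Y P u y = fhom U Y P v y"
    using fhom_pts[OF assms(3,2) mem(3) y] fhom_pts[OF assms(4,2) mem(3) y]
    by (intro inj_onD[OF inj]) simp_all
qed

lemma tabulates_is_product:
  assumes "tabulates A B (pts A \<times> pts B) P p q"
  shows "is_binary_product X A B P p q"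
proof -
  have mem: "A \<in> Ob X" "B \<in> Ob X" "P \<in> Ob X" "p \<in> Hom X P A" "q \<in> Hom X P B"
    using assms(1) by (auto simp: tabulates_def bij_betw_def)
  have "\<exists>!u. u \<in> Hom X Y P \<and> (Comp X Y P A p u = a \<and> Comp X Y P B q u = b)"
    if "Y \<in> Ob X" "a \<in> Hom X Y A" "b \<in> Hom X Y B" for Y a b
  proof -
    have "\<exists>u\<in>Hom X Y P. Comp X Y P A p u = a \<and> Comp X Y P B q u = b"
      using assms that mem fhom_pts by (auto simp: tabulates_def)
    then show ?thesis
      using tabulates_hom_eqI[OF assms that(1)] by (metis (no_types))
  qed
  then show ?thesis
    unfolding is_binary_product_def is_product_def
    using mem by (simp add: all_bool_eq ball_UNIV)
qed

lemma tabulates_is_pullback: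
  assumes tab: "tabulates A B {(x, y). x \<in> pts A \<and> y \<in> pts B \<and> fhom U A D f x = fhom U B D g y} P p q"
    and D: "D \<in> Ob X" "f \<in> Hom X A D" "g \<in> Hom X B D"
  shows "is_pullback X A B D f g P p q"
proof -
  have mem: "A \<in> Ob X" "B \<in> Ob X" "P \<in> Ob X" "p \<in> Hom X P A" "q \<in> Hom X P B"
    and bij: "bij_betw (\<lambda>z. (fhom U P A p z, fhom U P B q z)) (pts P)
      {(x, y). x \<in> pts A \<and> y \<in> pts B \<and> fhom U A D f x = fhom U B D g y}"
    using tab by (auto simp: tabulates_def)
  have "Comp X P A D f p = Comp X P B D g q"
    by (rule hom_eqI[OF _ _ mem(3) D(1)])
      (use mem D category_X bij_betwE[OF bij] in \<open>auto simp: fhom_Comp_apply intro: category_Comp\<close>)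
  moreover have "\<exists>!u. u \<in> Hom X Y P \<and> Comp X Y P A p u = a \<and> Comp X Y P B q u = b"
    if Y: "Y \<in> Ob X" and a: "a \<in> Hom X Y A" and b: "b \<in> Hom X Y B"
      and sq: "Comp X Y A D f a = Comp X Y B D g b" for Y a b
  proof -
    have "fhom U A D f (fhom U Y A a y) = fhom U B D g (fhom U Y B b y)" if "y \<in> pts Y" for y
      using arg_cong[OF sq, of "\<lambda>h. fhom U Y D h y"] Y a b mem D that
      by (simp add: fhom_Comp_apply)
    then have "\<exists>u\<in>Hom X Y P. Comp X Y P A p u = a \<and> Comp X Y P B q u = b"
      using tab Y a b mem fhom_pts by (auto simp: tabulates_def)
    then show ?thesis
      using tabulates_hom_eqI[OF tab Y] by (metis (no_types))
  qed
  ultimately show ?thesis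
    unfolding is_pullback_def using mem D by blast
qed

section \<open>The underlying equivalence relation of a pseudo-equivalence relation\<close>

lemma pseudo_mem:
  assumes "pseudo_equivalence X R"
  shows "top R \<in> Ob X" "base R \<in> Ob X" "leg1 R \<in> Hom X (top R) (base R)"
    "leg2 R \<in> Hom X (top R) (base R)"
  using assms by (auto simp: pseudo_equivalence_def split: parallel_pair.splits)

text \<open>
  The next three lemmas say that the relation on the morphisms \<open>Y \<rightarrow> base R\<close> of being the two
  components of a morphism \<open>Y \<rightarrow> top R\<close> is an equivalence relation. With \<open>Y\<close> a base object this yields
  the equivalence of morphisms of the exact completion, with \<open>Y\<close> the discrete point it yields an
  equivalence relation on points.
\<close>

lemma pseudo_refl:
  assumes R: "pseudo_equivalence X R" and f: "f \<in> Hom X Y (base R)" and Y: "Y \<in> Ob X"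
  shows "\<exists>h\<in>Hom X Y (top R). Comp X Y (top R) (base R) (leg1 R) h = f \<and>
    Comp X Y (top R) (base R) (leg2 R) h = f"
proof -
  note mem = pseudo_mem[OF R]
  obtain r where r: "r \<in> Hom X (base R) (top R)"
    "Comp X (base R) (top R) (base R) (leg1 R) r = Id X (base R)"
    "Comp X (base R) (top R) (base R) (leg2 R) r = Id X (base R)"
    using R by (auto simp: pseudo_equivalence_def split: parallel_pair.splits)
  have "Comp X Y (base R) (top R) r f \<in> Hom X Y (top R)"
    using category_Comp[OF category_X f r(1)] mem Y by simp
  moreover have "Comp X Y (top R) (base R) l (Comp X Y (base R) (top R) r f) = f"
    if "l \<in> Hom X (top R) (base R)" "Comp X (base R) (top R) (base R) l r = Id X (base R)" for l
    using category_assoc[OF category_X f r(1) that(1)] category_Id_left[OF category_X f] mem Y that(2)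
    by simp
  ultimately show ?thesis
    using mem r by blast
qed

lemma pseudo_sym:
  assumes R: "pseudo_equivalence X R" and h: "h \<in> Hom X Y (top R)" and Y: "Y \<in> Ob X"
  shows "\<exists>k\<in>Hom X Y (top R).
    Comp X Y (top R) (base R) (leg1 R) k = Comp X Y (top R) (base R) (leg2 R) h \<and>
    Comp X Y (top R) (base R) (leg2 R) k = Comp X Y (top R) (base R) (leg1 R) h"
proof -
  note mem = pseudo_mem[OF R]
  obtain s where s: "s \<in> Hom X (top R) (top R)"
    "Comp X (top R) (top R) (base R) (leg1 R) s = leg2 R"
    "Comp X (top R) (top R) (base R) (leg2 R) s = leg1 R"
    using R by (auto simp: pseudo_equivalence_def split: parallel_pair.splits)
  have "Comp X Y (top R) (top R) s h \<in> Hom X Y (top R)"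
    using category_Comp[OF category_X h s(1)] mem Y by simp
  moreover have "Comp X Y (top R) (base R) l (Comp X Y (top R) (top R) s h) =
      Comp X Y (top R) (base R) l' h"
    if "l \<in> Hom X (top R) (base R)" "Comp X (top R) (top R) (base R) l s = l'" for l l'
    using category_assoc[OF category_X h s(1) that(1)] mem Y that(2) by simp
  ultimately show ?thesis
    using mem s by blast
qed

lemma pseudo_trans:
  assumes R: "pseudo_equivalence X R" and Y: "Y \<in> Ob X"
    and h: "h \<in> Hom X Y (top R)" and k: "k \<in> Hom X Y (top R)"
    and eq: "Comp X Y (top R) (base R) (leg2 R) h = Comp X Y (top R) (base R) (leg1 R) k"
  shows "\<exists>m\<in>Hom X Y (top R).
    Comp X Y (top R) (base R) (leg1 R) m = Comp X Y (top R) (base R) (leg1 R) h \<and>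
    Comp X Y (top R) (base R) (leg2 R) m = Comp X Y (top R) (base R) (leg2 R) k"
proof -
  note mem = pseudo_mem[OF R]
  obtain P p q where "tabulates (top R) (top R) {(x, y). x \<in> pts (top R) \<and> y \<in> pts (top R) \<and>
      fhom U (top R) (base R) (leg2 R) x = fhom U (top R) (base R) (leg1 R) y} P p q"
    using tabulation_exists[OF mem(1,1)] by (metis (no_types, lifting) SigmaI case_prodE mem_Collect_eq subsetI)
  then have pb: "is_pullback X (top R) (top R) (base R) (leg2 R) (leg1 R) P p q"
    using tabulates_is_pullback mem by blast
  then have P: "P \<in> Ob X" "p \<in> Hom X P (top R)" "q \<in> Hom X P (top R)"
    by (auto simp: is_pullback_def)
  obtain t where t: "t \<in> Hom X P (top R)"
    "Comp X P (top R) (base R) (leg1 R) t = Comp X P (top R) (base R) (leg1 R) p"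
    "Comp X P (top R) (base R) (leg2 R) t = Comp X P (top R) (base R) (leg2 R) q"
    using R pb unfolding pseudo_equivalence_def by (cases R) fastforce
  obtain u where u: "u \<in> Hom X Y P" "Comp X Y P (top R) p u = h" "Comp X Y P (top R) q u = k"
    using pb Y h k eq unfolding is_pullback_def by blast
  have "Comp X Y P (top R) t u \<in> Hom X Y (top R)"
    using category_Comp[OF category_X u(1) t(1)] mem Y P by simp
  moreover have "Comp X Y (top R) (base R) l (Comp X Y P (top R) t u) =
      Comp X Y (top R) (base R) l (Comp X Y P (top R) v u)"
    if "l \<in> Hom X (top R) (base R)" "v \<in> Hom X P (top R)"
      "Comp X P (top R) (base R) l t = Comp X P (top R) (base R) l v" for l v
    using category_assoc[OF category_X u(1) t(1) that(1)] category_assoc[OF category_X u(1) that(2,1)]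
      mem Y P that(3) by simp
  ultimately show ?thesis
    using mem t P u by metis
qed

text \<open>
  The image of \<open>top R\<close> in the square of the points of \<open>base R\<close>: the relation that remains when one
  forgets which elements of \<open>top R\<close> witness that two points are related.
\<close>

definition ker :: "('o, 'm) parallel_pair \<Rightarrow> 'u rel" where
  "ker R = (\<lambda>z. (fhom U (top R) (base R) (leg1 R) z, fhom U (top R) (base R) (leg2 R) z)) ` pts (top R)"

lemma ker_hom:
  assumes R: "pseudo_equivalence X R" and Y: "Y \<in> Ob X" and h: "h \<in> Hom X Y (top R)"
    and a: "Comp X Y (top R) (base R) (leg1 R) h = a" and b: "Comp X Y (top R) (base R) (leg2 R) h = b"
    and y: "y \<in> pts Y"
  shows "(fhom U Y (base R) a y, fhom U Y (base R) b y) \<in> ker R"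
  using pseudo_mem[OF R] fhom_Comp_apply[OF h] fhom_pts[OF h Y _ y] Y y
  by (auto simp: ker_def simp flip: a b)

text \<open>
  Conversely to \<open>ker_hom\<close>, two points related by \<open>ker R\<close> come from a single point of \<open>top R\<close>, which
  is a morphism out of the discrete point. Over objects other than the discrete point, pointwise
  related morphisms need not lift: choosing witnesses pointwise gives a map that need not underlie a
  morphism.
\<close>

lemma ker_lift:
  assumes R: "pseudo_equivalence X R" and xy: "(x, y) \<in> ker R"
    and D: "D \<in> Ob X" "pts D = {d}"
    and disc: "\<And>Y y. Y \<in> Ob X \<Longrightarrow> y \<in> pts Y \<Longrightarrow> \<exists>f\<in>Hom X D Y. fhom U D Y f d = y"
    and a: "a \<in> Hom X D (base R)" "fhom U D (base R) a d = x"
    and b: "b \<in> Hom X D (base R)" "fhom U D (base R) b d = y"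
  shows "\<exists>h\<in>Hom X D (top R). Comp X D (top R) (base R) (leg1 R) h = a \<and>
    Comp X D (top R) (base R) (leg2 R) h = b"
proof -
  note mem = pseudo_mem[OF R]
  obtain z where z: "z \<in> pts (top R)" "fhom U (top R) (base R) (leg1 R) z = x"
    "fhom U (top R) (base R) (leg2 R) z = y"
    using xy by (auto simp: ker_def)
  obtain h where h: "h \<in> Hom X D (top R)" "fhom U D (top R) h d = z"
    using disc[OF mem(1) z(1)] by blast
  have "Comp X D (top R) (base R) l h = c"
    if "l \<in> Hom X (top R) (base R)" "c \<in> Hom X D (base R)"
      "fhom U (top R) (base R) l z = fhom U D (base R) c d" for l c
    by (rule hom_eqI[OF category_Comp[OF category_X h(1) that(1) D(1) mem(1,2)] that(2) D(1) mem(2)])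
      (use fhom_Comp_apply[OF h(1) that(1) D(1) mem(1,2)] D h that(3) in simp)
  then show ?thesis
    using h mem a b z by metis
qed

lemma equiv_ker:
  assumes R: "pseudo_equivalence X R"
  shows "equiv (pts (base R)) (ker R)"
proof -
  note mem = pseudo_mem[OF R]
  obtain D d where D: "D \<in> Ob X" "pts D = {d}"
    and disc: "\<And>Y y. Y \<in> Ob X \<Longrightarrow> y \<in> pts Y \<Longrightarrow> \<exists>f\<in>Hom X D Y. fhom U D Y f d = y"
    using discrete_point by blast
  note lift = ker_lift[OF R _ D disc]
  have sub: "ker R \<subseteq> pts (base R) \<times> pts (base R)"
    using mem fhom_pts by (auto simp: ker_def)
  moreover have "refl_on (pts (base R)) (ker R)"
  proof (rule refl_onI)
    fix x assume x: "x \<in> pts (base R)"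
    obtain f where f: "f \<in> Hom X D (base R)" "fhom U D (base R) f d = x"
      using disc mem x by blast
    obtain h where "h \<in> Hom X D (top R)" "Comp X D (top R) (base R) (leg1 R) h = f"
        "Comp X D (top R) (base R) (leg2 R) h = f"
      using pseudo_refl[OF R f(1) D(1)] by blast
    from ker_hom[OF R D(1) this, of d] show "(x, x) \<in> ker R" using D f by simp
  qed
  moreover have "sym (ker R)"
  proof (rule symI)
    fix x y assume xy: "(x, y) \<in> ker R"
    then have pt: "x \<in> pts (base R)" "y \<in> pts (base R)" using sub by auto
    obtain a where a: "a \<in> Hom X D (base R)" "fhom U D (base R) a d = x" using disc mem pt by blast
    obtain b where b: "b \<in> Hom X D (base R)" "fhom U D (base R) b d = y" using disc mem pt by blast
    obtain h where h: "h \<in> Hom X D (top R)" "Comp X D (top R) (base R) (leg1 R) h = a"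
        "Comp X D (top R) (base R) (leg2 R) h = b"
      using lift[OF xy] a b by blast
    then obtain k where "k \<in> Hom X D (top R)" "Comp X D (top R) (base R) (leg1 R) k = b"
        "Comp X D (top R) (base R) (leg2 R) k = a"
      using pseudo_sym[OF R h(1) D(1)] by auto
    from ker_hom[OF R D(1) this, of d] show "(y, x) \<in> ker R" using D a b by simp
  qed
  moreover have "trans (ker R)"
  proof (rule transI)
    fix x y z assume xy: "(x, y) \<in> ker R" and yz: "(y, z) \<in> ker R"
    then have pt: "x \<in> pts (base R)" "y \<in> pts (base R)" "z \<in> pts (base R)" using sub by auto
    obtain a where a: "a \<in> Hom X D (base R)" "fhom U D (base R) a d = x" using disc mem pt by blast
    obtain b where b: "b \<in> Hom X D (base R)" "fhom U D (base R) b d = y" using disc mem pt by blast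
    obtain c where c: "c \<in> Hom X D (base R)" "fhom U D (base R) c d = z" using disc mem pt by blast
    obtain h where h: "h \<in> Hom X D (top R)" "Comp X D (top R) (base R) (leg1 R) h = a"
        "Comp X D (top R) (base R) (leg2 R) h = b"
      using lift[OF xy] a b by blast
    obtain k where k: "k \<in> Hom X D (top R)" "Comp X D (top R) (base R) (leg1 R) k = b"
        "Comp X D (top R) (base R) (leg2 R) k = c"
      using lift[OF yz] b c by blast
    obtain m where "m \<in> Hom X D (top R)" "Comp X D (top R) (base R) (leg1 R) m = a"
        "Comp X D (top R) (base R) (leg2 R) m = c"
      using pseudo_trans[OF R D(1) h(1) k(1)] h k by auto
    from ker_hom[OF R D(1) this, of d] show "(x, z) \<in> ker R" using D a c by simp
  qed
  ultimately show ?thesis by (auto intro: equivI)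
qed

section \<open>The exact completion and the category of equivalence relations\<close>

lemma ex_hom_Hom: "f \<in> ex_hom X R S \<Longrightarrow> f \<in> Hom X (base R) (base S)"
  by (simp add: ex_hom_def)

lemma ex_hom_Id:
  assumes R: "pseudo_equivalence X R"
  shows "Id X (base R) \<in> ex_hom X R R"
proof -
  note mem = pseudo_mem[OF R]
  show ?thesis
    unfolding ex_hom_def using mem category_X
    by (auto simp: category_rules intro!: bexI[of _ "Id X (top R)"])
qed

lemma ex_hom_Comp:
  assumes R: "pseudo_equivalence X R" and S: "pseudo_equivalence X S" and T: "pseudo_equivalence X T"
    and f: "f \<in> ex_hom X R S" and g: "g \<in> ex_hom X S T"
  shows "Comp X (base R) (base S) (base T) g f \<in> ex_hom X R T"
proof -
  note mem = category_X pseudo_mem[OF R] pseudo_mem[OF S] pseudo_mem[OF T]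
    ex_hom_Hom[OF f] ex_hom_Hom[OF g]
  obtain f' where f': "f' \<in> Hom X (top R) (top S)"
    "Comp X (top R) (base R) (base S) f (leg1 R) = Comp X (top R) (top S) (base S) (leg1 S) f'"
    "Comp X (top R) (base R) (base S) f (leg2 R) = Comp X (top R) (top S) (base S) (leg2 S) f'"
    using f unfolding ex_hom_def by blast
  obtain g' where g': "g' \<in> Hom X (top S) (top T)"
    "Comp X (top S) (base S) (base T) g (leg1 S) = Comp X (top S) (top T) (base T) (leg1 T) g'"
    "Comp X (top S) (base S) (base T) g (leg2 S) = Comp X (top S) (top T) (base T) (leg2 T) g'"
    using g unfolding ex_hom_def by blast
  have "Comp X (top R) (base R) (base T) (Comp X (base R) (base S) (base T) g f) r =
      Comp X (top R) (top T) (base T) t (Comp X (top R) (top S) (top T) g' f')"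
    if "r \<in> Hom X (top R) (base R)" "s \<in> Hom X (top S) (base S)" "t \<in> Hom X (top T) (base T)"
      "Comp X (top R) (base R) (base S) f r = Comp X (top R) (top S) (base S) s f'"
      "Comp X (top S) (base S) (base T) g s = Comp X (top S) (top T) (base T) t g'" for r s t
  proof -
    have "Comp X (top R) (base R) (base T) (Comp X (base R) (base S) (base T) g f) r
        = Comp X (top R) (top S) (base T) (Comp X (top S) (base S) (base T) g s) f'"
      using mem f'(1) that(1-4) by (simp add: category_assoc del: that(5))
    also have "\<dots> = Comp X (top R) (top T) (base T) t (Comp X (top R) (top S) (top T) g' f')"
      unfolding that(5) using mem f'(1) g'(1) that(3) by (simp add: category_assoc)
    finally show ?thesis .
  qed
  moreover have "Comp X (top R) (top S) (top T) g' f' \<in> Hom X (top R) (top T)"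
    "Comp X (base R) (base S) (base T) g f \<in> Hom X (base R) (base T)"
    using mem f'(1) g'(1) by (auto intro!: category_Comp)
  ultimately show ?thesis
    unfolding ex_hom_def using mem f' g' by blast
qed

lemma ex_relI:
  assumes "f \<in> ex_hom X R S" "g \<in> ex_hom X R S" "h \<in> Hom X (base R) (top S)"
    "Comp X (base R) (top S) (base S) (leg1 S) h = f" "Comp X (base R) (top S) (base S) (leg2 S) h = g"
  shows "(f, g) \<in> ex_rel X R S"
  using assms unfolding ex_rel_def by blast

lemma ex_relE:
  assumes "(f, g) \<in> ex_rel X R S"
  obtains h where "f \<in> ex_hom X R S" "g \<in> ex_hom X R S" "h \<in> Hom X (base R) (top S)"
    "Comp X (base R) (top S) (base S) (leg1 S) h = f" "Comp X (base R) (top S) (base S) (leg2 S) h = g"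
  using assms unfolding ex_rel_def by blast

lemma ex_rel_refl:
  assumes R: "pseudo_equivalence X R" and S: "pseudo_equivalence X S"
  shows "(f, f) \<in> ex_rel X R S \<longleftrightarrow> f \<in> ex_hom X R S"
proof
  assume f: "f \<in> ex_hom X R S"
  then show "(f, f) \<in> ex_rel X R S"
    using pseudo_refl[OF S ex_hom_Hom[OF f] pseudo_mem(2)[OF R]] by (auto intro: ex_relI)
qed (auto elim: ex_relE)

lemma ex_rel_trans:
  assumes R: "pseudo_equivalence X R" and S: "pseudo_equivalence X S"
    and "(f, g) \<in> ex_rel X R S" "(g, h) \<in> ex_rel X R S"
  shows "(f, h) \<in> ex_rel X R S"
  using assms(3,4)
  by (elim ex_relE) (use pseudo_trans[OF S pseudo_mem(2)[OF R]] in \<open>metis ex_relI\<close>)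

text \<open>
  For the compatibility with composition, both morphisms are changed one at a time: if \<open>l\<close> relates
  \<open>g\<close> to \<open>g'\<close>, then \<open>l \<cdot> f\<close> relates \<open>g \<cdot> f\<close> to \<open>g' \<cdot> f\<close>; and if \<open>k\<close> relates \<open>f\<close> to \<open>f'\<close> and \<open>g1\<close> lifts
  \<open>g'\<close>, then \<open>g1 \<cdot> k\<close> relates \<open>g' \<cdot> f\<close> to \<open>g' \<cdot> f'\<close>.
\<close>

sublocale ex: quotient_data X "{R. pseudo_equivalence X R}" base "ex_rel X"
proof (unfold_locales, unfold mem_Collect_eq)
  show "category X" by (rule category_X)
  fix R S T f g f' g' h
  assume R: "pseudo_equivalence X R"
  show "base R \<in> Ob X" by (rule pseudo_mem[OF R])
  show "(Id X (base R), Id X (base R)) \<in> ex_rel X R R"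
    using ex_rel_refl[OF R R] ex_hom_Id[OF R] by simp
  assume S: "pseudo_equivalence X S"
  show "f \<in> Hom X (base R) (base S)" if "(f, g) \<in> ex_rel X R S"
    using that by (elim ex_relE) (rule ex_hom_Hom)
  show "(g, f) \<in> ex_rel X R S" if "(f, g) \<in> ex_rel X R S"
    using that by (elim ex_relE) (use pseudo_sym[OF S _ pseudo_mem(2)[OF R]] in \<open>metis ex_relI\<close>)
  show "(f, h) \<in> ex_rel X R S" if "(f, g) \<in> ex_rel X R S" "(g, h) \<in> ex_rel X R S"
    by (rule ex_rel_trans[OF R S that])
  assume T: "pseudo_equivalence X T"
  assume ff: "(f, f') \<in> ex_rel X R S" and gg: "(g, g') \<in> ex_rel X S T"
  obtain k where k: "k \<in> Hom X (base R) (top S)" "Comp X (base R) (top S) (base S) (leg1 S) k = f"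
      "Comp X (base R) (top S) (base S) (leg2 S) k = f'"
    and f: "f \<in> ex_hom X R S" "f' \<in> ex_hom X R S"
    using ff by (elim ex_relE)
  obtain l where l: "l \<in> Hom X (base S) (top T)" "Comp X (base S) (top T) (base T) (leg1 T) l = g"
      "Comp X (base S) (top T) (base T) (leg2 T) l = g'"
    and g: "g \<in> ex_hom X S T" "g' \<in> ex_hom X S T"
    using gg by (elim ex_relE)
  obtain g1 where g1: "g1 \<in> Hom X (top S) (top T)"
    "Comp X (top S) (base S) (base T) g' (leg1 S) = Comp X (top S) (top T) (base T) (leg1 T) g1"
    "Comp X (top S) (base S) (base T) g' (leg2 S) = Comp X (top S) (top T) (base T) (leg2 T) g1"
    using g(2) unfolding ex_hom_def by blast
  note mem = category_X pseudo_mem[OF R] pseudo_mem[OF S] pseudo_mem[OF T]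
    ex_hom_Hom[OF f(1)] ex_hom_Hom[OF f(2)] ex_hom_Hom[OF g(1)] ex_hom_Hom[OF g(2)] k(1) l(1) g1(1)
  have "(Comp X (base R) (base S) (base T) g f, Comp X (base R) (base S) (base T) g' f) \<in> ex_rel X R T"
  proof (rule ex_relI)
    show "Comp X (base R) (base S) (base T) g f \<in> ex_hom X R T"
      "Comp X (base R) (base S) (base T) g' f \<in> ex_hom X R T"
      using f g ex_hom_Comp[OF R S T] by blast+
    show "Comp X (base R) (base S) (top T) l f \<in> Hom X (base R) (top T)"
      using mem by (auto intro!: category_Comp)
    show "Comp X (base R) (top T) (base T) (leg1 T) (Comp X (base R) (base S) (top T) l f)
        = Comp X (base R) (base S) (base T) g f"
      "Comp X (base R) (top T) (base T) (leg2 T) (Comp X (base R) (base S) (top T) l f)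
        = Comp X (base R) (base S) (base T) g' f"
      using mem l by (simp_all flip: category_assoc)
  qed
  moreover have "(Comp X (base R) (base S) (base T) g' f, Comp X (base R) (base S) (base T) g' f') \<in> ex_rel X R T"
  proof (rule ex_relI)
    show "Comp X (base R) (base S) (base T) g' f \<in> ex_hom X R T"
      "Comp X (base R) (base S) (base T) g' f' \<in> ex_hom X R T"
      using f g ex_hom_Comp[OF R S T] by blast+
    show "Comp X (base R) (top S) (top T) g1 k \<in> Hom X (base R) (top T)"
      using mem by (auto intro!: category_Comp)
    have "Comp X (base R) (top T) (base T) t (Comp X (base R) (top S) (top T) g1 k)
        = Comp X (base R) (base S) (base T) g' (Comp X (base R) (top S) (base S) s k)"
      if "s \<in> Hom X (top S) (base S)" "t \<in> Hom X (top T) (base T)"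
        "Comp X (top S) (base S) (base T) g' s = Comp X (top S) (top T) (base T) t g1" for s t
    proof -
      have "Comp X (base R) (top T) (base T) t (Comp X (base R) (top S) (top T) g1 k)
          = Comp X (base R) (top S) (base T) (Comp X (top S) (top T) (base T) t g1) k"
        using mem that(1,2) by (simp add: category_assoc)
      also have "\<dots> = Comp X (base R) (base S) (base T) g' (Comp X (base R) (top S) (base S) s k)"
        unfolding that(3)[symmetric] using mem that(1,2) by (simp add: category_assoc)
      finally show ?thesis .
    qed
    then show "Comp X (base R) (top T) (base T) (leg1 T) (Comp X (base R) (top S) (top T) g1 k)
        = Comp X (base R) (base S) (base T) g' f"
      "Comp X (base R) (top T) (base T) (leg2 T) (Comp X (base R) (top S) (top T) g1 k)
        = Comp X (base R) (base S) (base T) g' f'"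
      using mem k g1 by metis+
  qed
  ultimately show "(Comp X (base R) (base S) (base T) g f, Comp X (base R) (base S) (base T) g' f') \<in> ex_rel X R T"
    by (rule ex_rel_trans[OF R T])
qed

lemma equ_hom_iff:
  "f \<in> equ_hom X U (A, r) (B, s) \<longleftrightarrow> f \<in> Hom X A B \<and>
    (\<forall>x x'. (x, x') \<in> r \<longrightarrow> (fhom U A B f x, fhom U A B f x') \<in> s)"
  by (auto simp: equ_hom_def)

text \<open>
  Since morphisms preserve the relations, equivalence of two morphisms only has to be checked on equal
  arguments.
\<close>

lemma equ_rel_iff:
  assumes r: "equiv (pts A) r" and s: "equiv (pts B) s"
  shows "(f, g) \<in> equ_rel X U (A, r) (B, s) \<longleftrightarrow>
    f \<in> equ_hom X U (A, r) (B, s) \<and> g \<in> equ_hom X U (A, r) (B, s) \<and>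
    (\<forall>x\<in>pts A. (fhom U A B f x, fhom U A B g x) \<in> s)"
proof -
  have "(\<forall>(x, x')\<in>r. (fhom U A B f x, fhom U A B g x') \<in> s) \<longleftrightarrow>
      (\<forall>x\<in>pts A. (fhom U A B f x, fhom U A B g x) \<in> s)"
    if "g \<in> equ_hom X U (A, r) (B, s)"
  proof
    assume "\<forall>(x, x')\<in>r. (fhom U A B f x, fhom U A B g x') \<in> s"
    then show "\<forall>x\<in>pts A. (fhom U A B f x, fhom U A B g x) \<in> s"
      using r by (auto elim!: equivE dest: refl_onD)
  next
    assume *: "\<forall>x\<in>pts A. (fhom U A B f x, fhom U A B g x) \<in> s"
    have "(fhom U A B f x, fhom U A B g x') \<in> s" if xx': "(x, x') \<in> r" for x x'
    proof -
      have "x \<in> pts A" using r xx' by (auto elim: equivE)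
      then show ?thesis
        using * xx' \<open>g \<in> equ_hom X U (A, r) (B, s)\<close> s unfolding equ_hom_iff
        by (blast elim: equivE dest: transD)
    qed
    then show "\<forall>(x, x')\<in>r. (fhom U A B f x, fhom U A B g x') \<in> s" by blast
  qed
  then show ?thesis
    by (auto simp: equ_rel_def)
qed

sublocale equ: quotient_data X "{(A, r). A \<in> Ob X \<and> equiv (pts A) r}" fst "equ_rel X U"
proof (unfold_locales, goal_cases)
  case 1 then show ?case by (rule category_X)
next
  case (2 A) then show ?case by auto
next
  case (3 A B f g) then show ?case by (auto simp: equ_rel_def equ_hom_def)
next
  case (4 A B f g)
  then show ?case
    by (cases A, cases B) (auto simp: equ_rel_iff equiv_def dest: symD)
next
  case (5 A B f g h)
  then show ?case
    by (cases A, cases B) (auto simp: equ_rel_iff equiv_def dest: transD)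
next
  case (6 A)
  then show ?case
    using category_X
    by (cases A) (auto simp: equ_rel_iff equ_hom_iff equiv_def category_Id fhom_Id subset_iff
        dest: refl_onD)
next
  case (7 A B D f f' g g')
  obtain A0 r B0 s D0 t where [simp]: "A = (A0, r)" "B = (B0, s)" "D = (D0, t)"
    by (cases A, cases B, cases D)
  have ob: "A0 \<in> Ob X" "B0 \<in> Ob X" "D0 \<in> Ob X"
    and eq: "equiv (pts A0) r" "equiv (pts B0) s" "equiv (pts D0) t"
    using 7(1-3) by auto
  have hom: "Comp X A0 B0 D0 h k \<in> equ_hom X U (A0, r) (D0, t)"
    if "k \<in> equ_hom X U (A0, r) (B0, s)" "h \<in> equ_hom X U (B0, s) (D0, t)" for h k
    using that ob category_X eq(1) unfolding equ_hom_iff equiv_def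
    by (auto simp: fhom_Comp_apply category_Comp subset_iff)
  have "(fhom U B0 D0 g (fhom U A0 B0 f x), fhom U B0 D0 g' (fhom U A0 B0 f' x)) \<in> t"
    if x: "x \<in> pts A0" for x
  proof -
    have "(fhom U A0 B0 f x, fhom U A0 B0 f' x) \<in> s"
      using 7(4) x by (simp add: equ_rel_iff eq)
    moreover have "\<forall>(y, y')\<in>s. (fhom U B0 D0 g y, fhom U B0 D0 g' y') \<in> t"
      using 7(5) by (simp add: equ_rel_def)
    ultimately show ?thesis by blast
  qed
  then show ?case
    using 7(4,5) hom ob by (auto simp: equ_rel_iff eq equ_hom_iff fhom_Comp_apply)
qed

abbreviation "ExC \<equiv> exact_completion X"
abbreviation "EqC \<equiv> Equ X U"
abbreviation "PerC \<equiv> PER_RegMono X"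

lemma Ob_ExC: "R \<in> Ob ExC \<longleftrightarrow> pseudo_equivalence X R"
  by (simp add: exact_completion_def)

lemma category_ExC: "category ExC"
  using ex.category_quotient by (simp add: exact_completion_def)

lemma Hom_ExC:
  assumes "R \<in> Ob ExC" "S \<in> Ob ExC"
  shows "c \<in> Hom ExC R S \<longleftrightarrow> (\<exists>f\<in>ex_hom X R S. c = ex_rel X R S `` {f})"
  using assms unfolding Ob_ExC by (auto simp: exact_completion_def ex.Hom_quotient ex_rel_refl)

lemma Comp_ExC:
  assumes "R \<in> Ob ExC" "S \<in> Ob ExC" "T \<in> Ob ExC" "f \<in> ex_hom X R S" "g \<in> ex_hom X S T"
  shows "Comp ExC R S T (ex_rel X S T `` {g}) (ex_rel X R S `` {f})
    = ex_rel X R T `` {Comp X (base R) (base S) (base T) g f}"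
  using assms unfolding Ob_ExC by (simp add: exact_completion_def ex.Comp_quotient ex_rel_refl)

lemma class_ExC_eq:
  assumes "R \<in> Ob ExC" "S \<in> Ob ExC" "f \<in> ex_hom X R S"
  shows "ex_rel X R S `` {f} = ex_rel X R S `` {g} \<longleftrightarrow> (f, g) \<in> ex_rel X R S"
  using assms unfolding Ob_ExC by (intro ex.class_eq) (auto simp: ex_rel_refl)

lemma Ob_EqC: "(A, r) \<in> Ob EqC \<longleftrightarrow> A \<in> Ob X \<and> equiv (pts A) r"
  by (simp add: Equ_def)

lemma category_EqC: "category EqC"
  using equ.category_quotient by (simp add: Equ_def)

lemma equ_rel_refl:
  assumes "(A, r) \<in> Ob EqC" "(B, s) \<in> Ob EqC"
  shows "(f, f) \<in> equ_rel X U (A, r) (B, s) \<longleftrightarrow> f \<in> equ_hom X U (A, r) (B, s)"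
  by (auto simp: equ_rel_def equ_hom_def)

lemma Hom_EqC:
  assumes "V \<in> Ob EqC" "W \<in> Ob EqC"
  shows "c \<in> Hom EqC V W \<longleftrightarrow> (\<exists>f\<in>equ_hom X U V W. c = equ_rel X U V W `` {f})"
  using assms by (cases V, cases W)
    (auto simp: equ_rel_refl[unfolded Ob_EqC] Ob_EqC Equ_def equ.Hom_quotient)

lemma Comp_EqC:
  assumes "V \<in> Ob EqC" "W \<in> Ob EqC" "Z \<in> Ob EqC" "f \<in> equ_hom X U V W" "g \<in> equ_hom X U W Z"
  shows "Comp EqC V W Z (equ_rel X U W Z `` {g}) (equ_rel X U V W `` {f})
    = equ_rel X U V Z `` {Comp X (fst V) (fst W) (fst Z) g f}"
  using assms by (cases V, cases W, cases Z)
    (auto simp: equ_rel_refl[unfolded Ob_EqC] Ob_EqC Equ_def equ.Comp_quotient)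

lemma class_EqC_eq:
  assumes "V \<in> Ob EqC" "W \<in> Ob EqC" "f \<in> equ_hom X U V W"
  shows "equ_rel X U V W `` {f} = equ_rel X U V W `` {g} \<longleftrightarrow> (f, g) \<in> equ_rel X U V W"
  using assms by (cases V, cases W)
    (intro equ.class_eq; auto simp: equ_rel_refl[unfolded Ob_EqC] Ob_EqC)

section \<open>The underlying object with equivalence relation\<close>

definition under :: "('o, 'm) parallel_pair \<Rightarrow> 'o \<times> 'u rel" where
  "under R = (base R, ker R)"

text \<open>
  The class of a morphism can only grow when the witnesses are forgotten, so the functor sends a class
  to its closure under the coarser relation.
\<close>

definition under_hom ::
  "('o, 'm) parallel_pair \<Rightarrow> ('o, 'm) parallel_pair \<Rightarrow> 'm set \<Rightarrow> 'm set" where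
  "under_hom R S c = equ_rel X U (under R) (under S) `` c"

lemma fst_under [simp]: "fst (under R) = base R"
  by (simp add: under_def)

lemma under_Ob: "R \<in> Ob ExC \<Longrightarrow> under R \<in> Ob EqC"
  by (simp add: under_def Ob_ExC Ob_EqC pseudo_mem equiv_ker)

lemma equ_hom_under:
  "f \<in> equ_hom X U (under R) (under S) \<longleftrightarrow> f \<in> Hom X (base R) (base S) \<and>
    (\<forall>x x'. (x, x') \<in> ker R \<longrightarrow> (fhom U (base R) (base S) f x, fhom U (base R) (base S) f x') \<in> ker S)"
  by (simp add: under_def equ_hom_iff)

lemma equ_rel_under:
  assumes "R \<in> Ob ExC" "S \<in> Ob ExC"
  shows "(f, g) \<in> equ_rel X U (under R) (under S) \<longleftrightarrow>
    f \<in> equ_hom X U (under R) (under S) \<and> g \<in> equ_hom X U (under R) (under S) \<and>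
    (\<forall>x\<in>pts (base R). (fhom U (base R) (base S) f x, fhom U (base R) (base S) g x) \<in> ker S)"
  using assms by (simp add: under_def Ob_ExC equ_rel_iff equiv_ker)

lemma ex_hom_under:
  assumes "R \<in> Ob ExC" "S \<in> Ob ExC" "f \<in> ex_hom X R S"
  shows "f \<in> equ_hom X U (under R) (under S)"
proof -
  have R: "pseudo_equivalence X R" and S: "pseudo_equivalence X S"
    using assms by (simp_all add: Ob_ExC)
  note mem = pseudo_mem[OF R] pseudo_mem[OF S]
  have f: "f \<in> Hom X (base R) (base S)"
    using assms(3) by (rule ex_hom_Hom)
  obtain g where g: "g \<in> Hom X (top R) (top S)"
    "Comp X (top R) (top S) (base S) (leg1 S) g = Comp X (top R) (base R) (base S) f (leg1 R)"
    "Comp X (top R) (top S) (base S) (leg2 S) g = Comp X (top R) (base R) (base S) f (leg2 R)"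
    using assms(3) unfolding ex_hom_def by force
  have "(fhom U (base R) (base S) f x, fhom U (base R) (base S) f x') \<in> ker S"
    if xx': "(x, x') \<in> ker R" for x x'
  proof -
    obtain z where z: "z \<in> pts (top R)" "fhom U (top R) (base R) (leg1 R) z = x"
      "fhom U (top R) (base R) (leg2 R) z = x'"
      using xx' by (auto simp: ker_def)
    show ?thesis
      using ker_hom[OF S mem(1) g z(1)] fhom_Comp_apply[OF mem(3) f mem(1,2,6) z(1)]
        fhom_Comp_apply[OF mem(4) f mem(1,2,6) z(1)] z by simp
  qed
  then show ?thesis
    using f by (simp add: equ_hom_under)
qed

lemma ex_rel_under:
  assumes "R \<in> Ob ExC" "S \<in> Ob ExC" "(f, g) \<in> ex_rel X R S"
  shows "(f, g) \<in> equ_rel X U (under R) (under S)"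
proof -
  have R: "pseudo_equivalence X R" and S: "pseudo_equivalence X S"
    using assms by (simp_all add: Ob_ExC)
  obtain h where "f \<in> ex_hom X R S" "g \<in> ex_hom X R S" "h \<in> Hom X (base R) (top S)"
    "Comp X (base R) (top S) (base S) (leg1 S) h = f" "Comp X (base R) (top S) (base S) (leg2 S) h = g"
    using assms(3) by (rule ex_relE)
  then show ?thesis
    using ker_hom[OF S pseudo_mem(2)[OF R]] assms(1,2) by (simp add: equ_rel_under ex_hom_under)
qed

lemma under_hom_class:
  assumes "R \<in> Ob ExC" "S \<in> Ob ExC" "f \<in> ex_hom X R S"
  shows "under_hom R S (ex_rel X R S `` {f}) = equ_rel X U (under R) (under S) `` {f}"
proof -
  have "(f, f) \<in> ex_rel X R S"
    using assms by (simp add: Ob_ExC ex_rel_refl)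
  moreover have "(f, h) \<in> equ_rel X U (under R) (under S)"
    if "(f, g) \<in> ex_rel X R S" "(g, h) \<in> equ_rel X U (under R) (under S)" for g h
    using equ.rel_trans[OF _ _ ex_rel_under[OF assms(1,2) that(1)] that(2)] assms(1,2)
    by (simp add: under_def Ob_ExC pseudo_mem equiv_ker)
  ultimately show ?thesis
    unfolding under_hom_def by blast
qed

lemma under_functor: "is_functor ExC EqC \<lparr>fob = under, fhom = under_hom\<rparr>"
proof -
  have 1: "under_hom R S c \<in> Hom EqC (under R) (under S)"
    if "R \<in> Ob ExC" "S \<in> Ob ExC" "c \<in> Hom ExC R S" for R S c
    using that by (auto simp: Hom_ExC Hom_EqC under_Ob under_hom_class intro: ex_hom_under)
  have 2: "under_hom R R (Id ExC R) = Id EqC (under R)" if R: "R \<in> Ob ExC" for R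
    using under_hom_class[OF R R ex_hom_Id] R
    by (simp add: Ob_ExC exact_completion_def Equ_def ex.Id_quotient equ.Id_quotient)
  have 3: "under_hom R T (Comp ExC R S T d c) =
      Comp EqC (under R) (under S) (under T) (under_hom S T d) (under_hom R S c)"
    if Ob: "R \<in> Ob ExC" "S \<in> Ob ExC" "T \<in> Ob ExC" and cd: "c \<in> Hom ExC R S" "d \<in> Hom ExC S T" for R S T c d
  proof -
    obtain f where f: "f \<in> ex_hom X R S" "c = ex_rel X R S `` {f}"
      using cd(1) Hom_ExC[OF Ob(1,2)] by blast
    obtain g where g: "g \<in> ex_hom X S T" "d = ex_rel X S T `` {g}"
      using cd(2) Hom_ExC[OF Ob(2,3)] by blast
    have gf: "Comp X (base R) (base S) (base T) g f \<in> ex_hom X R T"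
      using ex_hom_Comp f g Ob by (simp add: Ob_ExC)
    show ?thesis
      unfolding f(2) g(2) Comp_ExC[OF Ob f(1) g(1)] under_hom_class[OF Ob(1,3) gf]
        under_hom_class[OF Ob(1,2) f(1)] under_hom_class[OF Ob(2,3) g(1)]
      using Comp_EqC[OF Ob[THEN under_Ob] ex_hom_under[OF Ob(1,2) f(1)] ex_hom_under[OF Ob(2,3) g(1)]]
      by simp
  qed
  show ?thesis
    unfolding is_functor_def using category_ExC category_EqC under_Ob 1 2 3 by simp
qed

section \<open>Saturated pseudo-equivalence relations\<close>

text \<open>
  Pointwise related morphisms into \<open>base S\<close> are related by a morphism into \<open>top S\<close>: nothing is lost by
  passing from \<open>S\<close> to \<open>ker S\<close>. This holds when \<open>\<langle>leg1, leg2\<rangle>\<close> is a regular monomorphism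
  (\<open>saturated_if_pairing_regular_mono\<close>), and it makes morphisms into \<open>S\<close> in the exact completion
  literally the same sets as morphisms into \<open>under S\<close> in \<open>Equ\<close>.
\<close>

definition saturated :: "('o, 'm) parallel_pair \<Rightarrow> bool" where
  "saturated S \<longleftrightarrow> (\<forall>Y\<in>Ob X. \<forall>a\<in>Hom X Y (base S). \<forall>b\<in>Hom X Y (base S).
     (\<forall>y\<in>pts Y. (fhom U Y (base S) a y, fhom U Y (base S) b y) \<in> ker S) \<longrightarrow>
     (\<exists>h\<in>Hom X Y (top S). Comp X Y (top S) (base S) (leg1 S) h = a \<and>
        Comp X Y (top S) (base S) (leg2 S) h = b))"

lemma ex_hom_saturated:
  assumes "R \<in> Ob ExC" "S \<in> Ob ExC" "saturated S"
  shows "ex_hom X R S = equ_hom X U (under R) (under S)"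
proof
  show "ex_hom X R S \<subseteq> equ_hom X U (under R) (under S)"
    using ex_hom_under[OF assms(1,2)] by blast
  show "equ_hom X U (under R) (under S) \<subseteq> ex_hom X R S"
  proof
    fix f assume f: "f \<in> equ_hom X U (under R) (under S)"
    have R: "pseudo_equivalence X R" and S: "pseudo_equivalence X S"
      using assms by (simp_all add: Ob_ExC)
    note mem = pseudo_mem[OF R] pseudo_mem[OF S]
    have fH: "f \<in> Hom X (base R) (base S)" using f by (simp add: equ_hom_under)
    let ?a = "Comp X (top R) (base R) (base S) f (leg1 R)"
    let ?b = "Comp X (top R) (base R) (base S) f (leg2 R)"
    have "?a \<in> Hom X (top R) (base S)" "?b \<in> Hom X (top R) (base S)"
      using mem fH category_X by (auto intro: category_Comp)
    moreover have "\<forall>z\<in>pts (top R).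
        (fhom U (top R) (base S) ?a z, fhom U (top R) (base S) ?b z) \<in> ker S"
    proof
      fix z assume z: "z \<in> pts (top R)"
      then have "(fhom U (top R) (base R) (leg1 R) z, fhom U (top R) (base R) (leg2 R) z) \<in> ker R"
        by (auto simp: ker_def)
      then show "(fhom U (top R) (base S) ?a z, fhom U (top R) (base S) ?b z) \<in> ker S"
        using f mem fH z by (simp add: equ_hom_under fhom_Comp_apply)
    qed
    ultimately obtain g where "g \<in> Hom X (top R) (top S)"
      "Comp X (top R) (top S) (base S) (leg1 S) g = ?a"
      "Comp X (top R) (top S) (base S) (leg2 S) g = ?b"
      using assms(3) mem(1) unfolding saturated_def by blast
    then show "f \<in> ex_hom X R S"
      using fH unfolding ex_hom_def by force
  qed
qed

lemma ex_rel_saturated: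
  assumes "R \<in> Ob ExC" "S \<in> Ob ExC" "saturated S"
  shows "ex_rel X R S = equ_rel X U (under R) (under S)"
proof (intro equalityI subrelI)
  show "(f, g) \<in> equ_rel X U (under R) (under S)" if "(f, g) \<in> ex_rel X R S" for f g
    using ex_rel_under[OF assms(1,2) that] .
  fix f g assume "(f, g) \<in> equ_rel X U (under R) (under S)"
  then have fg: "f \<in> equ_hom X U (under R) (under S)" "g \<in> equ_hom X U (under R) (under S)"
    and *: "\<forall>x\<in>pts (base R). (fhom U (base R) (base S) f x, fhom U (base R) (base S) g x) \<in> ker S"
    using assms by (auto simp: equ_rel_under)
  then have "f \<in> Hom X (base R) (base S)" "g \<in> Hom X (base R) (base S)"
    by (auto simp: equ_hom_under)
  moreover have "base R \<in> Ob X" using assms(1) by (simp add: Ob_ExC pseudo_mem)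
  ultimately obtain h where "h \<in> Hom X (base R) (top S)"
    "Comp X (base R) (top S) (base S) (leg1 S) h = f" "Comp X (base R) (top S) (base S) (leg2 S) h = g"
    using assms(3) * unfolding saturated_def by blast
  then show "(f, g) \<in> ex_rel X R S"
    using fg by (intro ex_relI) (simp_all add: ex_hom_saturated[OF assms])
qed

lemma binary_product_ex1:
  assumes P: "is_binary_product C A B P p q" and Y: "Y \<in> Ob C"
    and "a \<in> Hom C Y A" "b \<in> Hom C Y B"
  shows "\<exists>!u. u \<in> Hom C Y P \<and> Comp C Y P A p u = a \<and> Comp C Y P B q u = b"
  using is_product_ex1[OF P[unfolded is_binary_product_def] Y, of "\<lambda>i. if i then a else b"] assms(3,4)
  by (simp add: all_bool_eq ball_UNIV)

text \<open>
  Points are morphisms out of the discrete point, so the uniqueness part of the universal property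
  separates them.
\<close>

lemma binary_product_pts_eqI:
  assumes P: "is_binary_product X A B P p q"
    and w: "w \<in> pts P" "w' \<in> pts P"
    and eq: "fhom U P A p w = fhom U P A p w'" "fhom U P B q w = fhom U P B q w'"
  shows "w = w'"
proof -
  have mem: "A \<in> Ob X" "B \<in> Ob X" "P \<in> Ob X" "p \<in> Hom X P A" "q \<in> Hom X P B"
    using P by (auto simp: is_binary_product_def is_product_def all_bool_eq ball_UNIV split: if_splits)
  obtain D d where D: "D \<in> Ob X" "pts D = {d}"
    and disc: "\<And>Y y. Y \<in> Ob X \<Longrightarrow> y \<in> pts Y \<Longrightarrow> \<exists>f\<in>Hom X D Y. fhom U D Y f d = y"
    using discrete_point by blast
  obtain f where f: "f \<in> Hom X D P" "fhom U D P f d = w" using disc mem w by blast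
  obtain g where g: "g \<in> Hom X D P" "fhom U D P g d = w'" using disc mem w by blast
  have *: "Comp X D P A p f \<in> Hom X D A" "Comp X D P A p g \<in> Hom X D A"
    "Comp X D P B q f \<in> Hom X D B" "Comp X D P B q g \<in> Hom X D B"
    using category_X D mem f g by (auto intro: category_Comp)
  have "Comp X D P A p f = Comp X D P A p g"
    by (rule hom_eqI[OF *(1,2) D(1) mem(1)]) (use D mem f g eq in \<open>simp add: fhom_Comp_apply\<close>)
  moreover have "Comp X D P B q f = Comp X D P B q g"
    by (rule hom_eqI[OF *(3,4) D(1) mem(2)]) (use D mem f g eq in \<open>simp add: fhom_Comp_apply\<close>)
  ultimately have "f = g"
    using binary_product_ex1[OF P D(1) *(2,4)] f(1) g(1) by blast
  then show ?thesis using f g by simp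
qed

text \<open>
  Let \<open>m\<close> be the equalizer of \<open>f\<close> and \<open>g\<close>. If \<open>a\<close> and \<open>b\<close> are pointwise related, then the pairing
  \<open>u\<close> of \<open>a\<close> and \<open>b\<close> takes values in the image of \<open>m\<close>, so \<open>f \<cdot> u\<close> and \<open>g \<cdot> u\<close> agree on points, hence
  agree by faithfulness, and \<open>u\<close> factors through \<open>m\<close>.
\<close>

lemma saturated_if_pairing_regular_mono:
  assumes "S \<in> Ob ExC" and S: "pairing_regular_mono X S"
  shows "saturated S"
  unfolding saturated_def
proof (intro ballI impI)
  fix Y a b
  assume Y: "Y \<in> Ob X" and a: "a \<in> Hom X Y (base S)" and b: "b \<in> Hom X Y (base S)"
    and ab: "\<forall>y\<in>pts Y. (fhom U Y (base S) a y, fhom U Y (base S) b y) \<in> ker S"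
  obtain P p q m where P: "is_binary_product X (base S) (base S) P p q"
    and m: "m \<in> Hom X (top S) P" "Comp X (top S) P (base S) p m = leg1 S"
      "Comp X (top S) P (base S) q m = leg2 S"
    and reg: "regular_mono X (top S) P m"
    using S unfolding pairing_regular_mono_def by blast
  obtain B f g where eqz: "is_equalizer X P B f g (top S) m"
    using reg unfolding regular_mono_def by blast
  have mem: "top S \<in> Ob X" "base S \<in> Ob X" "P \<in> Ob X" "p \<in> Hom X P (base S)" "q \<in> Hom X P (base S)"
    "B \<in> Ob X" "f \<in> Hom X P B" "g \<in> Hom X P B"
    and fg: "Comp X (top S) P B f m = Comp X (top S) P B g m"
    using P eqz by (auto simp: is_equalizer_def is_binary_product_def is_product_def all_bool_eq
        ball_UNIV split: if_splits)
  obtain u where u: "u \<in> Hom X Y P" "Comp X Y P (base S) p u = a" "Comp X Y P (base S) q u = b"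
    using binary_product_ex1[OF P Y a b] by blast
  have "fhom U P B f (fhom U Y P u y) = fhom U P B g (fhom U Y P u y)" if y: "y \<in> pts Y" for y
  proof -
    obtain z where z: "z \<in> pts (top S)" "fhom U (top S) (base S) (leg1 S) z = fhom U Y (base S) a y"
      "fhom U (top S) (base S) (leg2 S) z = fhom U Y (base S) b y"
      using ab y by (auto simp: ker_def)
    have "fhom U Y P u y = fhom U (top S) P m z"
    proof (rule binary_product_pts_eqI[OF P])
      show "fhom U Y P u y \<in> pts P" "fhom U (top S) P m z \<in> pts P"
        using u m Y mem y z by (auto intro: fhom_pts)
      show "fhom U P (base S) p (fhom U Y P u y) = fhom U P (base S) p (fhom U (top S) P m z)"
        using fhom_Comp_apply[OF u(1) mem(4) Y mem(3,2) y] fhom_Comp_apply[OF m(1) mem(4,1,3,2) z(1)]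
          u m z by simp
      show "fhom U P (base S) q (fhom U Y P u y) = fhom U P (base S) q (fhom U (top S) P m z)"
        using fhom_Comp_apply[OF u(1) mem(5) Y mem(3,2) y] fhom_Comp_apply[OF m(1) mem(5,1,3,2) z(1)]
          u m z by simp
    qed
    then show ?thesis
      using fhom_Comp_apply[OF m(1) mem(7,1,3,6) z(1)] fhom_Comp_apply[OF m(1) mem(8,1,3,6) z(1)] fg
      by simp
  qed
  then have "Comp X Y P B f u = Comp X Y P B g u"
    by (intro hom_eqI[OF category_Comp[OF category_X u(1) mem(7) Y mem(3,6)]
          category_Comp[OF category_X u(1) mem(8) Y mem(3,6)] Y mem(6)])
      (simp add: fhom_Comp_apply[OF u(1) mem(7) Y mem(3,6)] fhom_Comp_apply[OF u(1) mem(8) Y mem(3,6)])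
  then obtain h where h: "h \<in> Hom X Y (top S)" "Comp X Y (top S) P m h = u"
    using eqz Y u(1) unfolding is_equalizer_def by blast
  have "Comp X Y (top S) (base S) (leg1 S) h = a" "Comp X Y (top S) (base S) (leg2 S) h = b"
    using category_assoc[OF category_X h(1) m(1) mem(4) Y mem(1,3,2)]
      category_assoc[OF category_X h(1) m(1) mem(5) Y mem(1,3,2)] m u h by simp_all
  then show "\<exists>h\<in>Hom X Y (top S). Comp X Y (top S) (base S) (leg1 S) h = a \<and>
      Comp X Y (top S) (base S) (leg2 S) h = b"
    using h by blast
qed

section \<open>Tabulated equivalence relations\<close>

text \<open>
  The tabulation of \<open>r\<close> is the equalizer of the characteristic function of \<open>r\<close> and a constant
  function, both being morphisms from \<open>A \<times> A\<close> to an indiscrete two-point object because every map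
  into an indiscrete object underlies a morphism.
\<close>

lemma tabulates_pairing_regular_mono:
  assumes r: "r \<subseteq> pts A \<times> pts A" and tab: "tabulates A A r T p q"
  shows "pairing_regular_mono X (Parallel_Pair T A p q)"
proof -
  have mem: "A \<in> Ob X" "T \<in> Ob X" "p \<in> Hom X T A" "q \<in> Hom X T A"
    and bij: "bij_betw (\<lambda>z. (fhom U T A p z, fhom U T A q z)) (pts T) r"
    and univ: "\<And>Y a b. \<lbrakk>Y \<in> Ob X; a \<in> Hom X Y A; b \<in> Hom X Y A;
      \<forall>y\<in>pts Y. (fhom U Y A a y, fhom U Y A b y) \<in> r\<rbrakk>
      \<Longrightarrow> \<exists>u\<in>Hom X Y T. Comp X Y T A p u = a \<and> Comp X Y T A q u = b"
    using tab by (auto simp: tabulates_def)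
  obtain P p1 p2 where "tabulates A A (pts A \<times> pts A) P p1 p2"
    using tabulation_exists[OF mem(1,1)] by blast
  then have prod: "is_binary_product X A A P p1 p2"
    by (rule tabulates_is_product)
  then have P: "P \<in> Ob X" "p1 \<in> Hom X P A" "p2 \<in> Hom X P A"
    by (auto simp: is_binary_product_def is_product_def all_bool_eq ball_UNIV)
  obtain m where m: "m \<in> Hom X T P" "Comp X T P A p1 m = p" "Comp X T P A p2 m = q"
    using binary_product_ex1[OF prod mem(2-4)] by blast
  obtain a b where "a \<noteq> b" and ab: "{a, b} \<in> \<U>"
    by (rule two_points)
  obtain B where B: "B \<in> Ob X" "pts B = {a, b}"
    and into_B: "\<And>W u. W \<in> Ob X \<Longrightarrow> u \<in> pts W \<rightarrow>\<^sub>E {a, b} \<Longrightarrow> \<exists>v\<in>Hom X W B. fhom U W B v = u"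
    by (rule indiscrete[OF ab]) blast
  define \<chi> where "\<chi> = (\<lambda>w\<in>pts P. if (fhom U P A p1 w, fhom U P A p2 w) \<in> r then a else b)"
  obtain f where f: "f \<in> Hom X P B" "fhom U P B f = \<chi>"
    using into_B[OF P(1), of \<chi>] by (auto simp: \<chi>_def)
  obtain g where g: "g \<in> Hom X P B" "fhom U P B g = (\<lambda>w\<in>pts P. a)"
    using into_B[OF P(1), of "\<lambda>w\<in>pts P. a"] by auto
  have equalizes: "Comp X Y P B f h = Comp X Y P B g h \<longleftrightarrow>
      (\<forall>y\<in>pts Y. (fhom U Y A (Comp X Y P A p1 h) y, fhom U Y A (Comp X Y P A p2 h) y) \<in> r)"
    if Y: "Y \<in> Ob X" and h: "h \<in> Hom X Y P" for Y h
  proof -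
    have "Comp X Y P B f h = Comp X Y P B g h \<longleftrightarrow>
        (\<forall>y\<in>pts Y. fhom U Y B (Comp X Y P B f h) y = fhom U Y B (Comp X Y P B g h) y)"
      using hom_eqI[OF category_Comp[OF category_X h f(1) Y P(1) B(1)]
          category_Comp[OF category_X h g(1) Y P(1) B(1)] Y B(1)] by auto
    then show ?thesis
      using fhom_pts[OF h Y P(1)] \<open>a \<noteq> b\<close>
      by (simp add: fhom_Comp_apply[OF h f(1) Y P(1) B(1)] fhom_Comp_apply[OF h g(1) Y P(1) B(1)]
          fhom_Comp_apply[OF h P(2) Y P(1) mem(1)] fhom_Comp_apply[OF h P(3) Y P(1) mem(1)]
          f g \<chi>_def)
  qed
  have "is_equalizer X P B f g T m"
    unfolding is_equalizer_def
  proof (intro conjI ballI impI)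
    show "Comp X T P B f m = Comp X T P B g m"
      using equalizes[OF mem(2) m(1)] m bij_betwE[OF bij] by simp
    fix Y h assume Y: "Y \<in> Ob X" and h: "h \<in> Hom X Y P" and "Comp X Y P B f h = Comp X Y P B g h"
    then have "\<forall>y\<in>pts Y. (fhom U Y A (Comp X Y P A p1 h) y, fhom U Y A (Comp X Y P A p2 h) y) \<in> r"
      using equalizes by blast
    moreover have hp: "Comp X Y P A p1 h \<in> Hom X Y A" "Comp X Y P A p2 h \<in> Hom X Y A"
      using category_Comp[OF category_X h] Y P mem by auto
    ultimately obtain u where u: "u \<in> Hom X Y T"
      "Comp X Y T A p u = Comp X Y P A p1 h" "Comp X Y T A q u = Comp X Y P A p2 h"
      using univ[OF Y] by blast
    have p_m: "Comp X Y P A p1 (Comp X Y T P m v) = Comp X Y T A p v"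
      "Comp X Y P A p2 (Comp X Y T P m v) = Comp X Y T A q v" if "v \<in> Hom X Y T" for v
      using category_assoc[OF category_X that m(1) P(2) Y mem(2) P(1) mem(1)]
        category_assoc[OF category_X that m(1) P(3) Y mem(2) P(1) mem(1)] m by simp_all
    show "\<exists>!u. u \<in> Hom X Y T \<and> Comp X Y T P m u = h"
    proof (intro ex1I[of _ u] conjI)
      show "Comp X Y T P m u = h"
        using binary_product_ex1[OF prod Y hp] p_m[OF u(1)] u h
          category_Comp[OF category_X u(1) m(1) Y mem(2) P(1)] by metis
      show "v = u" if "v \<in> Hom X Y T \<and> Comp X Y T P m v = h" for v
        using tabulates_hom_eqI[OF tab Y _ u(1)] that p_m u by metis
    qed (rule u)
  qed (fact P B f g m mem)+
  then show ?thesis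
    unfolding pairing_regular_mono_def regular_mono_def parallel_pair.sel using prod m by blast
qed

lemma tabulates_pseudo_equivalence:
  assumes r: "equiv (pts A) r" and tab: "tabulates A A r T p q"
  shows "pseudo_equivalence X (Parallel_Pair T A p q)"
proof -
  have mem: "A \<in> Ob X" "T \<in> Ob X" "p \<in> Hom X T A" "q \<in> Hom X T A"
    and bij: "bij_betw (\<lambda>z. (fhom U T A p z, fhom U T A q z)) (pts T) r"
    and univ: "\<And>Y a b. \<lbrakk>Y \<in> Ob X; a \<in> Hom X Y A; b \<in> Hom X Y A;
      \<And>y. y \<in> pts Y \<Longrightarrow> (fhom U Y A a y, fhom U Y A b y) \<in> r\<rbrakk>
      \<Longrightarrow> \<exists>u\<in>Hom X Y T. Comp X Y T A p u = a \<and> Comp X Y T A q u = b"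
    using tab by (auto simp: tabulates_def)
  have in_r: "(fhom U T A p z, fhom U T A q z) \<in> r" if "z \<in> pts T" for z
    using bij_betwE[OF bij] that by blast
  have eq: "refl_on (pts A) r" "sym r" "trans r"
    using r by (auto elim: equivE)
  have "\<exists>u\<in>Hom X A T. Comp X A T A p u = Id X A \<and> Comp X A T A q u = Id X A"
    by (rule univ[OF mem(1)])
      (use category_Id[OF category_X mem(1)] eq(1) mem in \<open>auto simp: fhom_Id dest: refl_onD\<close>)
  moreover have "\<exists>u\<in>Hom X T T. Comp X T T A p u = q \<and> Comp X T T A q u = p"
    by (rule univ[OF mem(2,4,3)]) (use in_r eq(2) in \<open>auto dest: symD\<close>)
  moreover have "\<exists>t\<in>Hom X T2 T. Comp X T2 T A p t = Comp X T2 T A p r3 \<and>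
      Comp X T2 T A q t = Comp X T2 T A q r4"
    if "is_pullback X T T A q p T2 r3 r4" for T2 r3 r4
  proof -
    have T2: "T2 \<in> Ob X" "r3 \<in> Hom X T2 T" "r4 \<in> Hom X T2 T"
      and sq: "Comp X T2 T A q r3 = Comp X T2 T A p r4"
      using that by (auto simp: is_pullback_def)
    show ?thesis
    proof (rule univ[OF T2(1)])
      show "Comp X T2 T A p r3 \<in> Hom X T2 A" "Comp X T2 T A q r4 \<in> Hom X T2 A"
        using T2 mem category_X by (auto intro: category_Comp)
      fix y assume y: "y \<in> pts T2"
      have "(fhom U T2 A (Comp X T2 T A p r3) y, fhom U T2 A (Comp X T2 T A q r3) y) \<in> r"
        using T2 mem y in_r fhom_pts[OF T2(2,1) mem(2) y] by (simp add: fhom_Comp_apply)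
      moreover have "(fhom U T2 A (Comp X T2 T A p r4) y, fhom U T2 A (Comp X T2 T A q r4) y) \<in> r"
        using T2 mem y in_r fhom_pts[OF T2(3,1) mem(2) y] by (simp add: fhom_Comp_apply)
      ultimately show "(fhom U T2 A (Comp X T2 T A p r3) y, fhom U T2 A (Comp X T2 T A q r4) y) \<in> r"
        unfolding sq by (rule transD[OF eq(3)])
    qed
  qed
  ultimately show ?thesis
    using mem by (simp add: pseudo_equivalence_def)
qed

definition tabulator :: "'o \<times> 'u rel \<Rightarrow> ('o, 'm) parallel_pair" where
  "tabulator V = (SOME R. \<exists>T p q. R = Parallel_Pair T (fst V) p q \<and> tabulates (fst V) (fst V) (snd V) T p q)"

lemma Ob_PerC: "S \<in> Ob PerC \<longleftrightarrow> S \<in> Ob ExC \<and> pairing_regular_mono X S"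
  by (simp add: PER_RegMono_def full_subcategory_on_def)

lemma PerC_saturated: "S \<in> Ob PerC \<Longrightarrow> S \<in> Ob ExC \<and> saturated S"
  using saturated_if_pairing_regular_mono by (simp add: Ob_PerC)

lemma tabulator:
  assumes "V \<in> Ob EqC"
  shows "tabulator V \<in> Ob PerC" "under (tabulator V) = V"
proof -
  obtain A r where V: "V = (A, r)" by (cases V)
  have A: "A \<in> Ob X" and r: "equiv (pts A) r" using assms by (auto simp: V Ob_EqC)
  then have sub: "r \<subseteq> pts A \<times> pts A" by (auto elim: equivE)
  have "\<exists>R T p q. R = Parallel_Pair T (fst V) p q \<and> tabulates (fst V) (fst V) (snd V) T p q"
    using tabulation_exists[OF A A sub] by (simp add: V)
  then have "\<exists>T p q. tabulator V = Parallel_Pair T (fst V) p q \<and> tabulates (fst V) (fst V) (snd V) T p q"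
    unfolding tabulator_def by (rule someI_ex)
  then obtain T p q where *: "tabulator V = Parallel_Pair T A p q" and tab: "tabulates A A r T p q"
    by (auto simp: V)
  show "tabulator V \<in> Ob PerC"
    using tabulates_pairing_regular_mono[OF sub tab] tabulates_pseudo_equivalence[OF r tab]
    by (simp add: * Ob_PerC Ob_ExC)
  show "under (tabulator V) = V"
    using tab by (simp add: *[unfolded V] V under_def ker_def tabulates_def bij_betw_def)
qed

section \<open>The equivalence of categories and the reflector\<close>

lemma category_PerC: "category PerC"
  using category_ExC unfolding category_def PER_RegMono_def full_subcategory_on_def by simp

lemma Hom_PerC: "Hom PerC = Hom ExC" and Id_PerC: "Id PerC = Id ExC" and Comp_PerC: "Comp PerC = Comp ExC"
  by (simp_all add: PER_RegMono_def full_subcategory_on_def)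

lemma full_subcategory_PerC: "full_subcategory PerC ExC"
  unfolding full_subcategory_def using category_PerC category_ExC
  by (auto simp: PER_RegMono_def intro!: exI[of _ "{R \<in> Ob ExC. pairing_regular_mono X R}"])

text \<open>
  The following lemmas turn computations in the exact completion with morphisms into an object \<open>B\<close> of
  \<open>PER(X, RegMono)\<close> into computations in \<open>Equ\<close>. They are equalities of sets of morphisms and of
  operations, so that all functors and natural transformations below act as identities on
  morphisms into such objects.
\<close>

lemma Hom_into_PerC:
  assumes "A \<in> Ob ExC" "B \<in> Ob PerC"
  shows "Hom ExC A B = Hom EqC (under A) (under B)"
  using ex_rel_saturated[of A B] PerC_saturated[OF assms(2)] assms(1)
  by (simp add: exact_completion_def Equ_def quotient_category_def)

lemma Comp_into_PerC:
  assumes "A \<in> Ob ExC" "D \<in> Ob PerC"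
  shows "Comp ExC A B D g f = Comp EqC (under A) (under B) (under D) g f"
  using ex_rel_saturated[of A D] PerC_saturated[OF assms(2)] assms(1)
  by (simp add: exact_completion_def Equ_def quotient_category_def)

lemma Id_into_PerC:
  assumes "A \<in> Ob PerC"
  shows "Id ExC A = Id EqC (under A)"
  using ex_rel_saturated[of A A] PerC_saturated[OF assms]
  by (simp add: exact_completion_def Equ_def quotient_category_def)

lemma under_hom_into_PerC:
  assumes A: "A \<in> Ob ExC" and B: "B \<in> Ob PerC" and c: "c \<in> Hom ExC A B"
  shows "under_hom A B c = c"
proof -
  have B': "B \<in> Ob ExC" "saturated B" using PerC_saturated[OF B] by auto
  obtain f where f: "f \<in> ex_hom X A B" "c = ex_rel X A B `` {f}"
    using c Hom_ExC[OF A B'(1)] by blast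
  then show ?thesis
    using under_hom_class[OF A B'(1) f(1)] ex_rel_saturated[OF A B'] by simp
qed

lemma under_hom_Hom:
  "\<lbrakk>A \<in> Ob ExC; B \<in> Ob ExC; f \<in> Hom ExC A B\<rbrakk> \<Longrightarrow> under_hom A B f \<in> Hom EqC (under A) (under B)"
  using under_functor by (simp add: is_functor_def)

lemma Comp_under_into_PerC:
  assumes A: "A \<in> Ob ExC" and B: "B \<in> Ob ExC" and D: "D \<in> Ob PerC"
    and f: "f \<in> Hom ExC A B" and g: "g \<in> Hom ExC B D"
  shows "Comp ExC A B D g f = Comp EqC (under A) (under B) (under D) g (under_hom A B f)"
proof -
  have D': "D \<in> Ob ExC" using PerC_saturated[OF D] by simp
  have "under_hom A D (Comp ExC A B D g f) =
      Comp EqC (under A) (under B) (under D) (under_hom B D g) (under_hom A B f)"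
    using under_functor A B D' f g by (simp add: is_functor_def)
  then show ?thesis
    using under_hom_into_PerC[OF A D] under_hom_into_PerC[OF B D g]
      category_Comp[OF category_ExC f g A B D'] by simp
qed

text \<open>
  Tabulating \<open>r\<close> and then forgetting the witnesses gives back \<open>(A, r)\<close> itself. In the other direction,
  \<open>R\<close> and \<open>tabulator (under R)\<close> have the same underlying object of \<open>Equ\<close>, and the identity of that
  object is an isomorphism between them.
\<close>

theorem Equ_equivalent_PER: "equivalent_categories EqC PerC"
proof -
  note ob = PerC_saturated[THEN conjunct1] tabulator under_Ob
  let ?F = "\<lparr>fob = tabulator, fhom = \<lambda>_ _ c. c\<rparr> :: ('o \<times> 'u rel, 'm set, ('o, 'm) parallel_pair, 'm set) fct"
  let ?G = "\<lparr>fob = under, fhom = \<lambda>_ _ c. c\<rparr> :: (('o, 'm) parallel_pair, 'm set, 'o \<times> 'u rel, 'm set) fct"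
  have "is_functor EqC PerC ?F"
    unfolding is_functor_def using category_EqC category_PerC
    by (simp add: ob Hom_PerC Id_PerC Comp_PerC Hom_into_PerC Comp_into_PerC Id_into_PerC)
  moreover have "is_functor PerC EqC ?G"
    unfolding is_functor_def using category_EqC category_PerC
    by (simp add: ob Hom_PerC Id_PerC Comp_PerC Hom_into_PerC Comp_into_PerC Id_into_PerC)
  moreover have "natural_iso EqC EqC id_fct (comp_fct ?G ?F) (Id EqC)"
    unfolding natural_iso_def natural_transformation_def using category_EqC
    by (simp add: id_fct_def comp_fct_def ob category_rules iso_Id)
  moreover have "natural_iso PerC PerC (comp_fct ?F ?G) id_fct (\<lambda>R. Id EqC (under R))"
  proof -
    have "iso PerC (tabulator (under R)) R (Id EqC (under R))" if R: "R \<in> Ob PerC" for R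
      unfolding iso_def using category_EqC R
      by (auto simp: ob Hom_PerC Id_PerC Comp_PerC Hom_into_PerC Comp_into_PerC Id_into_PerC
          category_rules intro!: bexI[of _ "Id EqC (under R)"])
    then show ?thesis
      unfolding natural_iso_def natural_transformation_def using category_EqC
      by (simp add: id_fct_def comp_fct_def ob category_rules Hom_PerC Comp_PerC Hom_into_PerC
          Comp_into_PerC)
  qed
  ultimately show ?thesis
    unfolding equivalent_categories_def by blast
qed

definition reflection :: "(('o, 'm) parallel_pair, 'm set, ('o, 'm) parallel_pair, 'm set) fct" where
  "reflection = \<lparr>fob = (\<lambda>R. tabulator (under R)), fhom = under_hom\<rparr>"

definition reflection_unit :: "('o, 'm) parallel_pair \<Rightarrow> 'm set" where
  "reflection_unit R = Id EqC (under R)"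

text \<open>
  A morphism \<open>A \<rightarrow> B\<close> with \<open>B\<close> in \<open>PER(X, RegMono)\<close> is the same as a morphism \<open>under A \<rightarrow> under B\<close>, and
  \<open>under A\<close> is also the underlying object of the reflection of \<open>A\<close>. Under this identification the
  unit is an identity.
\<close>

theorem reflector_reflection: "reflector ExC PerC reflection reflection_unit"
proof -
  note ob = PerC_saturated[THEN conjunct1] tabulator under_Ob
  note into = Hom_PerC Id_PerC Comp_PerC Hom_into_PerC Comp_into_PerC Id_into_PerC
  have U: "under_hom A E (Comp ExC A B E g f) =
        Comp EqC (under A) (under B) (under E) (under_hom B E g) (under_hom A B f)"
    if "A \<in> Ob ExC" "B \<in> Ob ExC" "E \<in> Ob ExC" "f \<in> Hom ExC A B" "g \<in> Hom ExC B E" for A B E f g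
    using under_functor that by (simp add: is_functor_def)
  have U_Id: "under_hom A A (Id ExC A) = Id EqC (under A)" if "A \<in> Ob ExC" for A
    using under_functor that by (simp add: is_functor_def)
  have "is_functor ExC PerC reflection"
    unfolding is_functor_def reflection_def using category_ExC category_PerC
    by (simp add: ob into U U_Id under_hom_Hom)
  moreover have "natural_transformation ExC ExC id_fct reflection reflection_unit"
  proof -
    have unit: "reflection_unit A \<in> Hom ExC A (tabulator (under A))" if "A \<in> Ob ExC" for A
      using that category_EqC by (simp add: reflection_unit_def ob into category_Id)
    have "Comp ExC A B (tabulator (under B)) (reflection_unit B) f =
        Comp ExC A (tabulator (under A)) (tabulator (under B)) (under_hom A B f) (reflection_unit A)"
      if "A \<in> Ob ExC" "B \<in> Ob ExC" "f \<in> Hom ExC A B" for A B f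
    proof -
      have "Comp ExC A B (tabulator (under B)) (reflection_unit B) f = under_hom A B f"
        using that category_EqC under_hom_Hom[OF that] unit[OF that(2)]
        by (simp add: Comp_under_into_PerC ob reflection_unit_def category_Id_left)
      then show ?thesis
        using that category_EqC under_hom_Hom[OF that]
        by (simp add: reflection_unit_def ob into category_Id_right)
    qed
    then show ?thesis
      unfolding natural_transformation_def by (simp add: id_fct_def reflection_def unit)
  qed
  moreover have "\<exists>!g. g \<in> Hom PerC (fob reflection A) B \<and>
      Comp ExC A (fob reflection A) B g (reflection_unit A) = f"
    if "A \<in> Ob ExC" "B \<in> Ob PerC" "f \<in> Hom ExC A B" for A B f
  proof -
    have "Comp ExC A (fob reflection A) B g (reflection_unit A) = g"
      if "g \<in> Hom PerC (fob reflection A) B" for g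
      using that \<open>A \<in> _\<close> \<open>B \<in> _\<close> category_EqC
      by (simp add: reflection_def reflection_unit_def ob into category_Id_right)
    moreover have "f \<in> Hom PerC (fob reflection A) B"
      using that by (simp add: reflection_def ob into)
    ultimately show ?thesis by auto
  qed
  ultimately show ?thesis
    unfolding reflector_def using full_subcategory_PerC by blast
qed

section \<open>Limits and the reflector\<close>

text \<open>
  The embedding of \<open>X\<close> into its exact completion. Every morphism \<open>Y \<rightarrow> base R\<close> represents a morphism from
  \<open>discrete_pair Y\<close> to \<open>R\<close>; this is how maps that only respect \<open>ker R\<close> are brought into the exact
  completion.
\<close>

definition discrete_pair :: "'o \<Rightarrow> ('o, 'm) parallel_pair" where
  "discrete_pair Y = Parallel_Pair Y Y (Id X Y) (Id X Y)"

lemma discrete_pair_sel [simp]: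
  "top (discrete_pair Y) = Y" "base (discrete_pair Y) = Y"
  by (simp_all add: discrete_pair_def)

lemma discrete_pair_Ob:
  assumes "Y \<in> Ob X"
  shows "discrete_pair Y \<in> Ob ExC"
proof -
  have "\<exists>t\<in>Hom X T Y. Comp X T Y Y (Id X Y) t = Comp X T Y Y (Id X Y) a \<and>
      Comp X T Y Y (Id X Y) t = Comp X T Y Y (Id X Y) b"
    if "is_pullback X Y Y Y (Id X Y) (Id X Y) T a b" for T a b
    using that by (intro bexI[of _ a]) (auto simp: is_pullback_def)
  then show ?thesis
    unfolding Ob_ExC pseudo_equivalence_def discrete_pair_def parallel_pair.case
    using category_rules(1,3)[OF category_X] assms by blast
qed

lemma ex_hom_discrete_pair:
  assumes Y: "Y \<in> Ob X" and R: "R \<in> Ob ExC"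
  shows "ex_hom X (discrete_pair Y) R = Hom X Y (base R)"
proof (intro equalityI subsetI)
  fix f assume f: "f \<in> Hom X Y (base R)"
  have "pseudo_equivalence X R" using R by (simp add: Ob_ExC)
  then obtain h where "h \<in> Hom X Y (top R)" "Comp X Y (top R) (base R) (leg1 R) h = f"
      "Comp X Y (top R) (base R) (leg2 R) h = f"
    using pseudo_refl[OF _ f Y] by blast
  then show "f \<in> ex_hom X (discrete_pair Y) R"
    using f Y category_Id_right[OF category_X f Y] \<open>pseudo_equivalence X R\<close>
    by (auto simp: ex_hom_def discrete_pair_def pseudo_mem intro!: bexI[of _ h])
qed (auto dest: ex_hom_Hom)

text \<open>
  Regard \<open>x\<close> and \<open>x'\<close> as morphisms \<open>f\<close> and \<open>g\<close> out of the discrete point. Relatedness of points in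
  \<open>A i\<close> lifts to \<open>top (A i)\<close>, so \<open>f\<close> and \<open>g\<close> have equal composites with every \<open>p i\<close> in the exact
  completion. Joint monicity makes their classes equal, which is a witness for \<open>(x, x') \<in> ker Q\<close>.
\<close>

lemma ker_jointly_reflected:
  assumes Q: "Q \<in> Ob ExC" and A: "\<And>i. i \<in> I \<Longrightarrow> A i \<in> Ob ExC"
    and q: "\<And>i. i \<in> I \<Longrightarrow> q i \<in> ex_hom X Q (A i)"
    and p: "\<And>i. i \<in> I \<Longrightarrow> p i = ex_rel X Q (A i) `` {q i}"
    and mono: "jointly_monic ExC Q I A p"
    and x: "x \<in> pts (base Q)" "x' \<in> pts (base Q)"
    and qx: "\<And>i. i \<in> I \<Longrightarrow>
      (fhom U (base Q) (base (A i)) (q i) x, fhom U (base Q) (base (A i)) (q i) x') \<in> ker (A i)"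
  shows "(x, x') \<in> ker Q"
proof -
  have Qb: "base Q \<in> Ob X" and pQ: "pseudo_equivalence X Q" using Q by (simp_all add: Ob_ExC pseudo_mem)
  obtain D d where D: "D \<in> Ob X" "pts D = {d}"
    and disc: "\<And>Y y. Y \<in> Ob X \<Longrightarrow> y \<in> pts Y \<Longrightarrow> \<exists>f\<in>Hom X D Y. fhom U D Y f d = y"
    using discrete_point by blast
  obtain f where f: "f \<in> Hom X D (base Q)" "fhom U D (base Q) f d = x" using disc Qb x by blast
  obtain g where g: "g \<in> Hom X D (base Q)" "fhom U D (base Q) g d = x'" using disc Qb x by blast
  let ?D = "discrete_pair D"
  note DO = discrete_pair_Ob[OF D(1)] and DH = ex_hom_discrete_pair[OF D(1)]
  have fg: "f \<in> ex_hom X ?D Q" "g \<in> ex_hom X ?D Q"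
    using f g by (simp_all add: DH[OF Q])
  have "ex_rel X ?D Q `` {f} = ex_rel X ?D Q `` {g}"
  proof (rule mono[unfolded jointly_monic_def, rule_format, OF DO])
    show "ex_rel X ?D Q `` {f} \<in> Hom ExC ?D Q" "ex_rel X ?D Q `` {g} \<in> Hom ExC ?D Q"
      using fg by (auto simp: Hom_ExC[OF DO Q])
    fix i assume i: "i \<in> I"
    have pA: "pseudo_equivalence X (A i)" using A[OF i] by (simp add: Ob_ExC)
    have qH: "q i \<in> Hom X (base Q) (base (A i))" using q[OF i] by (rule ex_hom_Hom)
    note AO = A[OF i] and Ab = pseudo_mem(2)[OF pA]
    have c: "Comp X D (base Q) (base (A i)) (q i) f \<in> Hom X D (base (A i))"
      "Comp X D (base Q) (base (A i)) (q i) g \<in> Hom X D (base (A i))"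
      using category_Comp[OF category_X f(1) qH] category_Comp[OF category_X g(1) qH] D Qb Ab by auto
    have cd: "fhom U D (base (A i)) (Comp X D (base Q) (base (A i)) (q i) f) d
          = fhom U (base Q) (base (A i)) (q i) x"
      "fhom U D (base (A i)) (Comp X D (base Q) (base (A i)) (q i) g) d
          = fhom U (base Q) (base (A i)) (q i) x'"
      using fhom_Comp_apply[OF f(1) qH] fhom_Comp_apply[OF g(1) qH] D Qb Ab f g by auto
    obtain h where h: "h \<in> Hom X D (top (A i))"
      "Comp X D (top (A i)) (base (A i)) (leg1 (A i)) h = Comp X D (base Q) (base (A i)) (q i) f"
      "Comp X D (top (A i)) (base (A i)) (leg2 (A i)) h = Comp X D (base Q) (base (A i)) (q i) g"
      using ker_lift[OF pA qx[OF i] D disc c(1) cd(1) c(2) cd(2)] by blast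
    have "(Comp X D (base Q) (base (A i)) (q i) f, Comp X D (base Q) (base (A i)) (q i) g)
        \<in> ex_rel X ?D (A i)"
      by (rule ex_relI) (use c h in \<open>simp_all add: DH[OF AO]\<close>)
    then show "Comp ExC ?D Q (A i) (p i) (ex_rel X ?D Q `` {f}) =
        Comp ExC ?D Q (A i) (p i) (ex_rel X ?D Q `` {g})"
      using class_ExC_eq[OF DO AO] c
      by (simp add: p[OF i] Comp_ExC[OF DO Q AO fg(1) q[OF i]] Comp_ExC[OF DO Q AO fg(2) q[OF i]] DH[OF AO])
  qed
  then have "(f, g) \<in> ex_rel X ?D Q"
    using class_ExC_eq[OF DO Q fg(1)] by blast
  then obtain h where "h \<in> Hom X D (top Q)" "Comp X D (top Q) (base Q) (leg1 Q) h = f"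
      "Comp X D (top Q) (base Q) (leg2 Q) h = g"
    by (auto elim: ex_relE)
  from ker_hom[OF pQ D(1) this, of d] show ?thesis
    using f g D by simp
qed

text \<open>
  This carries universal properties from the exact completion to \<open>Equ\<close>. A cone \<open>h\<close> on
  \<open>(B, s)\<close> may fail to factor in the exact completion, but its restriction to \<open>discrete_pair B\<close> does,
  through some \<open>u\<close>. As \<open>q i \<cdot> u\<close> agrees with \<open>h i\<close> up to \<open>ker (A i)\<close> and \<open>ker Q\<close> is jointly
  reflected, \<open>u\<close> respects \<open>s\<close> because all \<open>h i\<close> do, and it is determined up to \<open>ker Q\<close>.
\<close>

lemma under_cone_ex1:
  assumes Q: "Q \<in> Ob ExC" and A: "\<And>i. i \<in> I \<Longrightarrow> A i \<in> Ob ExC"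
    and q: "\<And>i. i \<in> I \<Longrightarrow> q i \<in> ex_hom X Q (A i)"
    and p: "\<And>i. i \<in> I \<Longrightarrow> p i = ex_rel X Q (A i) `` {q i}"
    and mono: "jointly_monic ExC Q I A p"
    and V: "(B, s) \<in> Ob EqC"
    and h: "\<And>i. i \<in> I \<Longrightarrow> h i \<in> equ_hom X U (B, s) (under (A i))"
    and u: "u \<in> ex_hom X (discrete_pair B) Q"
    and lift: "\<And>i. i \<in> I \<Longrightarrow>
      (Comp X B (base Q) (base (A i)) (q i) u, h i) \<in> ex_rel X (discrete_pair B) (A i)"
  shows "\<exists>!c. c \<in> Hom EqC (B, s) (under Q) \<and>
    (\<forall>i\<in>I. Comp EqC (B, s) (under Q) (under (A i)) (under_hom Q (A i) (p i)) c
      = equ_rel X U (B, s) (under (A i)) `` {h i})"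
proof -
  have B: "B \<in> Ob X" "equiv (pts B) s" using V by (auto simp: Ob_EqC)
  have sB: "s \<subseteq> pts B \<times> pts B" using B(2) by (auto elim: equivE)
  have Qb: "base Q \<in> Ob X" and pQ: "pseudo_equivalence X Q" using Q by (simp_all add: Ob_ExC pseudo_mem)
  have Ab: "base (A i) \<in> Ob X" and Ae: "equiv (pts (base (A i))) (ker (A i))" if "i \<in> I" for i
    using A[OF that] by (simp_all add: Ob_ExC pseudo_mem equiv_ker)
  have tr: "(a, c) \<in> ker (A i)" if "i \<in> I" "(a, b) \<in> ker (A i)" "(b, c) \<in> ker (A i)" for i a b c
    using Ae[OF that(1)] that(2,3) by (meson equivE transD)
  have sy: "(b, a) \<in> ker (A i)" if "i \<in> I" "(a, b) \<in> ker (A i)" for i a b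
    using Ae[OF that(1)] that(2) by (meson equivE symD)
  have qH: "q i \<in> Hom X (base Q) (base (A i))" if "i \<in> I" for i
    using q[OF that] by (rule ex_hom_Hom)
  have uH: "u \<in> Hom X B (base Q)" using ex_hom_Hom[OF u] by simp
  have rel_iff: "(f, g) \<in> equ_rel X U (B, s) (under R) \<longleftrightarrow>
      f \<in> equ_hom X U (B, s) (under R) \<and> g \<in> equ_hom X U (B, s) (under R) \<and>
      (\<forall>y\<in>pts B. (fhom U B (base R) f y, fhom U B (base R) g y) \<in> ker R)" if "R \<in> Ob ExC" for R f g
    using that unfolding under_def by (intro equ_rel_iff[OF B(2)]) (simp add: Ob_ExC equiv_ker)
  have hom_iff: "f \<in> equ_hom X U (B, s) (under R) \<longleftrightarrow> f \<in> Hom X B (base R) \<and>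
      (\<forall>y y'. (y, y') \<in> s \<longrightarrow> (fhom U B (base R) f y, fhom U B (base R) f y') \<in> ker R)" for R f
    unfolding under_def by (rule equ_hom_iff)
  have reflect: "(x, x') \<in> ker Q" if "x \<in> pts (base Q)" "x' \<in> pts (base Q)"
    "\<And>i. i \<in> I \<Longrightarrow>
      (fhom U (base Q) (base (A i)) (q i) x, fhom U (base Q) (base (A i)) (q i) x') \<in> ker (A i)" for x x'
    by (rule ker_jointly_reflected[where A = A and I = I, OF Q A q p mono that])
  have qv: "fhom U B (base (A i)) (Comp X B (base Q) (base (A i)) (q i) v) y
      = fhom U (base Q) (base (A i)) (q i) (fhom U B (base Q) v y)"
    if "i \<in> I" "v \<in> Hom X B (base Q)" "y \<in> pts B" for i v y
    using fhom_Comp_apply[OF that(2) qH[OF that(1)] B(1) Qb Ab[OF that(1)] that(3)] .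
  have qu: "(fhom U (base Q) (base (A i)) (q i) (fhom U B (base Q) u y), fhom U B (base (A i)) (h i) y)
      \<in> ker (A i)" if "i \<in> I" "y \<in> pts B" for i y
    using ex_rel_under[OF discrete_pair_Ob[OF B(1)] A[OF that(1)] lift[OF that(1)]] that
    by (simp add: equ_rel_under[OF discrete_pair_Ob[OF B(1)] A] qv uH)
  have u_equ: "u \<in> equ_hom X U (B, s) (under Q)"
    unfolding hom_iff
  proof (intro conjI allI impI uH)
    fix y y' assume yy': "(y, y') \<in> s"
    then have y: "y \<in> pts B" "y' \<in> pts B" using sB by auto
    show "(fhom U B (base Q) u y, fhom U B (base Q) u y') \<in> ker Q"
    proof (rule reflect)
      fix i assume i: "i \<in> I"
      have "(fhom U B (base (A i)) (h i) y, fhom U B (base (A i)) (h i) y') \<in> ker (A i)"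
        using h[OF i] yy' by (simp add: hom_iff)
      then show "(fhom U (base Q) (base (A i)) (q i) (fhom U B (base Q) u y),
          fhom U (base Q) (base (A i)) (q i) (fhom U B (base Q) u y')) \<in> ker (A i)"
        using tr[OF i] sy[OF i] qu[OF i] y by blast
    qed (use fhom_pts[OF uH B(1) Qb] y in auto)
  qed
  have comp: "Comp EqC (B, s) (under Q) (under (A i)) (under_hom Q (A i) (p i))
        (equ_rel X U (B, s) (under Q) `` {v}) = equ_rel X U (B, s) (under (A i)) `` {h i} \<longleftrightarrow>
      (\<forall>y\<in>pts B. (fhom U (base Q) (base (A i)) (q i) (fhom U B (base Q) v y),
        fhom U B (base (A i)) (h i) y) \<in> ker (A i))"
    if i: "i \<in> I" and v: "v \<in> equ_hom X U (B, s) (under Q)" for i v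
  proof -
    have qe: "q i \<in> equ_hom X U (under Q) (under (A i))"
      by (rule ex_hom_under[OF Q A[OF i] q[OF i]])
    have vH: "v \<in> Hom X B (base Q)" using v by (simp add: hom_iff)
    have qve: "Comp X B (base Q) (base (A i)) (q i) v \<in> equ_hom X U (B, s) (under (A i))"
      unfolding hom_iff
      using category_Comp[OF category_X vH qH[OF i] B(1) Qb Ab[OF i]] v qe sB
      by (auto simp: hom_iff equ_hom_under qv[OF i vH])
    show ?thesis
      unfolding p[OF i] under_hom_class[OF Q A[OF i] q[OF i]]
        Comp_EqC[OF V under_Ob[OF Q] under_Ob[OF A[OF i]] v qe]
      using class_EqC_eq[OF V under_Ob[OF A[OF i]] qve] qve h[OF i]
      by (simp add: rel_iff[OF A[OF i]] qv[OF i vH])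
  qed
  show ?thesis
  proof (intro ex1I[of _ "equ_rel X U (B, s) (under Q) `` {u}"] conjI ballI)
    show "equ_rel X U (B, s) (under Q) `` {u} \<in> Hom EqC (B, s) (under Q)"
      using u_equ by (auto simp: Hom_EqC[OF V under_Ob[OF Q]])
    show "Comp EqC (B, s) (under Q) (under (A i)) (under_hom Q (A i) (p i))
        (equ_rel X U (B, s) (under Q) `` {u}) = equ_rel X U (B, s) (under (A i)) `` {h i}"
      if "i \<in> I" for i
      using that qu by (simp add: comp u_equ)
    fix c assume c: "c \<in> Hom EqC (B, s) (under Q) \<and>
      (\<forall>i\<in>I. Comp EqC (B, s) (under Q) (under (A i)) (under_hom Q (A i) (p i)) c
        = equ_rel X U (B, s) (under (A i)) `` {h i})"
    obtain v where v: "v \<in> equ_hom X U (B, s) (under Q)" "c = equ_rel X U (B, s) (under Q) `` {v}"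
      using Hom_EqC[OF V under_Ob[OF Q], THEN iffD1, OF conjunct1[OF c]] by blast
    have vH: "v \<in> Hom X B (base Q)" using v by (simp add: hom_iff)
    have "(fhom U B (base Q) v y, fhom U B (base Q) u y) \<in> ker Q" if y: "y \<in> pts B" for y
    proof (rule reflect)
      fix i assume i: "i \<in> I"
      have "(fhom U (base Q) (base (A i)) (q i) (fhom U B (base Q) v y),
          fhom U B (base (A i)) (h i) y) \<in> ker (A i)"
        using comp[OF i v(1)] bspec[OF conjunct2[OF c] i] y unfolding v(2) by blast
      then show "(fhom U (base Q) (base (A i)) (q i) (fhom U B (base Q) v y),
          fhom U (base Q) (base (A i)) (q i) (fhom U B (base Q) u y)) \<in> ker (A i)"
        using tr[OF i] sy[OF i] qu[OF i y] by blast
    qed (use fhom_pts[OF uH B(1) Qb] fhom_pts[OF vH B(1) Qb] y in auto)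
    then show "c = equ_rel X U (B, s) (under Q) `` {u}"
      unfolding v(2) using class_EqC_eq[OF V under_Ob[OF Q] v(1)] v(1) u_equ by (simp add: rel_iff[OF Q])
  qed
qed

theorem under_preserves_products:
  assumes P: "is_product ExC I A P p"
  shows "is_product EqC I (\<lambda>i. under (A i)) (under P) (\<lambda>i. under_hom P (A i) (p i))"
proof -
  have Ob: "P \<in> Ob ExC" "\<And>i. i \<in> I \<Longrightarrow> A i \<in> Ob ExC" and p: "\<And>i. i \<in> I \<Longrightarrow> p i \<in> Hom ExC P (A i)"
    using P by (auto simp: is_product_def)
  have "\<forall>i\<in>I. \<exists>q. q \<in> ex_hom X P (A i) \<and> p i = ex_rel X P (A i) `` {q}"
    using p Hom_ExC[OF Ob] by blast
  then obtain q where q: "\<And>i. i \<in> I \<Longrightarrow> q i \<in> ex_hom X P (A i)"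
    "\<And>i. i \<in> I \<Longrightarrow> p i = ex_rel X P (A i) `` {q i}"
    by metis
  have "\<exists>!c. c \<in> Hom EqC V (under P) \<and>
      (\<forall>i\<in>I. Comp EqC V (under P) (under (A i)) (under_hom P (A i) (p i)) c = h i)"
    if V: "V \<in> Ob EqC" and h: "\<And>i. i \<in> I \<Longrightarrow> h i \<in> Hom EqC V (under (A i))" for V h
  proof -
    obtain B s where Vd: "V = (B, s)" by (cases V)
    have B: "B \<in> Ob X" using V by (simp add: Vd Ob_EqC)
    note DO = discrete_pair_Ob[OF B] and DH = ex_hom_discrete_pair[OF B]
    have "\<forall>i\<in>I. \<exists>k. k \<in> equ_hom X U V (under (A i)) \<and> h i = equ_rel X U V (under (A i)) `` {k}"
      using h Hom_EqC[OF V under_Ob[OF Ob(2)]] by blast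
    then obtain k where k: "\<And>i. i \<in> I \<Longrightarrow> k i \<in> equ_hom X U V (under (A i))"
      "\<And>i. i \<in> I \<Longrightarrow> h i = equ_rel X U V (under (A i)) `` {k i}"
      by metis
    have kD: "k i \<in> ex_hom X (discrete_pair B) (A i)" if "i \<in> I" for i
      using k(1)[OF that] by (simp add: DH[OF Ob(2)[OF that]] Vd under_def equ_hom_iff)
    have "\<exists>!u. u \<in> Hom ExC (discrete_pair B) P \<and>
        (\<forall>i\<in>I. Comp ExC (discrete_pair B) P (A i) (p i) u = ex_rel X (discrete_pair B) (A i) `` {k i})"
      by (rule is_product_ex1[OF P DO]) (use kD Hom_ExC[OF DO Ob(2)] in blast)
    then obtain u' where u': "u' \<in> Hom ExC (discrete_pair B) P"
      "\<And>i. i \<in> I \<Longrightarrow> Comp ExC (discrete_pair B) P (A i) (p i) u' = ex_rel X (discrete_pair B) (A i) `` {k i}"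
      by blast
    then obtain u where u: "u \<in> ex_hom X (discrete_pair B) P" "u' = ex_rel X (discrete_pair B) P `` {u}"
      using Hom_ExC[OF DO Ob(1)] by blast
    have "(Comp X B (base P) (base (A i)) (q i) u, k i) \<in> ex_rel X (discrete_pair B) (A i)"
      if i: "i \<in> I" for i
    proof -
      have "Comp X B (base P) (base (A i)) (q i) u \<in> ex_hom X (discrete_pair B) (A i)"
        using ex_hom_Comp[OF _ _ _ u(1) q(1)[OF i]] DO Ob i by (simp add: Ob_ExC)
      then show ?thesis
        using u'(2)[OF i] Comp_ExC[OF DO Ob(1) Ob(2)[OF i] u(1) q(1)[OF i]]
          class_ExC_eq[OF DO Ob(2)[OF i]] by (simp add: u(2) q(2)[OF i])
    qed
    from under_cone_ex1[where I = I and A = A, OF Ob q is_product_jointly_monic[OF category_ExC P]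
        V[unfolded Vd] k(1)[unfolded Vd] u(1) this]
    show ?thesis
      using k(2) by (simp add: Vd cong: ball_cong)
  qed
  then show ?thesis
    unfolding is_product_def using Ob p by (simp add: under_Ob under_hom_Hom)
qed

text \<open>
  A cone over the cospan in \<open>Equ\<close> commutes only up to \<open>ker J\<close>. Saturation of \<open>J\<close> turns this into
  commutation in the exact completion of the cone restricted to \<open>discrete_pair B\<close>; this is the point
  where the common codomain has to lie in \<open>PER(X, RegMono)\<close>.
\<close>

theorem under_preserves_pullbacks:
  assumes J: "J \<in> Ob PerC" and pb: "is_pullback ExC A K J f k Q q1 q2"
  shows "is_pullback EqC (under A) (under K) (under J) (under_hom A J f) (under_hom K J k)
    (under Q) (under_hom Q A q1) (under_hom Q K q2)"
proof -
  have Ob: "A \<in> Ob ExC" "K \<in> Ob ExC" "J \<in> Ob ExC" "Q \<in> Ob ExC"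
    and hom: "f \<in> Hom ExC A J" "k \<in> Hom ExC K J" "q1 \<in> Hom ExC Q A" "q2 \<in> Hom ExC Q K"
    and sq: "Comp ExC Q A J f q1 = Comp ExC Q K J k q2"
    using pb by (auto simp: is_pullback_def)
  obtain f0 where f0: "f0 \<in> ex_hom X A J" "f = ex_rel X A J `` {f0}"
    using hom(1) Hom_ExC[OF Ob(1,3)] by blast
  obtain k0 where k0: "k0 \<in> ex_hom X K J" "k = ex_rel X K J `` {k0}"
    using hom(2) Hom_ExC[OF Ob(2,3)] by blast
  obtain r1 where r1: "r1 \<in> ex_hom X Q A" "q1 = ex_rel X Q A `` {r1}"
    using hom(3) Hom_ExC[OF Ob(4,1)] by blast
  obtain r2 where r2: "r2 \<in> ex_hom X Q K" "q2 = ex_rel X Q K `` {r2}"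
    using hom(4) Hom_ExC[OF Ob(4,2)] by blast
  let ?A = "\<lambda>i. if i then A else K" and ?r = "\<lambda>i. if i then r1 else r2"
  have r: "?r i \<in> ex_hom X Q (?A i)" and AO: "?A i \<in> Ob ExC" for i
    using r1 r2 Ob by auto
  let ?q = "\<lambda>i. if i then q1 else q2"
  have q: "?q i = ex_rel X Q (?A i) `` {?r i}" for i
    using r1(2) r2(2) by simp
  have mono: "jointly_monic ExC Q UNIV ?A ?q"
    using is_pullback_eqI[OF category_ExC pb] by (simp add: jointly_monic_def all_bool_eq ball_UNIV)
  have "\<exists>!c. c \<in> Hom EqC V (under Q) \<and>
      Comp EqC V (under Q) (under A) (under_hom Q A q1) c = a \<and>
      Comp EqC V (under Q) (under K) (under_hom Q K q2) c = b"
    if V: "V \<in> Ob EqC" and ab: "a \<in> Hom EqC V (under A)" "b \<in> Hom EqC V (under K)"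
      and fa: "Comp EqC V (under A) (under J) (under_hom A J f) a =
        Comp EqC V (under K) (under J) (under_hom K J k) b" for V a b
  proof -
    obtain B s where Vd: "V = (B, s)" by (cases V)
    have B: "B \<in> Ob X" "equiv (pts B) s" using V by (simp_all add: Vd Ob_EqC)
    let ?D = "discrete_pair B"
    note DO = discrete_pair_Ob[OF B(1)] and DH = ex_hom_discrete_pair[OF B(1)]
    obtain a0 where a0: "a0 \<in> equ_hom X U V (under A)" "a = equ_rel X U V (under A) `` {a0}"
      using ab(1) Hom_EqC[OF V under_Ob[OF Ob(1)]] by blast
    obtain b0 where b0: "b0 \<in> equ_hom X U V (under K)" "b = equ_rel X U V (under K) `` {b0}"
      using ab(2) Hom_EqC[OF V under_Ob[OF Ob(2)]] by blast
    have abD: "a0 \<in> ex_hom X ?D A" "b0 \<in> ex_hom X ?D K"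
      using a0 b0 by (simp_all add: DH Ob Vd under_def equ_hom_iff)
    let ?fa = "Comp X B (base A) (base J) f0 a0" and ?kb = "Comp X B (base K) (base J) k0 b0"
    have fk: "?fa \<in> ex_hom X ?D J" "?kb \<in> ex_hom X ?D J"
      using ex_hom_Comp[OF _ _ _ abD(1) f0(1)] ex_hom_Comp[OF _ _ _ abD(2) k0(1)] DO Ob
      by (simp_all add: Ob_ExC)
    have "equ_rel X U V (under J) `` {?fa} = equ_rel X U V (under J) `` {?kb}"
      using fa Comp_EqC[OF V under_Ob[OF Ob(1)] under_Ob[OF Ob(3)] a0(1) ex_hom_under[OF Ob(1,3) f0(1)]]
        Comp_EqC[OF V under_Ob[OF Ob(2)] under_Ob[OF Ob(3)] b0(1) ex_hom_under[OF Ob(2,3) k0(1)]]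
      by (simp add: a0(2) b0(2) f0(2) k0(2) under_hom_class[OF Ob(1,3) f0(1)]
          under_hom_class[OF Ob(2,3) k0(1)] Vd)
    moreover have "?fa \<in> equ_hom X U V (under J)"
    proof -
      note H = ex_hom_Hom[OF f0(1)] 
      have "a0 \<in> Hom X B (base A)" "base A \<in> Ob X" "base J \<in> Ob X" "s \<subseteq> pts B \<times> pts B"
        using a0(1) Ob B(2) by (auto simp: Vd under_def equ_hom_iff Ob_ExC pseudo_mem elim: equivE)
      then show ?thesis
        using ex_hom_under[OF Ob(1,3) f0(1)] a0(1) H B(1) category_X
        by (auto simp: Vd under_def equ_hom_iff fhom_Comp_apply category_Comp)
    qed
    ultimately have "(?fa, ?kb) \<in> equ_rel X U V (under J)"
      using class_EqC_eq[OF V under_Ob[OF Ob(3)]] by blast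
    then have "\<forall>y\<in>pts B. (fhom U B (base J) ?fa y, fhom U B (base J) ?kb y) \<in> ker J"
      using Ob(3) by (simp add: Vd under_def equ_rel_iff B(2) equiv_ker Ob_ExC)
    then have "(?fa, ?kb) \<in> ex_rel X ?D J"
      using fk[THEN ex_hom_under[OF DO Ob(3)]] PerC_saturated[OF J]
      by (simp add: ex_rel_saturated[OF DO] equ_rel_under[OF DO])
    then have "Comp ExC ?D A J f (ex_rel X ?D A `` {a0}) = Comp ExC ?D K J k (ex_rel X ?D K `` {b0})"
      using class_ExC_eq[OF DO Ob(3) fk(1)] Comp_ExC[OF DO Ob(1,3) abD(1) f0(1)]
        Comp_ExC[OF DO Ob(2,3) abD(2) k0(1)] by (simp add: f0(2) k0(2))
    moreover have "ex_rel X ?D A `` {a0} \<in> Hom ExC ?D A" "ex_rel X ?D K `` {b0} \<in> Hom ExC ?D K"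
      using abD Hom_ExC[OF DO Ob(1)] Hom_ExC[OF DO Ob(2)] by blast+
    ultimately obtain u' where u': "u' \<in> Hom ExC ?D Q" "Comp ExC ?D Q A q1 u' = ex_rel X ?D A `` {a0}"
      "Comp ExC ?D Q K q2 u' = ex_rel X ?D K `` {b0}"
      using pb DO unfolding is_pullback_def by blast
    then obtain u where u: "u \<in> ex_hom X ?D Q" "u' = ex_rel X ?D Q `` {u}"
      using Hom_ExC[OF DO Ob(4)] by blast
    let ?h = "\<lambda>i. if i then a0 else b0"
    have h: "?h i \<in> equ_hom X U (B, s) (under (?A i))" for i
      using a0 b0 by (simp add: Vd)
    have "(Comp X B (base Q) (base (?A i)) (?r i) u, ?h i) \<in> ex_rel X ?D (?A i)" for i
    proof -
      have "Comp X B (base Q) (base (?A i)) (?r i) u \<in> ex_hom X ?D (?A i)"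
        using ex_hom_Comp[OF _ _ _ u(1) r] DO Ob AO by (simp add: Ob_ExC)
      moreover have "Comp ExC ?D Q (?A i) (ex_rel X Q (?A i) `` {?r i}) u' = ex_rel X ?D (?A i) `` {?h i}"
        using u'(2,3) by (simp flip: q)
      ultimately show ?thesis
        using Comp_ExC[OF DO Ob(4) AO u(1) r] class_ExC_eq[OF DO AO] u(2) discrete_pair_sel by metis
    qed
    from under_cone_ex1[where I = UNIV and A = ?A and q = ?r and h = ?h,
        OF Ob(4) AO r q mono V[unfolded Vd] h u(1) this]
    show ?thesis
      using a0(2) b0(2) by (simp add: Vd all_bool_eq ball_UNIV)
  qed
  moreover have "Comp EqC (under Q) (under A) (under J) (under_hom A J f) (under_hom Q A q1) =
      Comp EqC (under Q) (under K) (under J) (under_hom K J k) (under_hom Q K q2)"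
    using under_functor Ob hom sq unfolding is_functor_def by (metis fct.select_convs)
  ultimately show ?thesis
    unfolding is_pullback_def using Ob hom by (simp add: under_Ob under_hom_Hom)
qed

text \<open>
  Product cones in \<open>PER(X, RegMono)\<close> and in \<open>Equ\<close> are tested by the same sets of morphisms.
\<close>

lemma reflection_preserves_products:
  assumes P: "is_product ExC I A P p"
  shows "is_product PerC I (\<lambda>i. fob reflection (A i)) (fob reflection P) (\<lambda>i. fhom reflection P (A i) (p i))"
proof -
  note ob = PerC_saturated[THEN conjunct1] tabulator under_Ob
  note into = Hom_PerC Id_PerC Comp_PerC Hom_into_PerC Comp_into_PerC Id_into_PerC
  have "P \<in> Ob ExC" "\<And>i. i \<in> I \<Longrightarrow> A i \<in> Ob ExC" "\<And>i. i \<in> I \<Longrightarrow> p i \<in> Hom ExC P (A i)"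
    using P by (auto simp: is_product_def)
  then show ?thesis
    using under_preserves_products[OF P]
    unfolding is_product_def reflection_def
    by (simp add: ob into under_hom_Hom cong: ball_cong conj_cong)
qed

text \<open>
  As \<open>J\<close> and \<open>K\<close> lie in \<open>PER(X, RegMono)\<close>, the morphisms \<open>f\<close> and \<open>q2\<close> are their own transposes, which
  is why they occur unchanged in the conclusion.
\<close>

lemma reflection_preserves_pullbacks:
  assumes J: "J \<in> Ob PerC" and K: "K \<in> Ob PerC" and pb: "is_pullback ExC A K J f k Q q1 q2"
  shows "is_pullback ExC (fob reflection A) K J f k (fob reflection Q) (fhom reflection Q A q1) q2"
proof -
  note ob = PerC_saturated[THEN conjunct1] tabulator under_Ob
  note into = Hom_into_PerC Comp_into_PerC
  have Ob: "A \<in> Ob ExC" "K \<in> Ob ExC" "J \<in> Ob ExC" "Q \<in> Ob ExC"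
    and hom: "f \<in> Hom ExC A J" "k \<in> Hom ExC K J" "q1 \<in> Hom ExC Q A" "q2 \<in> Hom ExC Q K"
    using pb by (auto simp: is_pullback_def)
  have "is_pullback EqC (under A) (under K) (under J) f k (under Q) (under_hom Q A q1) q2"
    using under_preserves_pullbacks[OF J pb] Ob hom J K by (simp add: under_hom_into_PerC)
  then show ?thesis
    using Ob J K unfolding is_pullback_def reflection_def
    by (simp add: ob into cong: ball_cong)
qed

theorem reflector_preserves_finite_products:
  assumes R: "reflector ExC PerC R \<eta>"
  shows "preserves_finite_products ExC PerC R"
  unfolding preserves_finite_products_def
proof (intro allI impI)
  fix I :: "nat set" and A P p
  assume P: "is_product ExC I A P p"
  then have Ob: "P \<in> Ob ExC" "\<And>i. i \<in> I \<Longrightarrow> A i \<in> Ob ExC" and p: "\<And>i. i \<in> I \<Longrightarrow> p i \<in> Hom ExC P (A i)"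
    by (auto simp: is_product_def)
  obtain \<theta> where \<theta>: "\<forall>A\<in>Ob ExC. iso ExC (fob R A) (fob reflection A) (\<theta> A) \<and>
      Comp ExC A (fob R A) (fob reflection A) (\<theta> A) (\<eta> A) = reflection_unit A \<and>
      (\<forall>B\<in>Ob ExC. \<forall>f\<in>Hom ExC A B.
        Comp ExC (fob R A) (fob R B) (fob reflection B) (\<theta> B) (fhom R A B f) =
        Comp ExC (fob R A) (fob reflection A) (fob reflection B) (fhom reflection A B f) (\<theta> A))"
    using reflectors_iso[OF R reflector_reflection] by blast
  have F: "\<And>A. A \<in> Ob ExC \<Longrightarrow> fob R A \<in> Ob PerC"
    "\<And>A B f. \<lbrakk>A \<in> Ob ExC; B \<in> Ob ExC; f \<in> Hom ExC A B\<rbrakk> \<Longrightarrow> fhom R A B f \<in> Hom PerC (fob R A) (fob R B)"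
    using R by (auto simp: reflector_def is_functor_def)
  have iso: "iso PerC B C g \<longleftrightarrow> iso ExC B C g" for B C g
    by (simp add: iso_def Hom_PerC Comp_PerC Id_PerC)
  show "is_product PerC I (\<lambda>i. fob R (A i)) (fob R P) (\<lambda>i. fhom R P (A i) (p i))"
    by (rule is_product_iso[OF category_PerC reflection_preserves_products[OF P],
          where \<alpha> = "\<theta> P" and \<beta> = "\<lambda>i. \<theta> (A i)"])
      (use \<theta> F Ob p in \<open>simp_all add: iso Comp_PerC\<close>)
qed

theorem reflector_commutes_with_codomain_base_change:
  assumes R: "reflector ExC PerC R \<eta>"
  shows "commutes_with_codomain_base_change ExC PerC R \<eta>"
  unfolding commutes_with_codomain_base_change_def
proof (intro ballI allI impI)
  fix J K k A f Q q1 q2 f' q2' T t1 t2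
  assume J: "J \<in> Ob PerC" and K: "K \<in> Ob PerC" and k: "k \<in> Hom PerC K J"
    and A: "A \<in> Ob ExC" and f: "f \<in> Hom ExC A J" and pb: "is_pullback ExC A K J f k Q q1 q2"
    and f': "f' \<in> Hom PerC (fob R A) J" "Comp ExC A (fob R A) J f' (\<eta> A) = f"
    and q2': "q2' \<in> Hom PerC (fob R Q) K" "Comp ExC Q (fob R Q) K q2' (\<eta> Q) = q2"
    and T: "is_pullback ExC (fob R A) K J f' k T t1 t2"
  have Q: "Q \<in> Ob ExC" and q: "q1 \<in> Hom ExC Q A" "q2 \<in> Hom ExC Q K"
    using pb by (auto simp: is_pullback_def)
  obtain \<theta> where \<theta>: "\<forall>A\<in>Ob ExC. iso ExC (fob R A) (fob reflection A) (\<theta> A) \<and>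
      Comp ExC A (fob R A) (fob reflection A) (\<theta> A) (\<eta> A) = reflection_unit A \<and>
      (\<forall>B\<in>Ob ExC. \<forall>f\<in>Hom ExC A B.
        Comp ExC (fob R A) (fob R B) (fob reflection B) (\<theta> B) (fhom R A B f) =
        Comp ExC (fob R A) (fob reflection A) (fob reflection B) (fhom reflection A B f) (\<theta> A))"
    using reflectors_iso[OF R reflector_reflection] by blast
  have F: "\<And>A. A \<in> Ob ExC \<Longrightarrow> fob R A \<in> Ob ExC" "\<And>A. A \<in> Ob ExC \<Longrightarrow> \<eta> A \<in> Hom ExC A (fob R A)"
    "\<And>A B f. \<lbrakk>A \<in> Ob ExC; B \<in> Ob ExC; f \<in> Hom ExC A B\<rbrakk> \<Longrightarrow> fhom R A B f \<in> Hom ExC (fob R A) (fob R B)"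
    using R by (auto simp: reflector_def is_functor_def natural_transformation_def id_fct_def
        Ob_PerC Hom_PerC)
  \<comment> \<open>Transposes along \<open>\<eta>\<close> differ from those along \<open>reflection_unit\<close> by \<open>\<theta>\<close>.\<close>
  have transpose: "g' = Comp ExC (fob R C) (fob reflection C) B g (\<theta> C)"
    if C: "C \<in> Ob ExC" and B: "B \<in> Ob PerC" and g: "g \<in> Hom ExC C B"
      and g': "g' \<in> Hom PerC (fob R C) B" "Comp ExC C (fob R C) B g' (\<eta> C) = g" for C B g g'
  proof -
    note ob = PerC_saturated[THEN conjunct1] tabulator under_Ob
    have B': "B \<in> Ob ExC" using PerC_saturated[OF B] by simp
    have rC: "fob reflection C \<in> Ob ExC" "g \<in> Hom ExC (fob reflection C) B"
      using C B g by (simp_all add: reflection_def ob Hom_into_PerC)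
    have unit: "Comp ExC C (fob reflection C) B g (reflection_unit C) = g"
      using C B g category_EqC
      by (simp add: reflection_def reflection_unit_def ob Hom_into_PerC Comp_into_PerC category_Id_right)
    have \<theta>C: "\<theta> C \<in> Hom ExC (fob R C) (fob reflection C)"
      using \<theta> C by (simp add: iso_def)
    have "Comp ExC C (fob R C) B (Comp ExC (fob R C) (fob reflection C) B g (\<theta> C)) (\<eta> C) = g"
      using category_assoc[OF category_ExC F(2)[OF C] \<theta>C rC(2) C F(1)[OF C] rC(1) B'] \<theta> C unit by simp
    moreover have "Comp ExC (fob R C) (fob reflection C) B g (\<theta> C) \<in> Hom PerC (fob R C) B"
      using category_Comp[OF category_ExC \<theta>C rC(2) F(1)[OF C] rC(1) B'] by (simp add: Hom_PerC)
    moreover have "\<exists>!k. k \<in> Hom PerC (fob R C) B \<and> Comp ExC C (fob R C) B k (\<eta> C) = g"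
      using R C B g by (simp add: reflector_def)
    ultimately show ?thesis
      using g' by blast
  qed
  have "is_pullback ExC (fob R A) K J f' k (fob R Q) (fhom R Q A q1) q2'"
    by (rule is_pullback_iso[OF category_ExC reflection_preserves_pullbacks[OF J K pb],
          where \<alpha> = "\<theta> Q" and \<beta> = "\<theta> A"])
      (use \<theta> F A Q q transpose[OF A J f f'] transpose[OF Q K q(2) q2'] in simp_all)
  then show "\<exists>c\<in>Hom ExC (fob R Q) T. Comp ExC (fob R Q) T (fob R A) t1 c = fhom R Q A q1 \<and>
      Comp ExC (fob R Q) T K t2 c = q2' \<and> iso ExC (fob R Q) T c"
    using pullback_comparison_iso[OF category_ExC _ T] by blast
qed

end

theorem theorem2p1:
  fixes X :: "('o, 'm) cat"
    and U :: "('o, 'm, 'u set, 'u \<Rightarrow> 'u) fct"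
    and \<U> :: "'u set set"
  assumes "set_universe \<U>"
    and "topological_functor X (Set_cat \<U>) U"
  shows "equivalent_categories (Equ X U) (PER_RegMono X)
    \<and> full_reflective_subcategory (PER_RegMono X) (exact_completion X)
    \<and> (\<forall>R \<eta>. reflector (exact_completion X) (PER_RegMono X) R \<eta> \<longrightarrow>
          preserves_finite_products (exact_completion X) (PER_RegMono X) R
        \<and> commutes_with_codomain_base_change (exact_completion X) (PER_RegMono X) R \<eta>)"
proof -
  interpret topological_over_sets X U \<U>
    using assms by unfold_locales
  show ?thesis
    using Equ_equivalent_PER full_subcategory_PerC reflector_reflection
      reflector_preserves_finite_products reflector_commutes_with_codomain_base_change
    unfolding full_reflective_subcategory_def by blast
qed

end
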